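(* There exists a constant $\mathbf{c}=\mathbf{c}(n,r_0,\vartheta,d)>0$ such that for all $m\in \mathbb{N}$, $\lambda \in \Lambda$, $\tilde{q}\in \tilde{Q}$, $\tilde{u}\in W^{2,p}(\Omega)\cap \tilde{O}_m$ and $0<\eta < \frac{\rho}{4}$, we have \[ \mathbf{c}\|\tilde{u}\|_{L^2(B_{d\rho/2}(x_0))}\le \eta^{-\lambda}\|(\Delta+\tilde{q}) \tilde{u}\|_{L^p(B_d(x_0))} + 2^{-(\lambda+1)}\|(\Delta+\tilde{q}) (\tilde{\phi} \tilde{u})\|_{L^{p}(B_d(x_0))}+(3d)^m\eta^{m-(\lambda+3)}\tilde{\varrho}_m(\tilde{u}). \]
   Context: Let $n\ge 3$ be an integer, $p:=\frac{2n}{n+2}$, $p':=\frac{2n}{n-2}$. $B_r(x_0)\subset\mathbb{R}^n$ is the open ball centered at $x_0$ with radius $r>0$, $B_r:=B_r(0)$, $B:=B_1$, $\dot B:=B\setminus\{0\}$; $\mathbb{N}$ is the set of positive integers. Let $\mathbf{B}_r$ be the closed ball of $L^{n/2}(B)$ centered at $0$ with radius $r>0$. $\Lambda:=\{\lambda>0:\ \mathrm{dist}(\lambda,\mathbb{N}+\frac{n-2}{2})=\frac12\}$. $r_\ast=r_\ast(n)>0$ is a constant (such a constant exists) with the property that for every $0<r_0<r_\ast$ there is $\kappa_0=\kappa_0(n,r_0)>0$ such that $\||x|^{-\lambda}u\|_{L^{p'}(B)}\le \kappa_0\||x|^{-\lambda}(\Delta+q)u\|_{L^p(B)}$ for all $u\in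 C_0^\infty(\dot B)$, $q\in\mathbf{B}_{r_0}$, $\lambda\in\Lambda$. $\sigma:=\sup\{\|w\|_{L^{p'}(B)}:\ w\in H_0^1(B),\ \|\nabla w\|_{L^2(B)}=1\}$. Fix $0<r_0<r_\ast$ and $\vartheta>0$ with $2\vartheta\sigma^2<1$; set $\varsigma:=\inf(r_0,\vartheta)$. Let $\Omega$ be a bounded domain of $\mathbb{R}^n$, $x_0\in\Omega$, $d:=\mathrm{dist}(x_0,\mathbb{R}^n\setminus\Omega)$, and $\tilde{Q}:=\{\tilde q\in L^{n/2}(\Omega):\ \|\tilde q\|_{L^{n/2}(B_d(x_0))}\le\varsigma\}$. For $\tilde u\in L^2(\Omega)$ and $m\in\mathbb{N}$ set $\tilde\varrho_m(\tilde u):=\sup\{\eta^{-m}\|\tilde u\|_{L^2(B_\eta(x_0))}:\ 0<\eta<d\}$ and $\tilde O_m:=\{\tilde u\in L^2(\Omega):\ \tilde\varrho_m(\tilde u)<\infty\}$. Fix arbitrarily $0<\rho<\frac12$ and $\phi\in C_0^\infty(B)$ with $\phi=1$ in $B_{1/2}$ and $0\le\phi\le1$; set $\tilde\phi(y):=\phi\left(\frac{y-x_0}{d}\right)$, $y\in B_d(x_0)$. *)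

theory Defs
  imports "HOL-Analysis.Analysis"
begin

text \<open>
  \<open>L\<^sup>p\<close> norms take values in \<^typ>\<open>ennreal\<close>, so that no integrability is hidden in default values.
  The space \<open>\<real>\<^sup>n\<close> is \<^typ>\<open>real^'n\<close>; functions on a subset of it are total functions
  whose values outside the subset are irrelevant, and elements of Lebesgue spaces are represented
  by functions rather than by classes modulo null sets.  All functions are real-valued.
\<close>

definition ennreal_root :: "real \<Rightarrow> ennreal \<Rightarrow> ennreal" where
  "ennreal_root p x = (if x = \<infinity> then \<infinity> else ennreal (enn2real x powr (1 / p)))"

definition Lnorm :: "real \<Rightarrow> (real^'n) set \<Rightarrow> (real^'n \<Rightarrow> 'b::real_normed_vector) \<Rightarrow> ennreal" where
  "Lnorm p S f = ennreal_root p (\<integral>\<^sup>+x. ennreal (norm (f x) powr p) \<partial>lebesgue_on S)"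

definition Lspace :: "real \<Rightarrow> (real^'n) set \<Rightarrow> (real^'n \<Rightarrow> real) set" where
  "Lspace p S = {f \<in> borel_measurable (lebesgue_on S). Lnorm p S f < \<infinity>}"

definition pderiv_at :: "'n \<Rightarrow> (real^'n \<Rightarrow> real) \<Rightarrow> real^'n \<Rightarrow> real" where
  "pderiv_at i f x = frechet_derivative f (at x) (axis i 1)"

definition lap :: "(real^'n \<Rightarrow> real) \<Rightarrow> real^'n \<Rightarrow> real" where
  "lap f x = (\<Sum>i\<in>UNIV. pderiv_at i (pderiv_at i f) x)"

primrec Ck :: "nat \<Rightarrow> (real^'n \<Rightarrow> real) \<Rightarrow> bool" where
  "Ck 0 f \<longleftrightarrow> continuous_on UNIV f"
| "Ck (Suc k) f \<longleftrightarrow> f differentiable_on UNIV \<and> (\<forall>i. Ck k (pderiv_at i f))"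

text \<open>\<open>C\<^sub>0\<^sup>\<infinity>(S)\<close>, its elements being extended by zero to the whole space.\<close>

definition test_functions :: "(real^'n) set \<Rightarrow> (real^'n \<Rightarrow> real) set" where
  "test_functions S = {f. (\<forall>k. Ck k f) \<and> compact (closure {x. f x \<noteq> 0}) \<and> closure {x. f x \<noteq> 0} \<subseteq> S}"

definition locally_integrable :: "(real^'n) set \<Rightarrow> (real^'n \<Rightarrow> real) \<Rightarrow> bool" where
  "locally_integrable S f \<longleftrightarrow> (\<forall>K. compact K \<and> K \<subseteq> S \<longrightarrow> set_integrable lebesgue K f)"

definition is_weak_deriv :: "(real^'n) set \<Rightarrow> 'n \<Rightarrow> (real^'n \<Rightarrow> real) \<Rightarrow> (real^'n \<Rightarrow> real) \<Rightarrow> bool" where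
  "is_weak_deriv S i u g \<longleftrightarrow> locally_integrable S u \<and> locally_integrable S g \<and>
     (\<forall>\<psi>\<in>test_functions S.
        (LINT x:S|lebesgue. u x * pderiv_at i \<psi> x) = - (LINT x:S|lebesgue. g x * \<psi> x))"

text \<open>
  The weak derivative is unique up to null sets of an open set \<open>S\<close>; the choice of the representative
  does not matter, because it is only used inside integrals over subsets of \<open>S\<close>.
\<close>

definition weak_deriv :: "(real^'n) set \<Rightarrow> 'n \<Rightarrow> (real^'n \<Rightarrow> real) \<Rightarrow> real^'n \<Rightarrow> real" where
  "weak_deriv S i u = (SOME g. is_weak_deriv S i u g)"

definition weak_grad :: "(real^'n) set \<Rightarrow> (real^'n \<Rightarrow> real) \<Rightarrow> real^'n \<Rightarrow> real^'n" where
  "weak_grad S u x = (\<chi> i. weak_deriv S i u x)"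

definition weak_lap :: "(real^'n) set \<Rightarrow> (real^'n \<Rightarrow> real) \<Rightarrow> real^'n \<Rightarrow> real" where
  "weak_lap S u x = (\<Sum>i\<in>UNIV. weak_deriv S i (weak_deriv S i u) x)"

text \<open>The Sobolev space \<open>W\<^bsup>k,p\<^esup>(S)\<close>.\<close>

primrec sobolev :: "nat \<Rightarrow> real \<Rightarrow> (real^'n) set \<Rightarrow> (real^'n \<Rightarrow> real) set" where
  "sobolev 0 p S = Lspace p S"
| "sobolev (Suc k) p S = {u \<in> Lspace p S. \<forall>i. \<exists>g \<in> sobolev k p S. is_weak_deriv S i u g}"

text \<open>\<open>H\<^sup>1\<^sub>0(S)\<close>: the closure of \<open>C\<^sub>0\<^sup>\<infinity>(S)\<close> in \<open>H\<^sup>1(S) = W\<^bsup>1,2\<^esup>(S)\<close>.\<close>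

definition H1_0 :: "(real^'n) set \<Rightarrow> (real^'n \<Rightarrow> real) set" where
  "H1_0 S = {w \<in> sobolev 1 2 S. \<forall>\<epsilon>>0. \<exists>\<psi>\<in>test_functions S.
     Lnorm 2 S (\<lambda>x. w x - \<psi> x) < ennreal \<epsilon> \<and>
     Lnorm 2 S (weak_grad S (\<lambda>x. w x - \<psi> x)) < ennreal \<epsilon>}"

definition crit_p :: "nat \<Rightarrow> real" where
  "crit_p n = 2 * real n / (real n + 2)"

definition crit_p' :: "nat \<Rightarrow> real" where
  "crit_p' n = 2 * real n / (real n - 2)"

definition Lambda :: "nat \<Rightarrow> real set" where
  "Lambda n = {\<tau>. \<tau> > 0 \<and> infdist \<tau> {real k + (real n - 2) / 2 |k. k \<ge> 1} = 1 / 2}"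

text \<open>
  \<open>carleman TYPE('n) r \<kappa>\<close>: the Carleman inequality on the punctured unit ball holds with constant \<open>\<kappa>\<close>,
  uniformly for potentials in the closed ball of radius \<open>r\<close> of \<open>L\<^bsup>n/2\<^esup>(B)\<close> and for
  weight exponents \<open>\<tau>\<close> in \<open>\<Lambda>\<close>.
\<close>

definition carleman :: "'n::finite itself \<Rightarrow> real \<Rightarrow> real \<Rightarrow> bool" where
  "carleman _ r \<kappa> \<longleftrightarrow>
     (\<forall>u \<in> test_functions (ball (0::real^'n) 1 - {0}).
      \<forall>q \<in> Lspace (real CARD('n) / 2) (ball 0 1).
      \<forall>\<tau> \<in> Lambda CARD('n).
        Lnorm (real CARD('n) / 2) (ball 0 1) q \<le> ennreal r \<longrightarrow>
        Lnorm (crit_p' CARD('n)) (ball 0 1) (\<lambda>x. norm x powr (-\<tau>) * u x)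
          \<le> ennreal \<kappa> *
            Lnorm (crit_p CARD('n)) (ball 0 1) (\<lambda>x. norm x powr (-\<tau>) * (lap u x + q x * u x)))"

definition sobolev_const :: "'n::finite itself \<Rightarrow> ennreal" where
  "sobolev_const _ =
     (SUP w \<in> {w \<in> H1_0 (ball (0::real^'n) 1). Lnorm 2 (ball 0 1) (weak_grad (ball 0 1) w) = 1}.
        Lnorm (crit_p' CARD('n)) (ball 0 1) w)"

definition Qtilde :: "(real^'n) set \<Rightarrow> real^'n \<Rightarrow> real \<Rightarrow> real \<Rightarrow> (real^'n \<Rightarrow> real) set" where
  "Qtilde \<Omega> x0 d s = {q \<in> Lspace (real CARD('n) / 2) \<Omega>.
     Lnorm (real CARD('n) / 2) (ball x0 d) q \<le> ennreal s}"

definition rho_m :: "real^'n \<Rightarrow> real \<Rightarrow> nat \<Rightarrow> (real^'n \<Rightarrow> real) \<Rightarrow> ennreal" where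
  "rho_m x0 d m u = (SUP \<eta> \<in> {0<..<d}. ennreal (\<eta> powr (- real m)) * Lnorm 2 (ball x0 \<eta>) u)"

definition O_m :: "(real^'n) set \<Rightarrow> real^'n \<Rightarrow> real \<Rightarrow> nat \<Rightarrow> (real^'n \<Rightarrow> real) set" where
  "O_m \<Omega> x0 d m = {u \<in> Lspace 2 \<Omega>. rho_m x0 d m u < \<infinity>}"

end

theory Submission
  imports Defs
begin

text \<open>
  After translation and scaling, the Carleman inequality holds on \<open>B\<^sub>d(x\<^sub>0) - {x\<^sub>0}\<close> with the same constant. It is
  applied to \<open>(\<phi> - h) U\<close>, where \<open>h\<close> cuts off a ball of radius comparable to \<open>\<eta> d\<close> and \<open>U\<close> is a mollification
  of \<open>u\<close>. The commutator of \<open>\<Delta>\<close> and \<open>h\<close> lives on an annulus \<open>|y - x\<^sub>0| \<approx> \<eta> d\<close>; its gradient term is bounded by a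
  Caccioppoli estimate, in which the smallness of \<open>\<theta> \<sigma>\<^sup>2\<close> absorbs the potential, so that only the \<open>L\<^sup>2\<close> norm
  of \<open>u\<close> near \<open>x\<^sub>0\<close> remains, which \<open>\<rho>\<^sub>m(u)\<close> controls. Dividing by the least weight \<open>(d \<rho> / 2)\<^bsup>-\<tau>\<^esup>\<close> on the ball
  of the left-hand side turns the weights of the inner and outer regions into factors at most \<open>\<eta>\<^bsup>-\<tau>\<^esup>\<close> and
  \<open>2\<^bsup>-\<tau>\<^esup>\<close>. In the limit \<open>U \<rightarrow> u\<close> no Sobolev embedding of \<open>W\<^bsup>2,p\<^esup>\<close> is needed for the term \<open>q U\<close>: the Carleman
  inequality without potential, applied to differences of mollifications, gives convergence in
  \<open>L\<^bsup>p'\<^esup>\<close> away from \<open>x\<^sub>0\<close>.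
\<close>

subsection \<open>Lebesgue norms\<close>

text \<open>The constant may depend only on n, r0, \<theta> and d. Hence the derivatives of \<phi>
  are never estimated: beyond radius d / 2 the expression in \<phi> u enters as a whole, and the
  constants of the inner cut-off come from one fixed bump \<open>f\<close>. With s = d * \<eta> that
  cut-off varies only for 3/4 s \<le> |y - x0| < 3/2 s; the Caccioppoli cut-off equals 1 there and
  lives within radius 3 s, whence the factor (3 * d) ^ m. Two factors 1 / s arise from derivatives
  of cut-offs, and Hoelder's inequality on the annulus, whose L^n norm is of order s, wins one back.
  The resulting power with exponent m - (\<tau> + 1) is below the asserted one because \<eta> < 1.
  The obstacle is regularity: the Carleman inequality is given for test functions only, and
  convergence of mollifications in W^{2,p} says nothing direct about q * U in L^p when q is merely
  in L^{n/2}. The estimates are therefore completed for smooth U, and the limit is taken in a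
  finished inequality whose constants do not depend on U.\<close>

lemma ennreal_root_ennreal: "0 \<le> a \<Longrightarrow> ennreal_root p (ennreal a) = ennreal (a powr (1 / p))"
  by (simp add: ennreal_root_def)

lemma ennreal_root_top [simp]: "ennreal_root p \<infinity> = \<infinity>" "ennreal_root p top = top"
  by (simp_all add: ennreal_root_def)

lemma ennreal_root_0 [simp]: "ennreal_root p 0 = 0"
  by (simp add: ennreal_root_def)

lemma ennreal_root_1 [simp]: "ennreal_root 1 X = X"
  by (cases X) (auto simp: ennreal_root_ennreal)

lemma ennreal_root_powr: "0 < p \<Longrightarrow> 0 \<le> a \<Longrightarrow> ennreal_root p (ennreal (a powr p)) = ennreal a"
  by (simp add: ennreal_root_ennreal powr_powr)

lemma ennreal_root_mono:
  assumes "0 < p" "x \<le> y" shows "ennreal_root p x \<le> ennreal_root p y"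
proof (cases y)
  case (real b)
  then obtain a where a: "x = ennreal a" "0 \<le> a" using assms(2)
    by (metis ennreal_cases ennreal_less_top leD top.extremum_unique)
  then show ?thesis using real assms
    by (auto simp: ennreal_root_ennreal intro!: ennreal_leI powr_mono2)
qed simp

lemma ennreal_root_le_iff:
  assumes "0 < p" "0 \<le> C"
  shows "ennreal_root p x \<le> ennreal C \<longleftrightarrow> x \<le> ennreal (C powr p)"
proof
  assume "x \<le> ennreal (C powr p)"
  from ennreal_root_mono[OF assms(1) this] show "ennreal_root p x \<le> ennreal C"
    using ennreal_root_powr[OF assms] by simp
next
  assume l: "ennreal_root p x \<le> ennreal C"
  show "x \<le> ennreal (C powr p)"
  proof (cases x)
    case (real a)
    then have "a powr (1/p) \<le> C" using l assms by (simp add: ennreal_root_ennreal)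
    then have "(a powr (1/p)) powr p \<le> C powr p" using assms by (intro powr_mono2) auto
    then show ?thesis using real assms by (simp add: powr_powr ennreal_leI)
  next
    case top then show ?thesis using l by (simp add: top_unique)
  qed
qed

lemma ennreal_root_mult:
  assumes "0 < p" shows "ennreal_root p (x * y) = ennreal_root p x * ennreal_root p y"
proof -
  \<comment> \<open>The convention 0 * top = 0 has to agree on both sides; it does because the root
    vanishes only at 0.\<close>
  have top: "ennreal_root p (top * z) = top * ennreal_root p z" for z
  proof (cases "z = 0")
    case False
    then have "ennreal_root p z \<noteq> 0" using assms
      by (cases z) (auto simp: ennreal_root_ennreal ennreal_eq_0_iff)
    then show ?thesis using False by (simp add: ennreal_top_mult)
  qed simp
  show ?thesis
  proof (cases x)
    case (real a)
    show ?thesis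
    proof (cases y)
      case (real b)
      then show ?thesis using \<open>x = ennreal a\<close> \<open>0 \<le> a\<close>
        by (simp add: ennreal_root_ennreal ennreal_mult[symmetric] powr_mult)
    next
      case top then show ?thesis using \<open>\<And>z. ennreal_root p (top * z) = top * ennreal_root p z\<close>[of x]
        by (simp add: mult.commute)
    qed
  qed (use top in auto)
qed

text \<open>By homogeneity it suffices to look at the shares of a and b in a + b. They lie in
  [0, 1], where t \<le> t powr r.\<close>

lemma add_powr_le:
  fixes a b r :: real
  assumes "0 \<le> a" "0 \<le> b" "0 < r" "r \<le> 1"
  shows "(a + b) powr r \<le> a powr r + b powr r"
proof (cases "a + b = 0")
  case False
  let ?s = "a + b"
  have s: "?s > 0" using False assms by linarith
  have t: "x \<le> x powr r" if "0 \<le> x" "x \<le> 1" for x :: real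
  proof (cases "x = 0")
    case False then have "x powr 1 \<le> x powr r" using that assms by (intro powr_mono') auto
    then show ?thesis using that False by simp
  qed simp
  have "1 = a / ?s + b / ?s" using s by (simp add: add_divide_distrib[symmetric])
  also have "\<dots> \<le> (a / ?s) powr r + (b / ?s) powr r"
    using assms s by (intro add_mono t) auto
  also have "\<dots> = (a powr r + b powr r) / ?s powr r"
    using assms s by (simp add: powr_divide add_divide_distrib)
  finally show ?thesis using s by (simp add: field_simps)
qed (use assms in auto)

lemma ennreal_root_add:
  assumes "1 \<le> p" shows "ennreal_root p (x + y) \<le> ennreal_root p x + ennreal_root p y"
proof (cases x)
  case (real a)
  show ?thesis
  proof (cases y)
    case (real b)
    then show ?thesis using \<open>x = ennreal a\<close> \<open>0 \<le> a\<close> assms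
      by (simp add: ennreal_root_ennreal ennreal_plus[symmetric] add_powr_le del: ennreal_plus)
  qed simp
qed simp

lemma ennreal_root_tendsto_0:
  assumes "0 < p" "(f \<longlongrightarrow> 0) F" shows "((\<lambda>x. ennreal_root p (f x)) \<longlongrightarrow> 0) F"
proof (rule tendsto_0_if_Limsup_eq_0_ennreal)
  have "Limsup F (\<lambda>x. ennreal_root p (f x)) \<le> 0 + ennreal e" if "0 < e" for e :: real
  proof (rule Limsup_bounded)
    have "\<forall>\<^sub>F x in F. f x < ennreal (e powr p)"
      using assms(2) by (rule order_tendstoD) (use that in simp)
    then show "\<forall>\<^sub>F x in F. ennreal_root p (f x) \<le> 0 + ennreal e"
      by eventually_elim (use that assms(1) in \<open>simp add: ennreal_root_le_iff\<close>)
  qed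
  then have "Limsup F (\<lambda>x. ennreal_root p (f x)) \<le> 0"
    by (rule ennreal_le_epsilon)
  then show "Limsup F (\<lambda>x. ennreal_root p (f x)) = 0" by simp
qed

section \<open>Comparison, homogeneity and sums of \<open>Lnorm\<close>\<close>

lemma Lnorm_alt:
  assumes "S \<in> sets lebesgue"
  shows "Lnorm p S f = ennreal_root p (\<integral>\<^sup>+x. ennreal (norm (f x) powr p) * indicator S x \<partial>lebesgue)"
  unfolding Lnorm_def using assms by (simp add: nn_integral_restrict_space)

lemma Lnorm_mono_AE:
  assumes "0 < p" "S \<in> sets lebesgue" "AE x in lebesgue. x \<in> S \<longrightarrow> norm (f x) \<le> norm (g x)"
  shows "Lnorm p S f \<le> Lnorm p S g"
  unfolding Lnorm_alt[OF assms(2)]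
proof (intro ennreal_root_mono assms(1) nn_integral_mono_AE)
  show "AE x in lebesgue. ennreal (norm (f x) powr p) * indicator S x \<le> ennreal (norm (g x) powr p) * indicator S x"
    using assms(3) by eventually_elim (use assms(1) in \<open>auto simp: indicator_def intro!: ennreal_leI powr_mono2\<close>)
qed

lemma Lnorm_mono:
  assumes "0 < p" "S \<in> sets lebesgue" "\<And>x. x \<in> S \<Longrightarrow> norm (f x) \<le> norm (g x)"
  shows "Lnorm p S f \<le> Lnorm p S g"
  using assms by (intro Lnorm_mono_AE) auto

lemma Lnorm_cong_AE:
  assumes "0 < p" "S \<in> sets lebesgue" "AE x in lebesgue. x \<in> S \<longrightarrow> norm (f x) = norm (g x)"
  shows "Lnorm p S f = Lnorm p S g"
  by (intro antisym Lnorm_mono_AE assms(1,2)) (use assms(3) in \<open>auto elim: eventually_mono\<close>)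

lemma Lnorm_cong:
  assumes "0 < p" "S \<in> sets lebesgue" "\<And>x. x \<in> S \<Longrightarrow> norm (f x) = norm (g x)"
  shows "Lnorm p S f = Lnorm p S g"
  using assms by (intro Lnorm_cong_AE) auto

text \<open>One rule for shrinking a domain, for inserting an indicator and for discarding a region
  where a cut-off vanishes; the two sets may overlap in any way.\<close>

lemma Lnorm_subset_mono:
  assumes "0 < p" "S \<in> sets lebesgue" "T \<in> sets lebesgue" 
    "\<And>x. x \<in> S \<Longrightarrow> x \<notin> T \<Longrightarrow> f x = 0" "\<And>x. x \<in> S \<Longrightarrow> x \<in> T \<Longrightarrow> norm (f x) \<le> norm (g x)"
  shows "Lnorm p S f \<le> Lnorm p T g"
  unfolding Lnorm_alt[OF assms(2)] Lnorm_alt[OF assms(3)]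
  using assms by (intro ennreal_root_mono nn_integral_mono)
    (auto simp: indicator_def intro!: ennreal_leI powr_mono2)

lemma Lnorm_subset:
  assumes "0 < p" "S \<in> sets lebesgue" "T \<in> sets lebesgue" "S \<subseteq> T"
  shows "Lnorm p S f \<le> Lnorm p T f"
  using assms by (intro Lnorm_subset_mono) auto

lemma Lnorm_0 [simp]: "Lnorm p S (\<lambda>x. 0) = 0"
  by (simp add: Lnorm_def)

lemma Lnorm_cmult:
  fixes f :: "real^'n \<Rightarrow> real"
  assumes "0 < p" "S \<in> sets lebesgue" "f \<in> borel_measurable (lebesgue_on S)"
  shows "Lnorm p S (\<lambda>x. c * f x) = ennreal \<bar>c\<bar> * Lnorm p S f"
proof -
  have [measurable]: "f \<in> borel_measurable (lebesgue_on S)" by fact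
  have "Lnorm p S (\<lambda>x. c * f x) = ennreal_root p (ennreal (\<bar>c\<bar> powr p) * (\<integral>\<^sup>+x. ennreal (norm (f x) powr p) \<partial>lebesgue_on S))"
    unfolding Lnorm_def by (subst nn_integral_cmult[symmetric])
      (auto simp: abs_mult powr_mult ennreal_mult)
  then show ?thesis using assms(1)
    by (simp add: ennreal_root_mult ennreal_root_powr Lnorm_def)
qed

text \<open>The factor \<open>2\<close> spares Minkowski's inequality, whose sharp form is never needed.\<close>

lemma Lnorm_add_le:
  fixes f g :: "real^'n \<Rightarrow> real"
  assumes "1 \<le> p" "S \<in> sets lebesgue" "f \<in> borel_measurable (lebesgue_on S)" "g \<in> borel_measurable (lebesgue_on S)"
  shows "Lnorm p S (\<lambda>x. f x + g x) \<le> 2 * (Lnorm p S f + Lnorm p S g)"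
proof -
  have [measurable]: "f \<in> borel_measurable (lebesgue_on S)" "g \<in> borel_measurable (lebesgue_on S)" by fact+
  have pw: "\<bar>a + b\<bar> powr p \<le> 2 powr p * (\<bar>a\<bar> powr p + \<bar>b\<bar> powr p)" for a b :: real
  proof -
    have "\<bar>a + b\<bar> powr p \<le> (2 * max \<bar>a\<bar> \<bar>b\<bar>) powr p" using assms(1) by (intro powr_mono2) auto
    also have "\<dots> = 2 powr p * max \<bar>a\<bar> \<bar>b\<bar> powr p" by (simp add: powr_mult)
    also have "\<dots> \<le> 2 powr p * (\<bar>a\<bar> powr p + \<bar>b\<bar> powr p)"
      by (intro mult_left_mono) (auto simp: max_def)
    finally show ?thesis .
  qed
  have "Lnorm p S (\<lambda>x. f x + g x) \<le> ennreal_root p (\<integral>\<^sup>+x. ennreal (2 powr p) * (ennreal (norm (f x) powr p) + ennreal (norm (g x) powr p)) \<partial>lebesgue_on S)"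
    unfolding Lnorm_def using assms(1) pw
    by (intro ennreal_root_mono nn_integral_mono)
       (auto simp: ennreal_plus[symmetric] ennreal_mult[symmetric] simp del: ennreal_plus intro!: ennreal_leI)
  also have "\<dots> = ennreal_root p (ennreal (2 powr p) * ((\<integral>\<^sup>+x. ennreal (norm (f x) powr p) \<partial>lebesgue_on S) + (\<integral>\<^sup>+x. ennreal (norm (g x) powr p) \<partial>lebesgue_on S)))"
    by (simp add: nn_integral_cmult nn_integral_add)
  also have "\<dots> \<le> 2 * (Lnorm p S f + Lnorm p S g)"
    using assms(1) mult_left_mono[OF ennreal_root_add[OF assms(1)], of 2] ennreal_root_powr[of p 2]
    by (simp add: ennreal_root_mult Lnorm_def mult_left_mono)
  finally show ?thesis .
qed

text \<open>Fatou's lemma for the p-th powers, carried through the monotone root. It turns bounds on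
  differences of two approximations into a bound on the distance from their limit.\<close>

lemma Lnorm_Fatou:
  fixes f :: "nat \<Rightarrow> real^'n \<Rightarrow> real"
  assumes "0 < p" "S \<in> sets lebesgue" "\<And>k. f k \<in> borel_measurable (lebesgue_on S)"
    "AE x in lebesgue. x \<in> S \<longrightarrow> (\<lambda>k. f k x) \<longlonglongrightarrow> g x"
    "0 \<le> C" "\<forall>\<^sub>F k in sequentially. Lnorm p S (f k) \<le> ennreal C"
  shows "Lnorm p S g \<le> ennreal C"
proof -
  have [measurable]: "\<And>k. f k \<in> borel_measurable (lebesgue_on S)" by fact
  have ae: "AE x in lebesgue_on S. (\<lambda>k. f k x) \<longlonglongrightarrow> g x"
    using assms(2,4) by (simp add: AE_restrict_space_iff)
  have "(\<integral>\<^sup>+x. ennreal (norm (g x) powr p) \<partial>lebesgue_on S)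
     \<le> (\<integral>\<^sup>+x. liminf (\<lambda>k. ennreal (norm (f k x) powr p)) \<partial>lebesgue_on S)"
  proof (rule nn_integral_mono_AE, use ae in eventually_elim)
    fix x assume l: "(\<lambda>k. f k x) \<longlonglongrightarrow> g x"
    have "(\<lambda>k. norm (f k x) powr p) \<longlonglongrightarrow> norm (g x) powr p"
      using assms(1) by (intro tendsto_powr' tendsto_norm l tendsto_const) auto
    then have "(\<lambda>k. ennreal (norm (f k x) powr p)) \<longlonglongrightarrow> ennreal (norm (g x) powr p)"
      by (rule tendsto_ennrealI)
    then show "ennreal (norm (g x) powr p) \<le> liminf (\<lambda>k. ennreal (norm (f k x) powr p))"
      using lim_imp_Liminf by (metis order_refl sequentially_bot)
  qed
  also have "\<dots> \<le> liminf (\<lambda>k. \<integral>\<^sup>+x. ennreal (norm (f k x) powr p) \<partial>lebesgue_on S)"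
    by (intro nn_integral_liminf) measurable
  also have "\<dots> \<le> limsup (\<lambda>k. \<integral>\<^sup>+x. ennreal (norm (f k x) powr p) \<partial>lebesgue_on S)"
    by (simp add: Liminf_le_Limsup)
  also have "\<dots> \<le> ennreal (C powr p)"
    using assms(6) unfolding Lnorm_def ennreal_root_le_iff[OF assms(1,5)] by (rule Limsup_bounded)
  finally show ?thesis
    unfolding Lnorm_def ennreal_root_le_iff[OF assms(1,5)] .
qed

text \<open>Young's inequality for f / A and g / B, where A and B are the two norms, is integrated;
  the sum 1/p + 1/q = 1 then appears.\<close>

lemma nn_integral_Holder:
  fixes f g :: "'a \<Rightarrow> real"
  assumes "1 < p" "1 < q" "1/p + 1/q = 1" and [measurable]: "f \<in> borel_measurable M" "g \<in> borel_measurable M"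
  shows "(\<integral>\<^sup>+x. ennreal \<bar>f x * g x\<bar> \<partial>M) \<le>
    ennreal_root p (\<integral>\<^sup>+x. ennreal (\<bar>f x\<bar> powr p) \<partial>M) * ennreal_root q (\<integral>\<^sup>+x. ennreal (\<bar>g x\<bar> powr q) \<partial>M)"
    (is "?L \<le> ennreal_root p ?F * ennreal_root q ?G")
proof -
  have z: "?L = 0" if "(\<integral>\<^sup>+x. ennreal (\<bar>h x\<bar> powr r) \<partial>M) = 0" and [measurable]: "h \<in> borel_measurable M"
     and "h = f \<or> h = g" for h r
  proof -
    have "AE x in M. ennreal (\<bar>h x\<bar> powr r) = 0" using that by (simp add: nn_integral_0_iff_AE)
    then have "AE x in M. ennreal \<bar>f x * g x\<bar> = 0"
      by eventually_elim (use that(3) in \<open>auto simp: ennreal_eq_0_iff\<close>)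
    then show ?thesis by (simp add: nn_integral_0_iff_AE)
  qed
  \<comment> \<open>Division by A and B requires positive and finite integrals. If one is zero, the
    product vanishes almost everywhere; otherwise an infinite one makes the right-hand side
    infinite.\<close>
  consider "?F = 0 \<or> ?G = 0" | "?F \<noteq> 0" "?G \<noteq> 0" "?F = top \<or> ?G = top" | "?F \<noteq> 0" "?G \<noteq> 0" "?F \<noteq> top" "?G \<noteq> top" by blast
  then show ?thesis
  proof cases
    case 1 then show ?thesis using z[of f p] z[of g q] by auto
  next
    case 2
    have "ennreal_root r X \<noteq> 0" if "X \<noteq> 0" for X r using that
      by (cases X) (auto simp: ennreal_root_ennreal ennreal_eq_0_iff)
    then show ?thesis using 2 by (auto simp: ennreal_top_mult ennreal_mult_top)
  next
    case 3
    define A where "A = enn2real ?F powr (1/p)"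
    define B where "B = enn2real ?G powr (1/q)"
    have Fp: "enn2real ?F > 0" and Gp: "enn2real ?G > 0" using 3
      by (auto simp: enn2real_positive_iff less_top zero_less_iff_neq_zero)
    have A: "A > 0" "ennreal_root p ?F = ennreal A" "?F = ennreal (A powr p)"
      using 3 Fp assms(1) by (auto simp: A_def ennreal_root_def powr_powr less_top)
    have B: "B > 0" "ennreal_root q ?G = ennreal B" "?G = ennreal (B powr q)"
      using 3 Gp assms(2) by (auto simp: B_def ennreal_root_def powr_powr less_top)
    have Y: "\<bar>f x * g x\<bar> \<le> A * B / p * (1 / A powr p) * \<bar>f x\<bar> powr p + A * B / q * (1 / B powr q) * \<bar>g x\<bar> powr q" for x
    proof -
      have "(\<bar>f x\<bar> / A) * (\<bar>g x\<bar> / B) \<le> (\<bar>f x\<bar> / A) powr p / p + (\<bar>g x\<bar> / B) powr q / q"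
        using A B assms by (intro Youngs_inequality) auto
      then have "A * B * ((\<bar>f x\<bar> / A) * (\<bar>g x\<bar> / B)) \<le> A * B * ((\<bar>f x\<bar> / A) powr p / p + (\<bar>g x\<bar> / B) powr q / q)"
        using A B by (intro mult_left_mono) auto
      then show ?thesis using A B by (simp add: powr_divide abs_mult algebra_simps)
    qed
    have "?L \<le> (\<integral>\<^sup>+x. ennreal (A * B / p * (1 / A powr p)) * ennreal (\<bar>f x\<bar> powr p) + ennreal (A * B / q * (1 / B powr q)) * ennreal (\<bar>g x\<bar> powr q) \<partial>M)"
      using Y A B assms by (intro nn_integral_mono)
       (auto simp: ennreal_plus[symmetric] ennreal_mult[symmetric] simp del: ennreal_plus intro!: ennreal_leI)
    also have "\<dots> = ennreal (A * B / p * (1 / A powr p)) * ?F + ennreal (A * B / q * (1 / B powr q)) * ?G"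
      by (simp add: nn_integral_add nn_integral_cmult)
    also have "\<dots> = ennreal (A * B / p * (1 / A powr p) * A powr p + A * B / q * (1 / B powr q) * B powr q)"
      unfolding A(3) B(3) using A(1) B(1) assms by (simp add: ennreal_mult[symmetric] ennreal_plus[symmetric] del: ennreal_plus)
    also have "A * B / p * (1 / A powr p) * A powr p + A * B / q * (1 / B powr q) * B powr q = A * B * (1/p + 1/q)"
      using A(1) B(1) by (simp add: field_simps)
    also have "ennreal \<dots> = ennreal_root p ?F * ennreal_root q ?G"
      unfolding A(2) B(2) assms(3) using A(1) B(1) by (simp add: ennreal_mult)
    finally show ?thesis .
  qed
qed

text \<open>Reduces to \<open>nn_integral_Holder\<close> for |f| powr r and |g| powr r, with the
  conjugate exponents p / r and q / r.\<close>

lemma Lnorm_Holder: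
  fixes f g :: "real^'n \<Rightarrow> real"
  assumes "0 < p" "0 < q" "0 < r" "1/r = 1/p + 1/q" "S \<in> sets lebesgue"
    "f \<in> borel_measurable (lebesgue_on S)" "g \<in> borel_measurable (lebesgue_on S)"
  shows "Lnorm r S (\<lambda>x. f x * g x) \<le> Lnorm p S f * Lnorm q S g"
proof -
  have [measurable]: "f \<in> borel_measurable (lebesgue_on S)" "g \<in> borel_measurable (lebesgue_on S)" by fact+
  have pr: "1 < p / r" "1 < q / r" "1/(p/r) + 1/(q/r) = 1" "r/p + r/q = 1"
  proof -
    have "r/p + r/q = r * (1 / r)" unfolding assms(4) by (simp add: algebra_simps)
    then have e: "r/p + r/q = 1" using assms(3) by simp
    moreover have "r / p > 0" "r / q > 0" using assms by auto
    ultimately have "r / p < 1" "r / q < 1" by linarith+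
    then show "1 < p / r" "1 < q / r" using assms by (simp_all add: field_simps)
    show "r/p + r/q = 1" "1/(p/r) + 1/(q/r) = 1" using e by simp_all
  qed
  have rr: "ennreal_root r (ennreal_root (s / r) x) = ennreal_root s x" if "0 < s" for s x
    using that assms(3) by (cases x) (auto simp: ennreal_root_ennreal powr_powr)
  have "(\<integral>\<^sup>+x. ennreal \<bar>\<bar>f x\<bar> powr r * \<bar>g x\<bar> powr r\<bar> \<partial>lebesgue_on S)
    \<le> ennreal_root (p/r) (\<integral>\<^sup>+x. ennreal (\<bar>\<bar>f x\<bar> powr r\<bar> powr (p/r)) \<partial>lebesgue_on S)
     * ennreal_root (q/r) (\<integral>\<^sup>+x. ennreal (\<bar>\<bar>g x\<bar> powr r\<bar> powr (q/r)) \<partial>lebesgue_on S)"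
    using pr by (intro nn_integral_Holder) auto
  then have "ennreal_root r (\<integral>\<^sup>+x. ennreal \<bar>\<bar>f x\<bar> powr r * \<bar>g x\<bar> powr r\<bar> \<partial>lebesgue_on S)
    \<le> ennreal_root r (ennreal_root (p/r) (\<integral>\<^sup>+x. ennreal (\<bar>\<bar>f x\<bar> powr r\<bar> powr (p/r)) \<partial>lebesgue_on S)
     * ennreal_root (q/r) (\<integral>\<^sup>+x. ennreal (\<bar>\<bar>g x\<bar> powr r\<bar> powr (q/r)) \<partial>lebesgue_on S))"
    using assms(3) by (intro ennreal_root_mono)
  then show ?thesis using assms(1-3)
    by (simp add: Lnorm_def ennreal_root_mult rr powr_powr abs_mult powr_mult)
qed

lemma Lnorm_const:
  assumes "0 < p" "S \<in> lmeasurable"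
  shows "Lnorm p S (\<lambda>x. c::real) = ennreal (\<bar>c\<bar> * measure lebesgue S powr (1/p))"
proof -
  have S: "S \<in> sets lebesgue" using assms by auto
  have "(\<integral>\<^sup>+x. ennreal (norm c powr p) \<partial>lebesgue_on S) = ennreal (\<bar>c\<bar> powr p * measure lebesgue S)"
    using assms S by (simp add: emeasure_restrict_space emeasure_eq_measure2 ennreal_mult)
  then show ?thesis using assms unfolding Lnorm_def
    by (simp add: ennreal_root_ennreal powr_mult powr_powr)
qed

subsection \<open>Smooth functions\<close>

definition smooth :: "(real^'n \<Rightarrow> real) \<Rightarrow> bool" where
  "smooth f \<longleftrightarrow> (\<forall>k. Ck k f)"

definition supp :: "(real^'n \<Rightarrow> real) \<Rightarrow> (real^'n) set" where
  "supp f = closure {x. f x \<noteq> 0}"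

lemma test_functions_iff: "f \<in> test_functions S \<longleftrightarrow> smooth f \<and> compact (supp f) \<and> supp f \<subseteq> S"
  by (simp add: test_functions_def smooth_def supp_def)

text \<open>Families such as the convolutions with a fixed function reproduce themselves under
  differentiation; exhibiting such a family replaces formulas for higher derivatives.\<close>

lemma smooth_coinduct:
  assumes "P f" "\<And>f. P f \<Longrightarrow> f differentiable_on UNIV \<and> (\<forall>i. P (pderiv_at i f))"
  shows "smooth f"
proof -
  have "Ck k f" if "P f" for k f using that
  proof (induction k arbitrary: f)
    case 0 then show ?case using assms(2) by (simp add: differentiable_imp_continuous_on)
  next
    case (Suc k) then show ?case using assms(2) by simp
  qed
  then show ?thesis using assms(1) by (simp add: smooth_def)
qed

lemma smooth_pderiv: "smooth f \<Longrightarrow> smooth (pderiv_at i f)"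
  using Ck.simps(2) unfolding smooth_def by blast

lemma smooth_differentiable_on: "smooth f \<Longrightarrow> f differentiable_on UNIV"
  using Ck.simps(2) unfolding smooth_def by blast

lemma smooth_continuous: "smooth f \<Longrightarrow> continuous_on S f"
  using Ck.simps(1) unfolding smooth_def by (metis continuous_on_subset subset_UNIV)

lemma smooth_has_derivative: "smooth f \<Longrightarrow> (f has_derivative frechet_derivative f (at x)) (at x)"
  using smooth_differentiable_on[of f] by (simp add: differentiable_on_def frechet_derivative_works)

lemma frechet_derivative_eq_sum:
  fixes f :: "real^'n \<Rightarrow> real"
  assumes "smooth f"
  shows "frechet_derivative f (at x) h = (\<Sum>i\<in>UNIV. h $ i * pderiv_at i f x)"
proof -
  have lin: "linear (frechet_derivative f (at x))"
    using smooth_has_derivative[OF assms] by (rule has_derivative_linear)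
  have "frechet_derivative f (at x) h = frechet_derivative f (at x) (\<Sum>i\<in>UNIV. h $ i *s axis i 1)"
    by (simp add: basis_expansion)
  also have "\<dots> = (\<Sum>i\<in>UNIV. h $ i * pderiv_at i f x)"
    by (simp add: linear_sum[OF lin] scalar_mult_eq_scaleR linear_cmul[OF lin] pderiv_at_def)
  finally show ?thesis .
qed

lemma pderiv_at_eqI: "(f has_derivative D) (at x) \<Longrightarrow> pderiv_at i f x = D (axis i 1)"
  unfolding pderiv_at_def using frechet_derivative_at by metis

lemma smooth_has_derivative': 
  "smooth f \<Longrightarrow> (f has_derivative (\<lambda>h. \<Sum>i\<in>UNIV. h $ i * pderiv_at i f x)) (at x)"
  using smooth_has_derivative[of f x] ext[of "frechet_derivative f (at x)", OF frechet_derivative_eq_sum[of f x]] by simp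

lemma pderiv_add:
  "smooth f \<Longrightarrow> smooth g \<Longrightarrow> pderiv_at i (\<lambda>x. f x + g x) = (\<lambda>x. pderiv_at i f x + pderiv_at i g x)"
  by (rule ext, subst pderiv_at_eqI[OF has_derivative_add[OF smooth_has_derivative smooth_has_derivative]])
     (simp_all add: pderiv_at_def)

lemma pderiv_diff:
  "smooth f \<Longrightarrow> smooth g \<Longrightarrow> pderiv_at i (\<lambda>x. f x - g x) = (\<lambda>x. pderiv_at i f x - pderiv_at i g x)"
  by (rule ext, subst pderiv_at_eqI[OF has_derivative_diff[OF smooth_has_derivative smooth_has_derivative]])
     (simp_all add: pderiv_at_def)

lemma pderiv_mult:
  "smooth f \<Longrightarrow> smooth g \<Longrightarrow> pderiv_at i (\<lambda>x. f x * g x) = (\<lambda>x. f x * pderiv_at i g x + pderiv_at i f x * g x)"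
  by (rule ext, subst pderiv_at_eqI[OF has_derivative_mult[OF smooth_has_derivative smooth_has_derivative]])
     (simp_all add: pderiv_at_def)

lemma pderiv_const: "pderiv_at i (\<lambda>x. c) = (\<lambda>x. 0)"
  by (rule ext, subst pderiv_at_eqI[OF has_derivative_const]) simp

lemma has_derivative_compose_affine:
  fixes f :: "real^'n \<Rightarrow> real"
  assumes "(f has_derivative D) (at (a + c *\<^sub>R x))"
  shows "((\<lambda>x. f (a + c *\<^sub>R x)) has_derivative (\<lambda>h. D (c *\<^sub>R h))) (at x)"
proof -
  have "((\<lambda>x. a + c *\<^sub>R x) has_derivative (\<lambda>h. c *\<^sub>R h)) (at x)"
    by (auto intro!: derivative_eq_intros)
  from diff_chain_at[OF this, of f D] assms show ?thesis by (simp add: o_def)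
qed

lemma pderiv_affine:
  fixes f :: "real^'n \<Rightarrow> real"
  assumes "smooth f"
  shows "pderiv_at i (\<lambda>x. f (a + c *\<^sub>R x)) = (\<lambda>x. c * pderiv_at i f (a + c *\<^sub>R x))"
proof
  fix x
  have lin: "linear (frechet_derivative f (at (a + c *\<^sub>R x)))"
    using smooth_has_derivative[OF assms] by (rule has_derivative_linear)
  show "pderiv_at i (\<lambda>x. f (a + c *\<^sub>R x)) x = c * pderiv_at i f (a + c *\<^sub>R x)"
    using pderiv_at_eqI[OF has_derivative_compose_affine[OF smooth_has_derivative[OF assms]]]
      linear_cmul[OF lin] by (simp add: pderiv_at_def)
qed

lemma smooth_affine:
  fixes f :: "real^'n \<Rightarrow> real"
  assumes "smooth f" shows "smooth (\<lambda>x. f (a + c *\<^sub>R x))"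
proof -
  \<comment> \<open>The factor b collects the powers of c that differentiation produces.\<close>
  define P where "P g \<longleftrightarrow> (\<exists>f b. smooth f \<and> g = (\<lambda>x::real^'n. b * f (a + c *\<^sub>R x)))" for g
  show ?thesis
  proof (rule smooth_coinduct[of P])
    show "P (\<lambda>x. f (a + c *\<^sub>R x))" unfolding P_def using assms by (intro exI[of _ f] exI[of _ 1]) simp
    fix g assume "P g"
    then obtain f b where f: "smooth f" and g: "g = (\<lambda>x. b * f (a + c *\<^sub>R x))" by (auto simp: P_def)
    have D: "(g has_derivative (\<lambda>h. b * frechet_derivative f (at (a + c *\<^sub>R x)) (c *\<^sub>R h))) (at x)" for x
      unfolding g by (intro has_derivative_mult_right has_derivative_compose_affine smooth_has_derivative f)
    have "pderiv_at i g x = (b * c) * pderiv_at i f (a + c *\<^sub>R x)" for i x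
      using pderiv_at_eqI[OF D, of i x] linear_cmul[OF has_derivative_linear[OF smooth_has_derivative[OF f]]]
      by (simp add: pderiv_at_def)
    then have "P (pderiv_at i g)" for i
      unfolding P_def using smooth_pderiv[OF f] by (intro exI[of _ "pderiv_at i f"] exI[of _ "b * c"]) auto
    moreover have "g differentiable_on UNIV"
      using D by (auto simp: differentiable_on_def differentiable_def)
    ultimately show "g differentiable_on UNIV \<and> (\<forall>i. P (pderiv_at i g))" by blast
  qed
qed

lemma smooth_const: "smooth (\<lambda>x. c)"
  by (rule smooth_coinduct[of "\<lambda>h. \<exists>c. h = (\<lambda>x. c)"]) (auto simp: pderiv_const)

lemma Ck_SucD: "Ck (Suc k) f \<Longrightarrow> Ck k f"
  by (induction k arbitrary: f) (auto simp: differentiable_imp_continuous_on)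

lemma Ck_add: "Ck k f \<Longrightarrow> Ck k g \<Longrightarrow> Ck k (\<lambda>x. f x + g x)"
proof (induction k arbitrary: f g)
  case (Suc k)
  have "pderiv_at i (\<lambda>x. f x + g x) = (\<lambda>x. pderiv_at i f x + pderiv_at i g x)" for i
  proof
    fix x
    have "(f has_derivative frechet_derivative f (at x)) (at x)" "(g has_derivative frechet_derivative g (at x)) (at x)"
      using Suc.prems by (simp_all add: differentiable_on_def frechet_derivative_works)
    from pderiv_at_eqI[OF has_derivative_add[OF this]]
    show "pderiv_at i (\<lambda>x. f x + g x) x = pderiv_at i f x + pderiv_at i g x" by (simp add: pderiv_at_def)
  qed
  then show ?case using Suc by auto
qed (auto intro: continuous_intros)

lemma Ck_mult: "Ck k f \<Longrightarrow> Ck k g \<Longrightarrow> Ck k (\<lambda>x. f x * g x)"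
proof (induction k arbitrary: f g)
  case (Suc k)
  have "pderiv_at i (\<lambda>x. f x * g x) = (\<lambda>x. f x * pderiv_at i g x + pderiv_at i f x * g x)" for i
  proof
    fix x
    have "(f has_derivative frechet_derivative f (at x)) (at x)" "(g has_derivative frechet_derivative g (at x)) (at x)"
      using Suc.prems by (simp_all add: differentiable_on_def frechet_derivative_works)
    from pderiv_at_eqI[OF has_derivative_mult[OF this]]
    show "pderiv_at i (\<lambda>x. f x * g x) x = f x * pderiv_at i g x + pderiv_at i f x * g x" by (simp add: pderiv_at_def)
  qed
  \<comment> \<open>The product rule leaves one factor undifferentiated, so the induction hypothesis
    also needs f and g at order k.\<close>
  moreover have "Ck k f" "Ck k g" using Suc.prems Ck_SucD by blast+
  ultimately show ?case using Suc by (auto intro!: Ck_add)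
qed (auto intro: continuous_intros)

lemma smooth_add: "smooth f \<Longrightarrow> smooth g \<Longrightarrow> smooth (\<lambda>x. f x + g x)"
  by (simp add: smooth_def Ck_add)

lemma smooth_mult: "smooth f \<Longrightarrow> smooth g \<Longrightarrow> smooth (\<lambda>x. f x * g x)"
  by (simp add: smooth_def Ck_mult)

lemma smooth_cmult: "smooth f \<Longrightarrow> smooth (\<lambda>x. c * f x)"
  by (intro smooth_mult smooth_const)

lemma smooth_diff: "smooth f \<Longrightarrow> smooth g \<Longrightarrow> smooth (\<lambda>x. f x - g x)"
  using smooth_add[OF _ smooth_cmult[of g "-1"]] by simp

lemma smooth_sum: "(\<And>i. i \<in> I \<Longrightarrow> smooth (f i)) \<Longrightarrow> smooth (\<lambda>x. \<Sum>i\<in>I. f i x)"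
  by (induction I rule: infinite_finite_induct) (auto intro!: smooth_const smooth_add)

lemma smooth_lap: "smooth f \<Longrightarrow> smooth (lap f)"
  unfolding lap_def[abs_def] by (intro smooth_sum smooth_pderiv)

lemma pderiv_cmult: "smooth f \<Longrightarrow> pderiv_at i (\<lambda>x. c * f x) = (\<lambda>x. c * pderiv_at i f x)"
  using pderiv_mult[OF smooth_const, of f] by (simp add: pderiv_const)

text \<open>\<open>frechet_derivative\<close> is a choice that depends only on the set of
  derivatives at x, and this set is local. Hence the equality holds even at points where the
  functions are not differentiable.\<close>

lemma pderiv_local:
  assumes "open S" "x \<in> S" "\<And>y. y \<in> S \<Longrightarrow> f y = g y"
  shows "pderiv_at i f x = pderiv_at i g x"
proof -
  have "(f has_derivative D) (at x) \<longleftrightarrow> (g has_derivative D) (at x)" for D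
    using assms has_derivative_transform_within_open by metis
  then show ?thesis unfolding pderiv_at_def frechet_derivative_def by simp
qed

lemma lap_local:
  assumes "open S" "x \<in> S" "\<And>y. y \<in> S \<Longrightarrow> f y = g y"
  shows "lap f x = lap g x"
  unfolding lap_def using assms
  by (intro sum.cong refl pderiv_local[OF assms(1,2)] pderiv_local[OF assms(1) _ assms(3)]) auto

lemma lap_diff: "smooth f \<Longrightarrow> smooth g \<Longrightarrow> lap (\<lambda>x. f x - g x) x = lap f x - lap g x"
  by (simp add: lap_def pderiv_diff smooth_pderiv sum_subtractf)

lemma lap_mult:
  assumes "smooth f" "smooth g"
  shows "lap (\<lambda>x. f x * g x) x = f x * lap g x + 2 * (\<Sum>i\<in>UNIV. pderiv_at i f x * pderiv_at i g x) + lap f x * g x"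
  by (simp add: lap_def pderiv_mult pderiv_add assms smooth_pderiv smooth_mult sum.distrib sum_distrib_left sum_distrib_right algebra_simps)

lemma lap_affine:
  assumes "smooth f"
  shows "lap (\<lambda>x. f (a + c *\<^sub>R x)) x = c\<^sup>2 * lap f (a + c *\<^sub>R x)"
proof -
  have "pderiv_at i (pderiv_at i (\<lambda>x. f (a + c *\<^sub>R x))) x = c\<^sup>2 * pderiv_at i (pderiv_at i f) (a + c *\<^sub>R x)" for i
    unfolding pderiv_affine[OF assms] pderiv_cmult[OF smooth_affine[OF smooth_pderiv[OF assms]]]
      pderiv_affine[OF smooth_pderiv[OF assms]] by (simp add: power2_eq_square)
  then show ?thesis by (simp add: lap_def sum_distrib_left)
qed

section \<open>Supports and test functions\<close>

lemma closed_supp: "closed (supp f)"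
  by (simp add: supp_def)

lemma not_in_supp: "x \<notin> supp f \<Longrightarrow> f x = 0"
  using closure_subset by (force simp: supp_def)

lemma supp_subset: "closed T \<Longrightarrow> (\<And>x. x \<notin> T \<Longrightarrow> f x = 0) \<Longrightarrow> supp f \<subseteq> T"
  unfolding supp_def by (rule closure_minimal) auto

lemma compact_closed_subset: "compact T \<Longrightarrow> closed S \<Longrightarrow> S \<subseteq> T \<Longrightarrow> compact S"
  for S :: "'a::t2_space set"
  using compact_Int_closed[of T S] by (simp add: Int_absorb1)

lemma compact_supp: "compact T \<Longrightarrow> (\<And>x. x \<notin> T \<Longrightarrow> f x = 0) \<Longrightarrow> compact (supp f)"
  by (rule compact_closed_subset[OF _ closed_supp]) (use supp_subset[of T f] compact_imp_closed in blast)+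

lemma supp_pderiv: "supp (pderiv_at i f) \<subseteq> supp f"
proof (rule supp_subset[OF closed_supp])
  fix x assume "x \<notin> supp f"
  then show "pderiv_at i f x = 0"
    using pderiv_local[of "- supp f" x f "\<lambda>x. 0" i] closed_supp[of f] not_in_supp[of _ f]
    by (auto simp: pderiv_const)
qed

lemma pderiv_eq_0: "x \<notin> supp f \<Longrightarrow> pderiv_at i f x = 0"
  using supp_pderiv[of i f] not_in_supp[of x "pderiv_at i f"] by blast

lemma lap_eq_0: "x \<notin> supp f \<Longrightarrow> lap f x = 0"
  unfolding lap_def using supp_pderiv[of _ f] pderiv_eq_0[of x "pderiv_at _ f"] by (intro sum.neutral) blast

lemma supp_mult_left: "supp (\<lambda>x. f x * g x) \<subseteq> supp f"
  by (rule supp_subset[OF closed_supp]) (simp add: not_in_supp)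

lemma test_functions_mono: "S \<subseteq> T \<Longrightarrow> f \<in> test_functions S \<Longrightarrow> f \<in> test_functions T"
  by (auto simp: test_functions_iff)

lemma test_functions_smooth: "f \<in> test_functions S \<Longrightarrow> smooth f"
  by (simp add: test_functions_iff)

lemma test_functions_pderiv: "f \<in> test_functions S \<Longrightarrow> pderiv_at i f \<in> test_functions S"
  unfolding test_functions_iff using supp_pderiv[of i f] compact_closed_subset[OF _ closed_supp supp_pderiv[of i f]]
  by (auto intro: smooth_pderiv)

lemma test_functions_mult: "f \<in> test_functions S \<Longrightarrow> smooth g \<Longrightarrow> (\<lambda>x. f x * g x) \<in> test_functions S"
  unfolding test_functions_iff using supp_mult_left[of f g] compact_closed_subset[OF _ closed_supp supp_mult_left[of f g]]
  by (auto intro: smooth_mult)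

lemma test_functions_mult': "f \<in> test_functions S \<Longrightarrow> smooth g \<Longrightarrow> (\<lambda>x. g x * f x) \<in> test_functions S"
  using test_functions_mult[of f S g] by (simp add: mult.commute)

lemma test_functionsI:
  assumes "smooth f" "compact K" "K \<subseteq> S" "\<And>x. x \<notin> K \<Longrightarrow> f x = 0"
  shows "f \<in> test_functions S"
  unfolding test_functions_iff using assms(1,3) compact_supp[OF assms(2,4)] supp_subset[OF compact_imp_closed[OF assms(2)] assms(4)]
  by (meson order_trans)

lemma test_functions_add:
  assumes "f \<in> test_functions S" "g \<in> test_functions S" shows "(\<lambda>x. f x + g x) \<in> test_functions S"
  by (rule test_functionsI[of _ "supp f \<union> supp g"])
     (use assms in \<open>auto simp: test_functions_iff not_in_supp intro!: smooth_add\<close>)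

lemma test_functions_affine:
  fixes f :: "real^'n \<Rightarrow> real"
  assumes "f \<in> test_functions S" "c \<noteq> 0" "\<And>x. a + c *\<^sub>R x \<in> S \<Longrightarrow> x \<in> T"
  shows "(\<lambda>x. f (a + c *\<^sub>R x)) \<in> test_functions T"
proof (rule test_functionsI)
  let ?g = "\<lambda>y. (1/c) *\<^sub>R (y - a)"
  show "smooth (\<lambda>x. f (a + c *\<^sub>R x))" using assms by (simp add: test_functions_iff smooth_affine)
  show "compact (?g ` supp f)" using assms
    by (intro compact_continuous_image continuous_intros) (simp add: test_functions_iff)
  have i: "a + c *\<^sub>R ?g y = y" for y using assms(2) by simp
  then show "?g ` supp f \<subseteq> T" using assms(1,3) by (force simp: test_functions_iff)
  show "f (a + c *\<^sub>R x) = 0" if "x \<notin> ?g ` supp f" for x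
  proof (rule not_in_supp, rule notI)
    assume "a + c *\<^sub>R x \<in> supp f"
    then have "?g (a + c *\<^sub>R x) \<in> ?g ` supp f" by blast
    then show False using that assms(2) by simp
  qed
qed

lemma continuous_compact_bounded:
  assumes "continuous_on UNIV f" "compact (supp f)"
  shows "\<exists>C\<ge>0. \<forall>x. \<bar>f x\<bar> \<le> C"
proof -
  have "bounded (f ` supp f)"
    using assms by (intro compact_imp_bounded compact_continuous_image) (auto intro: continuous_on_subset)
  then obtain C where C: "\<And>x. x \<in> supp f \<Longrightarrow> \<bar>f x\<bar> \<le> C" by (auto simp: bounded_iff)
  have "\<bar>f x\<bar> \<le> max C 0" for x using C[of x] not_in_supp[of x f] by (cases "x \<in> supp f") auto
  then show ?thesis by (intro exI[of _ "max C 0"]) auto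
qed

lemma test_functions_bounded:
  "f \<in> test_functions S \<Longrightarrow> \<exists>C\<ge>0. \<forall>x. \<bar>f x\<bar> \<le> C"
  by (intro continuous_compact_bounded) (auto simp: test_functions_iff smooth_continuous)

text \<open>Mean value inequality, with the sum of the bounds of the partial derivatives as
  constant. It supplies the dominating functions for difference quotients.\<close>

lemma test_functions_Lipschitz:
  fixes f :: "real^'n \<Rightarrow> real"
  assumes "f \<in> test_functions S"
  shows "\<exists>L\<ge>0. \<forall>x y. \<bar>f x - f y\<bar> \<le> L * norm (x - y)"
proof -
  have "\<forall>i. \<exists>C\<ge>0. \<forall>x. \<bar>pderiv_at i f x\<bar> \<le> C"
    using test_functions_bounded[OF test_functions_pderiv[OF assms]] by blast
  then obtain C where C: "\<And>i. C i \<ge> 0" "\<And>i x. \<bar>pderiv_at i f x\<bar> \<le> C i" by metis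
  define L where "L = (\<Sum>i\<in>UNIV. C i)"
  have "norm (f x - f y) \<le> L * norm (x - y)" for x y
  proof (rule differentiable_bound[of UNIV f])
    fix z :: "real^'n"
    show "(f has_derivative (\<lambda>h. \<Sum>i\<in>UNIV. h $ i * pderiv_at i f z)) (at z within UNIV)"
      using smooth_has_derivative' test_functions_smooth[OF assms] by blast
    show "onorm (\<lambda>h. \<Sum>i\<in>UNIV. h $ i * pderiv_at i f z) \<le> L"
    proof (rule onorm_le)
      fix h :: "real^'n"
      have "norm (\<Sum>i\<in>UNIV. h $ i * pderiv_at i f z) \<le> (\<Sum>i\<in>UNIV. norm (h $ i * pderiv_at i f z))"
        by (rule norm_sum)
      also have "\<dots> \<le> (\<Sum>i\<in>UNIV. norm h * C i)"
        using C component_le_norm_cart[of h] by (intro sum_mono) (auto simp: abs_mult intro!: mult_mono)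
      finally show "norm (\<Sum>i\<in>UNIV. h $ i * pderiv_at i f z) \<le> L * norm h"
        by (simp add: L_def sum_distrib_left mult.commute)
    qed
  qed auto
  moreover have "L \<ge> 0" unfolding L_def using C(1) by (intro sum_nonneg) auto
  ultimately show ?thesis by auto
qed

subsection \<open>Convolution\<close>

lemma lebesgue_affine_scaleR:
  fixes t :: "'a::euclidean_space"
  assumes "c \<noteq> 0"
  shows "lebesgue = density (distr lebesgue lebesgue (\<lambda>x. t + c *\<^sub>R x)) (\<lambda>_. ennreal (\<bar>c\<bar> ^ DIM('a)))"
    and "(\<lambda>x. t + c *\<^sub>R x) \<in> lebesgue \<rightarrow>\<^sub>M lebesgue"
  using lebesgue_affine_euclidean[where c="\<lambda>_::'a. c" and t=t] lebesgue_affine_measurable[where c="\<lambda>_::'a. c" and t=t] assms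
  unfolding scaleR_scaleR[symmetric] scaleR_sum_right[symmetric] euclidean_representation prod_constant by simp_all

lemma nn_integral_lebesgue_affine:
  fixes t :: "'a::euclidean_space"
  assumes "c \<noteq> 0" and [measurable]: "f \<in> borel_measurable lebesgue"
  shows "(\<integral>\<^sup>+x. f x \<partial>lebesgue) = ennreal (\<bar>c\<bar> ^ DIM('a)) * (\<integral>\<^sup>+x. f (t + c *\<^sub>R x) \<partial>lebesgue)"
proof -
  note [measurable] = lebesgue_affine_scaleR(2)[OF assms(1), of t]
  show ?thesis
    by (subst lebesgue_affine_scaleR(1)[OF assms(1), of t])
       (simp add: nn_integral_density nn_integral_distr nn_integral_cmult)
qed

lemma measurable_lebesgue_affine:
  fixes t :: "'a::euclidean_space"
  assumes "c \<noteq> 0" and "f \<in> borel_measurable lebesgue"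
  shows "(\<lambda>x. f (t + c *\<^sub>R x)) \<in> borel_measurable lebesgue"
  using measurable_compose[OF lebesgue_affine_scaleR(2)[OF assms(1)] assms(2)] .

lemma lebesgue_integral_shift:
  fixes f :: "'a::euclidean_space \<Rightarrow> real"
  assumes [measurable]: "f \<in> borel_measurable lebesgue"
  shows "(LINT x|lebesgue. f (a + x)) = (LINT x|lebesgue. f x)"
proof -
  have "(LINT x|lebesgue. f x) = (LINT x|distr lebesgue lebesgue (\<lambda>x. a + x). f x)"
    using lebesgue_affine_scaleR(1)[of 1 a] by (simp add: density_1)
  also have "\<dots> = (LINT x|lebesgue. f (a + x))"
    using lebesgue_affine_scaleR(2)[of 1 a] by (subst integral_distr) simp_all
  finally show ?thesis by simp
qed

lemma borel_measurable_lebesgue_on_iff: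
  fixes f :: "real^'n \<Rightarrow> real"
  assumes "S \<in> sets lebesgue"
  shows "f \<in> borel_measurable (lebesgue_on S) \<longleftrightarrow> (\<lambda>x. indicator S x * f x) \<in> borel_measurable lebesgue"
  using assms borel_measurable_restrict_space_iff[of S lebesgue f] by simp

text \<open>The power of d explains the exponents of the theorem: for n / 2 it is d^2, the factor of
  a Laplacian; the powers for \<open>crit_p\<close> and \<open>crit_p'\<close> differ by d^2, those
  for 2 and \<open>crit_p'\<close> by d.\<close>

lemma Lnorm_affine:
  fixes f :: "real^'n \<Rightarrow> real"
  assumes "0 < p" "0 < d" "f \<in> borel_measurable (lebesgue_on (ball a d))"
  shows "Lnorm p (ball a d) f = ennreal (d powr (real CARD('n) / p)) * Lnorm p (ball 0 1) (\<lambda>x. f (a + d *\<^sub>R x))"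
    and "(\<lambda>x. f (a + d *\<^sub>R x)) \<in> borel_measurable (lebesgue_on (ball 0 1))"
proof -
  have i: "indicator (ball a d) (a + d *\<^sub>R x) = indicator (ball 0 1) x" for x :: "real^'n"
    using assms(2) by (simp add: indicator_def dist_norm)
  have m: "(\<lambda>x. indicator (ball a d) x * f x) \<in> borel_measurable lebesgue"
    using assms(3) by (subst (asm) borel_measurable_lebesgue_on_iff) auto
  from measurable_lebesgue_affine[OF _ this, of d a] assms(2)
  have m2: "(\<lambda>x. indicator (ball 0 1) x * f (a + d *\<^sub>R x)) \<in> borel_measurable lebesgue"
    unfolding i by simp
  then show "(\<lambda>x. f (a + d *\<^sub>R x)) \<in> borel_measurable (lebesgue_on (ball 0 1))"
    by (subst borel_measurable_lebesgue_on_iff) auto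
  have B: "ball 0 1 \<in> sets (lebesgue :: (real^'n) measure)" by simp
  have e: "ennreal (norm y powr p) * indicator S x = ennreal (norm (indicator S x * y) powr p)" for y :: real and S and x :: "real^'n"
    using assms(1) by (auto simp: indicator_def)
  have "Lnorm p (ball a d) f = ennreal_root p (\<integral>\<^sup>+x. ennreal (norm (indicator (ball a d) x * f x) powr p) \<partial>lebesgue)"
    by (subst Lnorm_alt) (simp_all only: e, simp)
  also have "\<dots> = ennreal_root p (ennreal (\<bar>d\<bar> ^ CARD('n)) * (\<integral>\<^sup>+x. ennreal (norm (indicator (ball 0 1) x * f (a + d *\<^sub>R x)) powr p) \<partial>lebesgue))"
    using assms(2) m by (subst nn_integral_lebesgue_affine[of d _ a]) (auto simp: i)
  also have "\<dots> = ennreal_root p (ennreal (d powr real CARD('n))) * Lnorm p (ball 0 1) (\<lambda>x. f (a + d *\<^sub>R x))"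
    unfolding Lnorm_alt[OF B] e using assms(1,2) by (simp only: ennreal_root_mult powr_realpow abs_of_pos)
  finally show "Lnorm p (ball a d) f = ennreal (d powr (real CARD('n) / p)) * Lnorm p (ball 0 1) (\<lambda>x. f (a + d *\<^sub>R x))"
    by (simp add: ennreal_root_ennreal powr_powr)
qed

lemma smooth_measurable_borel: "smooth f \<Longrightarrow> f \<in> borel_measurable borel"
  by (intro borel_measurable_continuous_onI smooth_continuous)

lemma smooth_measurable: "smooth f \<Longrightarrow> S \<in> sets lebesgue \<Longrightarrow> f \<in> borel_measurable (lebesgue_on S)"
  by (intro continuous_imp_measurable_on_sets_lebesgue smooth_continuous)

lemma smooth_measurable_lebesgue: "smooth f \<Longrightarrow> f \<in> borel_measurable lebesgue"
  using smooth_measurable[of f UNIV] by (simp add: lebesgue_on_UNIV_eq)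

lemma smooth_shift_flip:
  fixes J :: "real^'n \<Rightarrow> real"
  assumes "smooth J" shows "smooth (\<lambda>y. J (x - y))"
  using smooth_affine[OF assms, of x "-1"] by simp

lemma integrable_bounded_supp:
  fixes f :: "real^'n \<Rightarrow> real"
  assumes "f \<in> borel_measurable lebesgue" "\<And>x. \<bar>f x\<bar> \<le> C" "bounded T" "\<And>x. x \<notin> T \<Longrightarrow> f x = 0"
  shows "integrable lebesgue f"
proof -
  obtain r where r: "T \<subseteq> cball 0 r" using assms(3) by (auto simp: bounded_iff subset_eq)
  show ?thesis
  proof (rule Bochner_Integration.integrable_bound[of _ "\<lambda>x. indicator (cball 0 r) x * C"])
    show "integrable lebesgue (\<lambda>x::real^'n. indicator (cball 0 r) x * C)"
      using lmeasurable_cball[of "0::real^'n" r]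
      by (intro integrable_mult_left integrable_real_indicator) (auto simp: fmeasurable_def)
    show "AE x in lebesgue. norm (f x) \<le> norm (indicator (cball 0 r) x * C)"
    proof (rule AE_I2)
      fix x show "norm (f x) \<le> norm (indicator (cball 0 r) x * C)"
        using assms(2)[of x] assms(4)[of x] subsetD[OF r, of x] by (cases "x \<in> cball 0 r") auto
    qed
  qed (rule assms(1))
qed

lemma test_functions_integrable:
  fixes f :: "real^'n \<Rightarrow> real"
  assumes "f \<in> test_functions S" shows "integrable lebesgue f"
proof -
  obtain C where "\<And>x. \<bar>f x\<bar> \<le> C" using test_functions_bounded[OF assms] by blast
  then show ?thesis
    using assms by (intro integrable_bounded_supp[of f C "supp f"] smooth_measurable_lebesgue)
      (auto simp: test_functions_iff not_in_supp compact_imp_bounded)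
qed

text \<open>Translation invariance makes the integral of every difference quotient vanish.\<close>

lemma integral_pderiv_eq_0:
  fixes f :: "real^'n \<Rightarrow> real"
  assumes "f \<in> test_functions S"
  shows "(LINT x|lebesgue. pderiv_at i f x) = 0"
proof -
  have sm: "smooth f" and [measurable]: "f \<in> borel_measurable lebesgue"
    using assms by (auto simp: test_functions_iff smooth_measurable_lebesgue)
  have int: "integrable lebesgue f" by (rule test_functions_integrable[OF assms])
  obtain L where L: "L \<ge> 0" "\<And>x y. \<bar>f x - f y\<bar> \<le> L * norm (x - y)"
    using test_functions_Lipschitz[OF assms] by blast
  have "bounded (supp f)" using assms by (auto simp: test_functions_iff compact_imp_bounded)
  then obtain r where r: "\<And>x. x \<in> supp f \<Longrightarrow> norm x \<le> r" by (auto simp: bounded_iff)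
  let ?e = "axis i (1::real)"
  define t where "t k = 1 / real (Suc k)" for k
  have t: "t k > 0" "t k \<le> 1" for k by (auto simp: t_def)
  have t0: "t \<longlonglongrightarrow> 0" unfolding t_def by (rule LIMSEQ_Suc[OF lim_1_over_n])
  define s where "s k x = (f (x + t k *\<^sub>R ?e) - f x) / t k" for k x
  have ms: "(\<lambda>x. f (x + a)) \<in> borel_measurable lebesgue" for a
    using measurable_lebesgue_affine[of 1 f a] by (simp add: add.commute)
  have shi: "integrable lebesgue (\<lambda>x. f (x + a))" for a
  proof -
    have "(\<lambda>x. f (a + 1 *\<^sub>R x)) \<in> test_functions UNIV"
      by (rule test_functions_affine[OF assms]) auto
    from test_functions_integrable[OF this] show ?thesis by (simp add: add.commute)
  qed
  have z: "(LINT x|lebesgue. s k x) = 0" for k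
    unfolding s_def using int shi[of "t k *\<^sub>R ?e"] lebesgue_integral_shift[of f "t k *\<^sub>R ?e"] by (simp add: add.commute)
  \<comment> \<open>The shifts are at most 1, so all quotients vanish outside radius r + 1; inside,
    the Lipschitz constant dominates them.\<close>
  have "(\<lambda>k. LINT x|lebesgue. s k x) \<longlonglongrightarrow> (LINT x|lebesgue. pderiv_at i f x)"
  proof (rule integral_dominated_convergence[where w="\<lambda>x. L * indicator (cball 0 (r + 1)) x"])
    show "pderiv_at i f \<in> borel_measurable lebesgue"
      using smooth_pderiv[OF sm] smooth_measurable_lebesgue by blast
    show "s k \<in> borel_measurable lebesgue" for k
      unfolding s_def using ms by measurable
    show "integrable lebesgue (\<lambda>x::real^'n. L * indicator (cball 0 (r + 1)) x)"
      using lmeasurable_cball[of "0::real^'n" "r + 1"]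
      by (intro integrable_mult_right integrable_real_indicator) (auto simp: fmeasurable_def)
    show "AE x in lebesgue. (\<lambda>k. s k x) \<longlonglongrightarrow> pderiv_at i f x"
    proof (rule AE_I2)
      fix x
      have "((\<lambda>h. f (x + h *\<^sub>R ?e)) has_derivative (\<lambda>h. frechet_derivative f (at x) (h *\<^sub>R ?e))) (at 0)"
      proof -
        have "((\<lambda>h. x + h *\<^sub>R ?e) has_derivative (\<lambda>h. h *\<^sub>R ?e)) (at 0)"
          by (auto intro!: derivative_eq_intros)
        from diff_chain_at[OF this, of f "frechet_derivative f (at x)"] smooth_has_derivative[OF sm, of x]
        show ?thesis by (simp add: o_def)
      qed
      moreover have "frechet_derivative f (at x) (h *\<^sub>R ?e) = pderiv_at i f x * h" for h
        using linear_cmul[OF has_derivative_linear[OF smooth_has_derivative[OF sm]]]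
        by (simp add: pderiv_at_def mult.commute)
      ultimately have "((\<lambda>h. f (x + h *\<^sub>R ?e)) has_field_derivative pderiv_at i f x) (at 0)"
        by (simp add: has_field_derivative_def)
      then have "((\<lambda>h. (f (x + h *\<^sub>R ?e) - f x) / h) \<longlongrightarrow> pderiv_at i f x) (at 0)"
        by (simp add: has_field_derivative_iff)
      then show "(\<lambda>k. s k x) \<longlonglongrightarrow> pderiv_at i f x"
        unfolding s_def by (rule filterlim_compose) (use t0 t(1) in \<open>auto simp: filterlim_at less_imp_neq[THEN not_sym]\<close>)
    qed
    show "AE x in lebesgue. norm (s k x) \<le> L * indicator (cball 0 (r + 1)) x" for k
    proof (rule AE_I2)
      fix x :: "real^'n"
      have b: "\<bar>s k x\<bar> \<le> L"
        using L(2)[of "x + t k *\<^sub>R ?e" x] t(1)[of k] by (simp add: s_def field_simps)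
      show "norm (s k x) \<le> L * indicator (cball 0 (r + 1)) x"
      proof (cases "x \<in> cball 0 (r + 1)")
        case False
        then have n: "norm x > r + 1" by simp
        have "norm x \<le> norm (x + t k *\<^sub>R ?e) + norm (t k *\<^sub>R ?e)"
          using norm_triangle_ineq4[of "x + t k *\<^sub>R ?e" "t k *\<^sub>R ?e"] by simp
        then have "norm (x + t k *\<^sub>R ?e) > r" using n t[of k] by simp
        then have "f (x + t k *\<^sub>R ?e) = 0" "f x = 0" using r n not_in_supp by force+
        then show ?thesis using False by (simp add: s_def)
      qed (use b in simp)
    qed
  qed
  then show ?thesis by (simp add: z LIMSEQ_const_iff)
qed

section \<open>Convolution with a test function\<close>

definition conv :: "(real^'n \<Rightarrow> real) \<Rightarrow> (real^'n \<Rightarrow> real) \<Rightarrow> real^'n \<Rightarrow> real" where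
  "conv J v x = (LINT y|lebesgue. J (x - y) * v y)"

lemma integrable_conv:
  fixes J v :: "real^'n \<Rightarrow> real"
  assumes "J \<in> test_functions S" "integrable lebesgue v"
  shows "integrable lebesgue (\<lambda>y. J (x - y) * v y)"
proof -
  obtain C where C: "\<And>x. \<bar>J x\<bar> \<le> C" using test_functions_bounded[OF assms(1)] by blast
  have [measurable]: "(\<lambda>y. J (x - y)) \<in> borel_measurable lebesgue"
    using smooth_measurable_lebesgue smooth_shift_flip test_functions_smooth[OF assms(1)] by blast
  show ?thesis
  proof (rule Bochner_Integration.integrable_bound[of _ "\<lambda>y. C * v y"])
    show "AE y in lebesgue. norm (J (x - y) * v y) \<le> norm (C * v y)"
      using C order_trans[OF C abs_ge_self] by (intro AE_I2) (auto simp: abs_mult intro!: mult_right_mono)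
  qed (use assms(2) in auto)
qed

text \<open>Differentiation under the integral. As v is merely integrable, the remainder of the
  first-order expansion of J is dominated by (L + M) * |v|: L bounds the increment of J and M its
  linear part.\<close>

lemma conv_has_derivative:
  fixes J v :: "real^'n \<Rightarrow> real"
  assumes J: "J \<in> test_functions S" and v: "integrable lebesgue v"
  shows "(conv J v has_derivative (\<lambda>h. \<Sum>i\<in>UNIV. h $ i * conv (pderiv_at i J) v x)) (at x)"
proof -
  have sm: "smooth J" using J test_functions_smooth by blast
  have [measurable]: "v \<in> borel_measurable lebesgue" using v by auto
  have mJ[measurable]: "(\<lambda>y. J (x - y)) \<in> borel_measurable lebesgue" for x
    using smooth_measurable_lebesgue smooth_shift_flip sm by blast
  have mpJ[measurable]: "(\<lambda>y. pderiv_at i J (x - y)) \<in> borel_measurable lebesgue" for x i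
    using smooth_measurable_lebesgue smooth_shift_flip smooth_pderiv[OF sm] by blast
  obtain L where L: "L \<ge> 0" "\<And>x y. \<bar>J x - J y\<bar> \<le> L * norm (x - y)"
    using test_functions_Lipschitz[OF J] by blast
  have "\<forall>i. \<exists>C\<ge>0. \<forall>x. \<bar>pderiv_at i J x\<bar> \<le> C"
    using test_functions_bounded[OF test_functions_pderiv[OF J]] by blast
  then obtain C where C: "\<And>i. C i \<ge> 0" "\<And>i x. \<bar>pderiv_at i J x\<bar> \<le> C i" by metis
  define M where "M = (\<Sum>i\<in>UNIV. C i)"
  define D where "D h z = (\<Sum>i\<in>UNIV. h $ i * pderiv_at i J z)" for h :: "real^'n" and z
  have Db: "\<bar>D h z\<bar> \<le> M * norm h" for h z
  proof -
    have "\<bar>D h z\<bar> \<le> (\<Sum>i\<in>UNIV. \<bar>h $ i * pderiv_at i J z\<bar>)" unfolding D_def by (rule sum_abs)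
    also have "\<dots> \<le> (\<Sum>i\<in>UNIV. norm h * C i)"
      using C component_le_norm_cart[of h] by (intro sum_mono) (auto simp: abs_mult intro!: mult_mono)
    finally show ?thesis by (simp add: M_def sum_distrib_left mult.commute)
  qed
  define R where "R h y = (J (x + h - y) - J (x - y) - D h (x - y)) / norm h * v y" for h y
  have iJ: "integrable lebesgue (\<lambda>y. J (z - y) * v y)" for z by (rule integrable_conv[OF J v])
  have ipJ: "integrable lebesgue (\<lambda>y. pderiv_at i J (z - y) * v y)" for z i
    by (rule integrable_conv[OF test_functions_pderiv[OF J] v])
  have iD: "integrable lebesgue (\<lambda>y. D h (x - y) * v y)"
     "(LINT y|lebesgue. D h (x - y) * v y) = (\<Sum>i\<in>UNIV. h $ i * conv (pderiv_at i J) v x)" for h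
    unfolding D_def sum_distrib_right mult.assoc conv_def using ipJ by (simp_all add: integral_sum)
  have IR: "(LINT y|lebesgue. R h y) = (conv J v (x + h) - conv J v x - (\<Sum>i\<in>UNIV. h $ i * conv (pderiv_at i J) v x)) / norm h" for h
  proof -
    have "R h = (\<lambda>y. (J (x + h - y) * v y - J (x - y) * v y - D h (x - y) * v y) / norm h)"
      by (rule ext) (simp add: R_def algebra_simps diff_divide_distrib)
    then show ?thesis using iJ[of "x + h"] iJ[of x] iD(1)[of h]
      by (simp add: conv_def iD(2)[unfolded conv_def])
  qed
  \<comment> \<open>Dominated convergence speaks of sequences, so the limit at 0 is tested along an
    arbitrary sequence of nonzero increments.\<close>
  have lim: "((\<lambda>h. LINT y|lebesgue. R h y) \<longlongrightarrow> 0) (at 0)"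
    unfolding tendsto_at_iff_sequentially
  proof (intro allI impI)
    fix X :: "nat \<Rightarrow> real^'n" assume X: "\<forall>i. X i \<in> UNIV - {0}" "X \<longlonglongrightarrow> 0"
    have "(\<lambda>k. LINT y|lebesgue. R (X k) y) \<longlonglongrightarrow> (LINT y|(lebesgue::(real^'n) measure). 0)"
    proof (rule integral_dominated_convergence[where w="\<lambda>y. (L + M) * \<bar>v y\<bar>"])
      show "R (X k) \<in> borel_measurable lebesgue" for k
        unfolding R_def D_def using mJ mpJ by measurable
      show "integrable lebesgue (\<lambda>y. (L + M) * \<bar>v y\<bar>)" using v by auto
      show "AE y in lebesgue. (\<lambda>k. R (X k) y) \<longlonglongrightarrow> 0"
      proof (rule AE_I2)
        fix y
        have "((\<lambda>h. norm (J ((x - y) + h) - J (x - y) - D h (x - y)) / norm h) \<longlongrightarrow> 0) (at 0)"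
          using smooth_has_derivative'[OF sm, of "x - y"] unfolding has_derivative_at D_def by blast
        then have "((\<lambda>k. norm (J ((x - y) + X k) - J (x - y) - D (X k) (x - y)) / norm (X k)) \<longlongrightarrow> 0) sequentially"
          by (rule filterlim_compose) (use X in \<open>auto simp: filterlim_at\<close>)
        then have "(\<lambda>k. norm ((J ((x - y) + X k) - J (x - y) - D (X k) (x - y)) / norm (X k))) \<longlonglongrightarrow> 0" by simp
        then have "(\<lambda>k. (J ((x - y) + X k) - J (x - y) - D (X k) (x - y)) / norm (X k)) \<longlonglongrightarrow> 0"
          by (rule tendsto_norm_zero_cancel)
        then have "(\<lambda>k. (J ((x - y) + X k) - J (x - y) - D (X k) (x - y)) / norm (X k) * v y) \<longlonglongrightarrow> 0 * v y"
          by (intro tendsto_intros)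
        then show "(\<lambda>k. R (X k) y) \<longlonglongrightarrow> 0" by (simp add: R_def algebra_simps)
      qed
      show "AE y in lebesgue. norm (R (X k) y) \<le> (L + M) * \<bar>v y\<bar>" for k
      proof (rule AE_I2)
        fix y
        have "X k \<noteq> 0" using X(1) by auto
        then have n: "norm (X k) > 0" by simp
        have "\<bar>J (x + X k - y) - J (x - y) - D (X k) (x - y)\<bar> \<le> (L + M) * norm (X k)"
          using L(2)[of "x + X k - y" "x - y"] Db[of "X k" "x - y"] by (simp add: algebra_simps)
        then have "\<bar>J (x + X k - y) - J (x - y) - D (X k) (x - y)\<bar> / norm (X k) \<le> L + M"
          using n by (simp add: pos_divide_le_eq)
        then show "norm (R (X k) y) \<le> (L + M) * \<bar>v y\<bar>"
          unfolding R_def using mult_right_mono[of _ "L + M" "\<bar>v y\<bar>"] by (fastforce simp: abs_mult)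
      qed
    qed simp
    then show "((\<lambda>h. LINT y|lebesgue. R h y) \<circ> X) \<longlonglongrightarrow> 0" by (simp add: o_def)
  qed
  show ?thesis
    unfolding has_derivative_at
  proof
    show "bounded_linear (\<lambda>h. \<Sum>i\<in>UNIV. h $ i * conv (pderiv_at i J) v x)"
      by (intro bounded_linear_sum bounded_linear_mult_const bounded_linear_vec_nth)
    show "((\<lambda>h. norm (conv J v (x + h) - conv J v x - (\<Sum>i\<in>UNIV. h $ i * conv (pderiv_at i J) v x)) / norm h) \<longlongrightarrow> 0) (at 0)"
      using tendsto_norm_zero[OF lim] by (simp add: IR)
  qed
qed

lemma pderiv_conv:
  assumes "J \<in> test_functions S" "integrable lebesgue v"
  shows "pderiv_at i (conv J v) = conv (pderiv_at i J) v"
proof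
  fix x
  have "axis i 1 $ j * c = (if j = i then c else 0)" for j and c :: real by (simp add: axis_def)
  then show "pderiv_at i (conv J v) x = conv (pderiv_at i J) v x"
    by (simp add: pderiv_at_eqI[OF conv_has_derivative[OF assms]])
qed

lemma smooth_conv:
  assumes "J \<in> test_functions S" "integrable lebesgue v"
  shows "smooth (conv J v)"
proof (rule smooth_coinduct[of "\<lambda>f. \<exists>J\<in>test_functions S. f = conv J v"])
  fix f assume "\<exists>J\<in>test_functions S. f = conv J v"
  then obtain J where J: "J \<in> test_functions S" "f = conv J v" by blast
  show "f differentiable_on UNIV \<and> (\<forall>i. \<exists>J\<in>test_functions S. pderiv_at i f = conv J v)"
    using conv_has_derivative[OF J(1) assms(2)] pderiv_conv[OF J(1) assms(2)] test_functions_pderiv[OF J(1)]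
    unfolding J(2) by (auto simp: differentiable_on_def differentiable_def)
qed (use assms in auto)

lemma Lnorm_UNIV: "Lnorm p UNIV f = ennreal_root p (\<integral>\<^sup>+x. ennreal (norm (f x) powr p) \<partial>lebesgue)"
  by (simp add: Lnorm_def lebesgue_on_UNIV_eq)

text \<open>Jensen's inequality for the probability density J (x - y), derived from Hoelder's
  inequality by splitting J into J powr (1/p) * J powr (1/q).\<close>

lemma conv_le_root:
  fixes J v :: "real^'n \<Rightarrow> real"
  assumes p: "1 \<le> p" and J: "J \<in> test_functions S" "\<And>x. 0 \<le> J x" "(LINT x|lebesgue. J x) = 1"
    and v[measurable]: "v \<in> borel_measurable lebesgue"
  shows "ennreal \<bar>conv J v x\<bar> \<le> ennreal_root p (\<integral>\<^sup>+y. ennreal (J (x - y) * \<bar>v y\<bar> powr p) \<partial>lebesgue)"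
proof -
  have sm: "smooth J" using J test_functions_smooth by blast
  have mJ[measurable]: "(\<lambda>y. J (x - y)) \<in> borel_measurable lebesgue"
    using smooth_measurable_lebesgue smooth_shift_flip sm by blast
  have J1: "(\<integral>\<^sup>+y. ennreal (J (x - y)) \<partial>lebesgue) = 1"
  proof -
    have "(\<integral>\<^sup>+y. ennreal (J (x + (-1) *\<^sub>R y)) \<partial>lebesgue) = (\<integral>\<^sup>+y. ennreal (J y) \<partial>lebesgue)"
      using nn_integral_lebesgue_affine[of "-1" "\<lambda>y. ennreal (J y)" x] smooth_measurable_lebesgue[OF sm] by simp
    also have "\<dots> = 1"
      using nn_integral_eq_integral[OF test_functions_integrable[OF J(1)]] J(2,3) by simp
    finally show ?thesis by simp
  qed
  \<comment> \<open>Where the integrand is not integrable, the Bochner integral is 0 by default and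
    the bound is trivial.\<close>
  have "ennreal \<bar>conv J v x\<bar> \<le> (\<integral>\<^sup>+y. ennreal \<bar>J (x - y) * v y\<bar> \<partial>lebesgue)"
    unfolding conv_def using integral_norm_bound_ennreal[of lebesgue "\<lambda>y. J (x - y) * v y"]
    by (cases "integrable lebesgue (\<lambda>y. J (x - y) * v y)") (auto simp: not_integrable_integral_eq)
  also have "\<dots> \<le> ennreal_root p (\<integral>\<^sup>+y. ennreal (J (x - y) * \<bar>v y\<bar> powr p) \<partial>lebesgue)"
  proof (cases "p = 1")
    case True
    then show ?thesis using J(2) by (simp add: abs_mult)
  next
    case False
    then have p1: "p > 1" using p by simp
    define q where "q = p / (p - 1)"
    have q: "1 < q" "1/p + 1/q = 1" using p1 by (auto simp: q_def field_simps)
    have J_split: "J z powr (1/p) * J z powr (1/q) = J z" for z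
      using J(2)[of z] q(2) by (cases "J z = 0") (auto simp: powr_add[symmetric])
    have "(\<integral>\<^sup>+y. ennreal \<bar>(J (x - y) powr (1/p) * \<bar>v y\<bar>) * J (x - y) powr (1/q)\<bar> \<partial>lebesgue) \<le>
      ennreal_root p (\<integral>\<^sup>+y. ennreal (\<bar>J (x - y) powr (1/p) * \<bar>v y\<bar>\<bar> powr p) \<partial>lebesgue) *
      ennreal_root q (\<integral>\<^sup>+y. ennreal (\<bar>J (x - y) powr (1/q)\<bar> powr q) \<partial>lebesgue)"
      using p1 q by (intro nn_integral_Holder) auto
    also have "(\<lambda>y. \<bar>(J (x - y) powr (1/p) * \<bar>v y\<bar>) * J (x - y) powr (1/q)\<bar>) = (\<lambda>y. \<bar>J (x - y) * v y\<bar>)"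
      by (rule ext) (use J_split J(2) in \<open>simp add: abs_mult mult.assoc mult.left_commute\<close>)
    also have "(\<lambda>y. \<bar>J (x - y) powr (1/q)\<bar> powr q) = (\<lambda>y. J (x - y))"
      using q J(2) by (auto simp: powr_powr)
    also have "(\<lambda>y. \<bar>J (x - y) powr (1/p) * \<bar>v y\<bar>\<bar> powr p) = (\<lambda>y. J (x - y) * \<bar>v y\<bar> powr p)"
      using p1 J(2) by (auto simp: powr_powr powr_mult abs_mult)
    finally show ?thesis using q ennreal_root_ennreal[of 1 q] by (simp add: J1 ennreal_root_def)
  qed
  finally show ?thesis .
qed

lemma ennreal_le_root_imp_powr_le:
  assumes "0 < p" "0 \<le> a" "ennreal a \<le> ennreal_root p X"
  shows "ennreal (a powr p) \<le> X"
proof (cases X)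
  case (real r)
  then have "a \<le> r powr (1/p)" using assms by (simp add: ennreal_root_ennreal)
  then have "a powr p \<le> (r powr (1/p)) powr p" using assms by (intro powr_mono2) auto
  then show ?thesis using real assms by (simp add: powr_powr ennreal_leI)
qed simp

text \<open>Jensen's inequality at each x, then Tonelli: for every y the integral of J (x - y) over
  x is 1.\<close>

lemma Lnorm_conv_le:
  fixes J v :: "real^'n \<Rightarrow> real"
  assumes p: "1 \<le> p" and J: "J \<in> test_functions S" "\<And>x. 0 \<le> J x" "(LINT x|lebesgue. J x) = 1"
    and v: "v \<in> borel_measurable lebesgue"
  shows "Lnorm p UNIV (conv J v) \<le> Lnorm p UNIV v"
proof -
  have sm: "smooth J" using J test_functions_smooth by blast
  note [measurable] = smooth_measurable_borel[OF sm]
  \<comment> \<open>Tonelli is applied to \<open>lborel\<close>, so the Lebesgue measurable v is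
    first replaced by a Borel function equal to it almost everywhere.\<close>
  obtain w where w[measurable]: "w \<in> borel_measurable lborel" and vw: "AE x in lborel. v x = w x"
    using completion_ex_borel_measurable_real[OF v] by blast
  have ae: "AE x in lebesgue. v x = w x" using vw by (rule AE_completion)
  have c: "conv J v x = conv J w x" for x
    unfolding conv_def
    by (rule integral_cong_AE)
       (use ae v w smooth_measurable_lebesgue[OF smooth_shift_flip[OF sm]] in \<open>auto elim!: eventually_mono intro!: borel_measurable_times measurable_completion\<close>)
  have J1: "(\<integral>\<^sup>+x. ennreal (J (x - y)) \<partial>lborel) = 1" for y
  proof -
    have "(\<integral>\<^sup>+x. ennreal (J (- y + 1 *\<^sub>R x)) \<partial>lebesgue) = (\<integral>\<^sup>+y. ennreal (J y) \<partial>lebesgue)"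
      using nn_integral_lebesgue_affine[of "1" "\<lambda>y. ennreal (J y)" "-y"] smooth_measurable_lebesgue[OF sm] by simp
    also have "\<dots> = 1"
      using nn_integral_eq_integral[OF test_functions_integrable[OF J(1)]] J(2,3) by simp
    finally show ?thesis by (simp add: nn_integral_completion)
  qed
  have "(\<integral>\<^sup>+x. ennreal (norm (conv J v x) powr p) \<partial>lebesgue)
     \<le> (\<integral>\<^sup>+x. \<integral>\<^sup>+y. ennreal (J (x - y) * \<bar>w y\<bar> powr p) \<partial>lborel \<partial>lborel)"
    unfolding nn_integral_completion
  proof (rule nn_integral_mono)
    fix x
    have "ennreal \<bar>conv J w x\<bar> \<le> ennreal_root p (\<integral>\<^sup>+y. ennreal (J (x - y) * \<bar>w y\<bar> powr p) \<partial>lebesgue)"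
      using w by (intro conv_le_root[OF p J]) (auto intro: measurable_completion)
    from ennreal_le_root_imp_powr_le[OF _ _ this] p
    show "ennreal (norm (conv J v x) powr p) \<le> (\<integral>\<^sup>+y. ennreal (J (x - y) * \<bar>w y\<bar> powr p) \<partial>lborel)"
      by (simp add: c nn_integral_completion)
  qed
  also have "\<dots> = (\<integral>\<^sup>+y. \<integral>\<^sup>+x. ennreal (J (x - y) * \<bar>w y\<bar> powr p) \<partial>lborel \<partial>lborel)"
    by (rule lborel_pair.Fubini'[symmetric]) measurable
  also have "\<dots> = (\<integral>\<^sup>+y. ennreal (\<bar>w y\<bar> powr p) \<partial>lborel)"
  proof (rule nn_integral_cong)
    fix y
    have "(\<integral>\<^sup>+x. ennreal (J (x - y) * \<bar>w y\<bar> powr p) \<partial>lborel) = (\<integral>\<^sup>+x. ennreal (\<bar>w y\<bar> powr p) * ennreal (J (x - y)) \<partial>lborel)"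
      using J(2) by (intro nn_integral_cong) (simp add: ennreal_mult[symmetric] mult.commute)
    also have "\<dots> = ennreal (\<bar>w y\<bar> powr p)"
      by (subst nn_integral_cmult) (auto simp: J1)
    finally show "(\<integral>\<^sup>+x. ennreal (J (x - y) * \<bar>w y\<bar> powr p) \<partial>lborel) = ennreal (\<bar>w y\<bar> powr p)" .
  qed
  also have "\<dots> = (\<integral>\<^sup>+x. ennreal (norm (v x) powr p) \<partial>lebesgue)"
    unfolding nn_integral_completion by (rule nn_integral_cong_AE) (use vw in \<open>auto elim!: eventually_mono\<close>)
  finally show ?thesis
    unfolding Lnorm_UNIV using p by (intro ennreal_root_mono) auto
qed

section \<open>Mollifiers\<close>

definition mollifier :: "(nat \<Rightarrow> real^'n \<Rightarrow> real) \<Rightarrow> bool" where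
  "mollifier J \<longleftrightarrow> (\<forall>k. J k \<in> test_functions (ball 0 (1 / real (Suc k))) \<and> (\<forall>x. 0 \<le> J k x) \<and> (LINT x|lebesgue. J k x) = 1)"

text \<open>The bump is squeezed into radius 1 / (k + 1) and divided by its integral, which is
  positive because the squeezed bump dominates the indicator of a ball.\<close>

lemma mollifier_exists:
  fixes \<phi> :: "real^'n \<Rightarrow> real"
  assumes \<phi>: "\<phi> \<in> test_functions (ball 0 1)" "\<And>x. 0 \<le> \<phi> x" "\<And>x. x \<in> ball 0 (1/2) \<Longrightarrow> \<phi> x = 1"
  shows "\<exists>J :: nat \<Rightarrow> real^'n \<Rightarrow> real. mollifier J"
proof -
  define K where "K k x = \<phi> (0 + real (Suc k) *\<^sub>R x)" for k x
  have K: "K k \<in> test_functions (ball 0 (1 / real (Suc k)))" for k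
    unfolding K_def
    by (rule test_functions_affine[OF \<phi>(1)]) (auto simp: field_simps simp del: of_nat_Suc)
  have Kpos: "0 < (LINT x|lebesgue. K k x)" for k
  proof -
    have K1: "K k x = 1" if "x \<in> ball 0 (1 / (2 * real (Suc k)))" for x
      using that by (auto simp: K_def intro!: \<phi>(3)) (simp add: field_simps)
    have "0 < measure lebesgue (ball (0::real^'n) (1 / (2 * real (Suc k))))"
      using content_ball_pos[of "1 / (2 * real (Suc k))" "0::real^'n"] by simp
    also have "\<dots> = (LINT x|lebesgue. indicator (ball (0::real^'n) (1 / (2 * real (Suc k)))) x)"
      by simp
    also have "\<dots> \<le> (LINT x|lebesgue. K k x)"
    proof (rule integral_mono)
      show "integrable lebesgue (\<lambda>x::real^'n. indicat_real (ball 0 (1 / (2 * real (Suc k)))) x)"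
        using lmeasurable_ball[of "0::real^'n" "1 / (2 * real (Suc k))"]
        by (intro integrable_real_indicator) (auto simp: fmeasurable_def)
      show "integrable lebesgue (K k)" by (rule test_functions_integrable[OF K])
      show "indicat_real (ball 0 (1 / (2 * real (Suc k)))) x \<le> K k x" for x
        using K1[of x] \<phi>(2) by (cases "x \<in> ball 0 (1 / (2 * real (Suc k)))") (auto simp: K_def)
    qed
    finally show ?thesis .
  qed
  have K0: "0 \<le> K k x" for k x using \<phi>(2) by (simp add: K_def)
  have "mollifier (\<lambda>k x. inverse (LINT x|lebesgue. K k x) * K k x)"
    unfolding mollifier_def
  proof (intro allI conjI)
    fix k x
    show "(\<lambda>x. inverse (LINT x|lebesgue. K k x) * K k x) \<in> test_functions (ball 0 (1 / real (Suc k)))"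
      by (rule test_functions_mult'[OF K smooth_const])
    show "0 \<le> inverse (LINT x|lebesgue. K k x) * K k x"
      using Kpos[of k] K0 by simp
    show "(LINT x|lebesgue. inverse (LINT x|lebesgue. K k x) * K k x) = 1"
      using Kpos[of k] by simp
  qed
  then show ?thesis by blast
qed

lemma mollifierD:
  assumes "mollifier J"
  shows "J k \<in> test_functions UNIV" "\<And>x. 0 \<le> J k x" "(LINT x|lebesgue. J k x) = 1"
    "norm x \<ge> 1 / real (Suc k) \<Longrightarrow> J k x = 0"
proof -
  have J: "J k \<in> test_functions (ball 0 (1 / real (Suc k)))" using assms by (simp add: mollifier_def)
  then show "J k \<in> test_functions UNIV" using test_functions_mono by blast
  show "J k x = 0" if "norm x \<ge> 1 / real (Suc k)"
    by (rule not_in_supp) (use J that in \<open>auto simp: test_functions_iff\<close>)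
qed (use assms in \<open>auto simp: mollifier_def\<close>)

lemma conv_diff:
  assumes "J \<in> test_functions S" "integrable lebesgue v" "integrable lebesgue w"
  shows "conv J (\<lambda>x. v x - w x) x = conv J v x - conv J w x"
  unfolding conv_def using integrable_conv[OF assms(1,2)] integrable_conv[OF assms(1,3)]
  by (simp add: right_diff_distrib)

lemma integral_shift_flip:
  assumes "J \<in> test_functions S"
  shows "(LINT y|lebesgue. J (x - y)) = (LINT y|lebesgue. J y)"
proof -
  have sm: "smooth J" using assms test_functions_smooth by blast
  have *: "(LINT y|lebesgue. f (- y)) = (LINT y|lebesgue. f y)" if "f \<in> borel_measurable lebesgue" for f :: "real^'n \<Rightarrow> real"
    using that lebesgue_affine_scaleR[of "-1" "0::real^'n"]
    by (simp add: density_1 integral_distr[of "\<lambda>x. - x" lebesgue lebesgue f, symmetric])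
  have "(LINT y|lebesgue. J (x - y)) = (LINT y|lebesgue. J (x + y))"
    using *[of "\<lambda>y. J (x + y)"] measurable_lebesgue_affine[of 1 J x] smooth_measurable_lebesgue[OF sm] by simp
  also have "\<dots> = (LINT y|lebesgue. J y)"
    by (rule lebesgue_integral_shift[OF smooth_measurable_lebesgue[OF sm]])
  finally show ?thesis .
qed

lemma tendsto_ennreal_zeroI:
  fixes f :: "nat \<Rightarrow> ennreal"
  assumes "\<And>e::real. e > 0 \<Longrightarrow> \<forall>\<^sub>F k in sequentially. f k \<le> ennreal e"
  shows "f \<longlonglongrightarrow> 0"
proof (rule tendsto_0_if_Limsup_eq_0_ennreal)
  have "limsup f \<le> 0 + ennreal e" if "0 < e" for e :: real
    using Limsup_bounded[OF assms[OF that]] by simp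
  then have "limsup f \<le> 0" by (rule ennreal_le_epsilon)
  then show "limsup f = 0" by simp
qed

lemma tendsto_ennreal_zeroD:
  fixes f :: "nat \<Rightarrow> ennreal"
  assumes "f \<longlonglongrightarrow> 0" "e > (0::real)" shows "\<forall>\<^sub>F k in sequentially. f k \<le> ennreal e"
proof -
  have "\<forall>\<^sub>F k in sequentially. f k < ennreal e" using assms by (intro order_tendstoD(2)[OF assms(1)]) simp
  then show ?thesis by eventually_elim simp
qed

text \<open>Uniform continuity makes the difference uniformly small, and the difference lives in a
  fixed ball, whose measure turns the uniform bound into an L^p bound.\<close>

lemma conv_mollifier_continuous:
  fixes g :: "real^'n \<Rightarrow> real"
  assumes m: "mollifier J" and g: "continuous_on UNIV g" and R: "R \<ge> 0" "\<And>x. norm x > R \<Longrightarrow> g x = 0" and p: "1 \<le> p"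
  shows "(\<lambda>k. Lnorm p UNIV (\<lambda>x. conv (J k) g x - g x)) \<longlonglongrightarrow> 0"
proof (rule tendsto_ennreal_zeroI)
  fix e :: real assume e: "e > 0"
  define V where "V = measure lebesgue (cball (0::real^'n) (R + 1)) powr (1/p)"
  define e' where "e' = e / (V + 1)"
  have V: "V \<ge> 0" by (simp add: V_def)
  then have e': "e' > 0" "e' * V \<le> e" using e by (auto simp: e'_def field_simps)
  \<comment> \<open>Here x ranges over radius R + 1 and y stays within distance 1 of x, hence R +
    2.\<close>
  have "uniformly_continuous_on (cball 0 (R + 2)) g"
    using g by (intro compact_uniformly_continuous) (auto intro: continuous_on_subset)
  then obtain \<delta> where \<delta>: "\<delta> > 0" "\<And>x y. x \<in> cball 0 (R+2) \<Longrightarrow> y \<in> cball 0 (R+2) \<Longrightarrow> dist y x < \<delta> \<Longrightarrow> dist (g y) (g x) < e'"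
    unfolding uniformly_continuous_on_def using e'(1) by metis
  have gi: "integrable lebesgue g"
  proof -
    have cs: "compact (supp g)" by (rule compact_supp[of "cball 0 R"]) (use R in auto)
    obtain C where "\<And>x. \<bar>g x\<bar> \<le> C" using continuous_compact_bounded[OF g cs] by blast
    then show ?thesis
      using g R(2) by (intro integrable_bounded_supp[of g C "cball 0 R"])
        (auto intro!: measurable_completion borel_measurable_continuous_onI)
  qed
  have ev: "\<forall>\<^sub>F k in sequentially. 1 / real (Suc k) < \<delta>"
    using order_tendstoD(2)[OF LIMSEQ_Suc[OF lim_1_over_n] \<delta>(1)] by simp
  show "\<forall>\<^sub>F k in sequentially. Lnorm p UNIV (\<lambda>x. conv (J k) g x - g x) \<le> ennreal e"
    using ev
  proof eventually_elim
    case (elim k)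
    note Jk = mollifierD[OF m, of k]
    have eq: "conv (J k) g x - g x = (LINT y|lebesgue. J k (x - y) * (g y - g x))" for x
    proof -
      have Ji: "integrable lebesgue (\<lambda>y. J k (x - y))"
        using test_functions_integrable[OF test_functions_affine[OF Jk(1), of "-1" x UNIV]] by simp
      have "(LINT y|lebesgue. J k (x - y) * (g y - g x)) = (LINT y|lebesgue. J k (x - y) * g y - J k (x - y) * g x)"
        by (simp add: right_diff_distrib)
      also have "\<dots> = conv (J k) g x - g x"
        using integrable_conv[OF Jk(1) gi, of x] Ji Jk(3) integral_shift_flip[OF Jk(1), of x]
        by (simp add: conv_def)
      finally show ?thesis ..
    qed
    have bound: "\<bar>conv (J k) g x - g x\<bar> \<le> c" if c: "\<And>y. norm (x - y) < 1 / real (Suc k) \<Longrightarrow> \<bar>g y - g x\<bar> \<le> c" "c \<ge> 0" for x c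
    proof -
      have Ji: "integrable lebesgue (\<lambda>y. J k (x - y))"
        using test_functions_integrable[OF test_functions_affine[OF Jk(1), of "-1" x UNIV]] by simp
      have i: "integrable lebesgue (\<lambda>y. J k (x - y) * (g y - g x))"
        using integrable_conv[OF Jk(1) gi, of x] Ji by (simp add: right_diff_distrib)
      have "\<bar>conv (J k) g x - g x\<bar> \<le> (LINT y|lebesgue. \<bar>J k (x - y) * (g y - g x)\<bar>)"
        unfolding eq by (rule integral_abs_bound)
      also have "\<dots> \<le> (LINT y|lebesgue. J k (x - y) * c)"
      proof (rule integral_mono)
        show "\<bar>J k (x - y) * (g y - g x)\<bar> \<le> J k (x - y) * c" for y
          using c(1)[of y] Jk(2)[of "x - y"] Jk(4)[of "x - y"]
          by (cases "norm (x - y) < 1 / real (Suc k)") (auto simp: abs_mult mult_left_mono)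
      qed (use i Ji in auto)
      also have "\<dots> = c" using Jk(3) integral_shift_flip[OF Jk(1), of x] by simp
      finally show ?thesis .
    qed
    have k1: "1 / real (Suc k) \<le> 1" by simp
    have "Lnorm p UNIV (\<lambda>x. conv (J k) g x - g x) \<le> Lnorm p (cball (0::real^'n) (R + 1)) (\<lambda>x. e')"
    proof (rule Lnorm_subset_mono)
      show "conv (J k) g x - g x = 0" if x: "x \<notin> cball 0 (R + 1)" for x
      proof -
        have "\<bar>g y - g x\<bar> \<le> 0" if "norm (x - y) < 1 / real (Suc k)" for y
        proof -
          have "norm y > R" using norm_triangle_ineq2[of x y] less_le_trans[OF that k1] x by simp
          then show ?thesis using R x by simp
        qed
        from bound[OF this] show ?thesis by simp
      qed
      show "norm (conv (J k) g x - g x) \<le> norm e'" if x: "x \<in> cball 0 (R + 1)" for x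
      proof -
        have "\<bar>g y - g x\<bar> \<le> e'" if "norm (x - y) < 1 / real (Suc k)" for y
        proof -
          have "norm y \<le> R + 2" using norm_triangle_ineq2[of y x] less_le_trans[OF that k1] x by (simp add: norm_minus_commute)
          then show ?thesis using \<delta>(2)[of x y] that elim x by (simp add: dist_norm norm_minus_commute)
        qed
        from bound[OF this] show ?thesis using e' by simp
      qed
    qed (use p in auto)
    also have "\<dots> = ennreal (e' * V)" using p e' by (subst Lnorm_const) (auto simp: V_def)
    also have "\<dots> \<le> ennreal e" using e' by (intro ennreal_leI)
    finally show ?case .
  qed
qed

lemma Lnorm_tendsto_0_dominated:
  fixes f :: "nat \<Rightarrow> real^'n \<Rightarrow> real"
  assumes p: "0 < p" and [measurable]: "\<And>k. f k \<in> borel_measurable lebesgue" "w \<in> borel_measurable lebesgue"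
   and ae: "AE x in lebesgue. (\<lambda>k. f k x) \<longlonglongrightarrow> 0" and b: "\<And>k x. \<bar>f k x\<bar> \<le> w x" and w: "Lnorm p UNIV w < \<infinity>"
  shows "(\<lambda>k. Lnorm p UNIV (f k)) \<longlonglongrightarrow> 0"
  unfolding Lnorm_UNIV
proof (rule ennreal_root_tendsto_0[OF p])
  have "(\<integral>\<^sup>+x. ennreal (norm (w x) powr p) \<partial>lebesgue) < \<infinity>"
    using w unfolding Lnorm_UNIV by (cases "(\<integral>\<^sup>+x. ennreal (norm (w x) powr p) \<partial>lebesgue)") auto
  then have "(\<lambda>k. \<integral>\<^sup>+x. ennreal (norm (f k x) powr p) \<partial>lebesgue) \<longlonglongrightarrow> (\<integral>\<^sup>+x. ennreal 0 \<partial>(lebesgue::(real^'n) measure))"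
  proof (intro nn_integral_dominated_convergence[where w="\<lambda>x. ennreal (norm (w x) powr p)"])
    show "AE x in lebesgue. ennreal (norm (f k x) powr p) \<le> ennreal (norm (w x) powr p)" for k
      using b p by (intro AE_I2 ennreal_leI powr_mono2) (auto intro: order_trans[OF b abs_ge_self])
    show "AE x in lebesgue. (\<lambda>k. ennreal (norm (f k x) powr p)) \<longlonglongrightarrow> ennreal 0"
      using ae
    proof eventually_elim
      case (elim x)
      have "(\<lambda>k. norm (f k x) powr p) \<longlonglongrightarrow> norm (0::real) powr p"
        using p by (intro tendsto_powr' tendsto_norm elim tendsto_const) auto
      then show ?case by (intro tendsto_ennrealI) simp
    qed
  qed measurable
  then show "(\<lambda>k. \<integral>\<^sup>+x. ennreal (norm (f k x) powr p) \<partial>lebesgue) \<longlonglongrightarrow> 0" by simp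
qed

text \<open>The function is truncated in height and then approached almost everywhere by continuous
  functions. Clipping these at the same height and multiplying them by \<open>ct\<close> yields a
  bounded majorant of bounded support, so both errors tend to 0 by dominated convergence.\<close>

lemma continuous_dense_Lnorm:
  fixes v :: "real^'n \<Rightarrow> real"
  assumes p: "1 \<le> p" and v[measurable]: "v \<in> borel_measurable lebesgue" and R: "R \<ge> 0" "\<And>x. norm x > R \<Longrightarrow> v x = 0"
    and fin: "Lnorm p UNIV v < \<infinity>" and e: "e > 0"
  shows "\<exists>g. continuous_on UNIV g \<and> (\<forall>x. norm x > R + 1 \<longrightarrow> g x = 0) \<and> Lnorm p UNIV (\<lambda>x. v x - g x) \<le> ennreal e"
proof -
  define clip where "clip M t = max (- M) (min M t)" for M t :: real
  have clipb: "\<bar>clip M t\<bar> \<le> M" if "M \<ge> 0" for M t using that by (auto simp: clip_def)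
  have [measurable]: "clip M \<in> borel_measurable borel" for M unfolding clip_def by measurable
  have cont_clip: "continuous_on UNIV (clip M)" for M unfolding clip_def by (intro continuous_intros)
  have "(\<lambda>k. Lnorm p UNIV (\<lambda>x. v x - clip (real k) (v x))) \<longlonglongrightarrow> 0"
  proof (rule Lnorm_tendsto_0_dominated[where w="\<lambda>x. \<bar>v x\<bar>"])
    show "AE x in lebesgue. (\<lambda>k. v x - clip (real k) (v x)) \<longlonglongrightarrow> 0"
    proof (rule AE_I2)
      fix x
      have "\<forall>\<^sub>F k in sequentially. v x - clip (real k) (v x) = 0"
        using eventually_ge_at_top[of "nat \<lceil>\<bar>v x\<bar>\<rceil>"] by eventually_elim (auto simp: clip_def nat_le_iff ceiling_le_iff)
      then show "(\<lambda>k. v x - clip (real k) (v x)) \<longlonglongrightarrow> 0" by (rule tendsto_eventually)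
    qed
    show "\<bar>v x - clip (real k) (v x)\<bar> \<le> \<bar>v x\<bar>" for k x by (auto simp: clip_def)
    show "Lnorm p UNIV (\<lambda>x. \<bar>v x\<bar>) < \<infinity>" using fin by (simp add: Lnorm_UNIV)
  qed (use p in auto)
  from tendsto_ennreal_zeroD[OF this, of "e / 4"] e obtain k where k: "Lnorm p UNIV (\<lambda>x. v x - clip (real k) (v x)) \<le> ennreal (e / 4)"
    using eventually_happens[of _ sequentially] by force
  define M where "M = real k"
  have M: "M \<ge> 0" by (simp add: M_def)
  define w where "w x = clip M (v x)" for x
  have [measurable]: "w \<in> borel_measurable lebesgue" unfolding w_def by measurable
  \<comment> \<open>\<open>measurable_on\<close> provides continuous functions converging off a
    negligible set, but without any bound; \<open>h\<close> below repairs this.\<close>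
  have "w measurable_on UNIV" by (rule lebesgue_measurable_imp_measurable_on) auto
  then obtain N g where N: "negligible N" and g: "\<And>n. continuous_on UNIV (g n)" and lim: "\<And>x. x \<notin> N \<Longrightarrow> (\<lambda>n. g n x) \<longlonglongrightarrow> w x"
    unfolding measurable_on_def by auto
  define ct :: "real^'n \<Rightarrow> real" where "ct x = max 0 (min 1 (R + 1 - norm x))" for x
  have ct: "continuous_on UNIV ct" "\<And>x. 0 \<le> ct x" "\<And>x. ct x \<le> 1" "\<And>x. norm x > R + 1 \<Longrightarrow> ct x = 0" "\<And>x. norm x \<le> R \<Longrightarrow> ct x = 1"
    unfolding ct_def by (auto intro!: continuous_intros)
  have ctw: "ct x * w x = w x" for x using ct(5)[of x] R(2)[of x] M by (cases "norm x \<le> R") (auto simp: w_def clip_def)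
  define h where "h n x = ct x * clip M (g n x)" for n x
  have h: "continuous_on UNIV (h n)" for n
    unfolding h_def using continuous_on_compose2[OF cont_clip g] by (intro continuous_intros ct) auto
  then have [measurable]: "h n \<in> borel_measurable lebesgue" for n
    by (intro measurable_completion) (simp add: borel_measurable_continuous_onI)
  have iw: "(\<lambda>x::real^'n. 2 * M * indicator (cball 0 (R + 1)) x) \<in> borel_measurable lebesgue"
    by (intro borel_measurable_times borel_measurable_indicator) auto
  have "(\<lambda>n. Lnorm p UNIV (\<lambda>x. w x - h n x)) \<longlonglongrightarrow> 0"
  proof (rule Lnorm_tendsto_0_dominated[where w="\<lambda>x. (2 * M) * indicator (cball 0 (R + 1)) x"])
    have "AE x in lebesgue. x \<notin> N" using N by (simp add: negligible_iff_null_sets AE_not_in)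
    then show "AE x in lebesgue. (\<lambda>n. w x - h n x) \<longlonglongrightarrow> 0"
    proof eventually_elim
      case (elim x)
      have "clip M (w x) = w x" using M by (auto simp: w_def clip_def)
      moreover have "(\<lambda>n. clip M (g n x)) \<longlonglongrightarrow> clip M (w x)"
        using lim[OF elim] unfolding clip_def by (intro tendsto_intros)
      ultimately have "(\<lambda>n. w x - h n x) \<longlonglongrightarrow> w x - ct x * w x"
        unfolding h_def by (intro tendsto_intros) simp
      then show ?case by (simp add: ctw)
    qed
    show "\<bar>w x - h n x\<bar> \<le> 2 * M * indicator (cball 0 (R + 1)) x" for n x
    proof (cases "norm x \<le> R + 1")
      case True
      have "\<bar>w x\<bar> \<le> M" "\<bar>clip M (g n x)\<bar> \<le> M" using clipb[OF M] by (auto simp: w_def)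
      moreover have "\<bar>h n x\<bar> \<le> 1 * M" unfolding h_def abs_mult using ct(2,3)[of x] calculation by (intro mult_mono) auto
      ultimately show ?thesis using True by (auto simp: indicator_def)
    next
      case False
      then show ?thesis using ct(4)[of x] R by (simp add: h_def w_def clip_def M)
    qed
    have "Lnorm p UNIV (\<lambda>x::real^'n. 2 * M * indicator (cball 0 (R + 1)) x) \<le> Lnorm p (cball (0::real^'n) (R + 1)) (\<lambda>x. 2 * M)"
      using p by (intro Lnorm_subset_mono) auto
    also have "\<dots> < \<infinity>" using p by (subst Lnorm_const) auto
    finally show "Lnorm p UNIV (\<lambda>x::real^'n. 2 * M * indicator (cball 0 (R + 1)) x) < \<infinity>" .
  qed (use p iw in auto)
  from tendsto_ennreal_zeroD[OF this, of "e / 4"] e obtain n where n: "Lnorm p UNIV (\<lambda>x. w x - h n x) \<le> ennreal (e / 4)"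
    using eventually_happens[of _ sequentially] by force
  have "Lnorm p UNIV (\<lambda>x. (v x - w x) + (w x - h n x)) \<le> 2 * (Lnorm p UNIV (\<lambda>x. v x - w x) + Lnorm p UNIV (\<lambda>x. w x - h n x))"
    using p by (intro Lnorm_add_le) (auto simp: lebesgue_on_UNIV_eq)
  also have "\<dots> \<le> 2 * (ennreal (e / 4) + ennreal (e / 4))"
    using k n by (intro mult_left_mono add_mono) (auto simp: w_def M_def)
  also have "\<dots> = ennreal e" using e ennreal_mult[of 2 "e/2"] by (simp add: ennreal_plus[symmetric] del: ennreal_plus)
  finally have "Lnorm p UNIV (\<lambda>x. v x - h n x) \<le> ennreal e" by simp
  moreover have "\<forall>x. norm x > R + 1 \<longrightarrow> h n x = 0" using ct(4) by (simp add: h_def)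
  ultimately show ?thesis using h by blast
qed

text \<open>Mollification does not increase the L^p norm. So the error committed by passing from v
  to a continuous g is small both before and after mollifying, and g is covered by uniform
  continuity.\<close>

lemma conv_mollifier_tendsto:
  fixes v :: "real^'n \<Rightarrow> real"
  assumes m: "mollifier J" and p: "1 \<le> p" and vi: "integrable lebesgue v" and R: "R \<ge> 0" "\<And>x. norm x > R \<Longrightarrow> v x = 0"
    and fin: "Lnorm p UNIV v < \<infinity>"
  shows "(\<lambda>k. Lnorm p UNIV (\<lambda>x. conv (J k) v x - v x)) \<longlonglongrightarrow> 0"
proof (rule tendsto_ennreal_zeroI)
  fix e :: real assume e: "e > 0"
  have [measurable]: "v \<in> borel_measurable lebesgue" using vi by auto
  \<comment> \<open>Two uses of \<open>Lnorm_add_le\<close> weigh the three errors with 2, 4 and 4,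
    and 10/12 \<le> 1.\<close>
  obtain g where g: "continuous_on UNIV g" "\<And>x. norm x > R + 1 \<Longrightarrow> g x = 0" and gv: "Lnorm p UNIV (\<lambda>x. v x - g x) \<le> ennreal (e / 12)"
    using continuous_dense_Lnorm[OF p _ R fin, of "e / 12"] e by auto
  have [measurable]: "g \<in> borel_measurable lebesgue"
    using g(1) by (intro measurable_completion) (simp add: borel_measurable_continuous_onI)
  have gi: "integrable lebesgue g"
  proof -
    have cs: "compact (supp g)" by (rule compact_supp[of "cball 0 (R + 1)"]) (use g in auto)
    obtain C where "\<And>x. \<bar>g x\<bar> \<le> C" using continuous_compact_bounded[OF g(1) cs] by blast
    then show ?thesis
      using g by (intro integrable_bounded_supp[of g C "cball 0 (R + 1)"]) auto
  qed
  have lim: "(\<lambda>k. Lnorm p UNIV (\<lambda>x. conv (J k) g x - g x)) \<longlonglongrightarrow> 0"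
    using R g by (intro conv_mollifier_continuous[OF m g(1), of "R + 1"] p) auto
  have ev: "\<forall>\<^sub>F k in sequentially. Lnorm p UNIV (\<lambda>x. conv (J k) g x - g x) \<le> ennreal (e / 12)"
    using tendsto_ennreal_zeroD[OF lim] e by simp
  then show "\<forall>\<^sub>F k in sequentially. Lnorm p UNIV (\<lambda>x. conv (J k) v x - v x) \<le> ennreal e"
  proof eventually_elim
    case (elim k)
    note Jk = mollifierD[OF m, of k]
    have ms: "conv (J k) f \<in> borel_measurable lebesgue" if "integrable lebesgue f" for f
      using smooth_measurable_lebesgue[OF smooth_conv[OF Jk(1) that]] .
    note [measurable] = ms[OF vi] ms[OF gi]
    have A: "Lnorm p UNIV (\<lambda>x. conv (J k) v x - conv (J k) g x) \<le> ennreal (e / 12)"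
    proof -
      have "Lnorm p UNIV (conv (J k) (\<lambda>x. v x - g x)) \<le> Lnorm p UNIV (\<lambda>x. v x - g x)"
        by (rule Lnorm_conv_le[OF p Jk(1-3)]) auto
      moreover have "conv (J k) (\<lambda>x. v x - g x) = (\<lambda>x. conv (J k) v x - conv (J k) g x)"
        using conv_diff[OF Jk(1) vi gi] by blast
      ultimately show ?thesis using gv by simp
    qed
    have "Lnorm p UNIV (\<lambda>x. (conv (J k) v x - conv (J k) g x) + ((conv (J k) g x - g x) + (g x - v x)))
      \<le> 2 * (Lnorm p UNIV (\<lambda>x. conv (J k) v x - conv (J k) g x) + Lnorm p UNIV (\<lambda>x. (conv (J k) g x - g x) + (g x - v x)))"
      using p by (intro Lnorm_add_le) (auto simp: lebesgue_on_UNIV_eq)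
    also have "\<dots> \<le> 2 * (Lnorm p UNIV (\<lambda>x. conv (J k) v x - conv (J k) g x) + 2 * (Lnorm p UNIV (\<lambda>x. conv (J k) g x - g x) + Lnorm p UNIV (\<lambda>x. g x - v x)))"
      using p by (intro mult_left_mono add_mono Lnorm_add_le order_refl) (auto simp: lebesgue_on_UNIV_eq)
    also have "\<dots> \<le> 2 * (ennreal (e / 12) + 2 * (ennreal (e / 12) + ennreal (e / 12)))"
      using A elim gv by (intro mult_left_mono add_mono) (auto simp: Lnorm_UNIV abs_minus_commute)
    also have "\<dots> \<le> ennreal e"
      using e by (simp only: ennreal_numeral[symmetric] ennreal_mult[symmetric] ennreal_plus[symmetric] divide_nonneg_pos
        less_imp_le mult_nonneg_nonneg add_nonneg_nonneg zero_le_numeral zero_less_numeral) (simp add: ennreal_leI)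
    finally show ?case by simp
  qed
qed

subsection \<open>Weak derivatives\<close>

lemma locally_integrableD:
  "locally_integrable S f \<Longrightarrow> compact K \<Longrightarrow> K \<subseteq> S \<Longrightarrow> integrable lebesgue (\<lambda>x. indicator K x * f x)"
  by (simp add: locally_integrable_def set_integrable_def)

lemma locally_integrableI:
  "(\<And>K. compact K \<Longrightarrow> K \<subseteq> S \<Longrightarrow> integrable lebesgue (\<lambda>x. indicator K x * f x)) \<Longrightarrow> locally_integrable S f"
  by (simp add: locally_integrable_def set_integrable_def)

lemma locally_integrable_subset: "locally_integrable S f \<Longrightarrow> T \<subseteq> S \<Longrightarrow> locally_integrable T f"
  unfolding locally_integrable_def by blast

lemma locally_integrable_add:
  "locally_integrable S f \<Longrightarrow> locally_integrable S g \<Longrightarrow> locally_integrable S (\<lambda>x. f x + g x)"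
  by (rule locally_integrableI) (simp add: distrib_left locally_integrableD)

lemma locally_integrable_mult_smooth:
  fixes f :: "real^'n \<Rightarrow> real"
  assumes "smooth a" "locally_integrable S f"
  shows "locally_integrable S (\<lambda>x. a x * f x)"
proof (rule locally_integrableI)
  fix K assume K: "compact K" "K \<subseteq> S"
  have i: "integrable lebesgue (\<lambda>x. indicator K x * f x)" using locally_integrableD[OF assms(2) K] .
  have "bounded (a ` K)"
    using K smooth_continuous[OF assms(1)] by (intro compact_imp_bounded compact_continuous_image) auto
  then obtain C where C: "\<And>x. x \<in> K \<Longrightarrow> \<bar>a x\<bar> \<le> C" by (auto simp: bounded_iff)
  have [measurable]: "a \<in> borel_measurable lebesgue" using smooth_measurable_lebesgue[OF assms(1)] .
  have [measurable]: "(\<lambda>x. indicator K x * f x) \<in> borel_measurable lebesgue" using i by auto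
  have "(\<lambda>x. a x * (indicator K x * f x)) \<in> borel_measurable lebesgue" by measurable
  then have m: "(\<lambda>x. indicator K x * (a x * f x)) \<in> borel_measurable lebesgue" by (simp add: mult.left_commute)
  show "integrable lebesgue (\<lambda>x. indicator K x * (a x * f x))"
  proof (rule Bochner_Integration.integrable_bound[of _ "\<lambda>x. C * (indicator K x * f x)"])
    show "AE x in lebesgue. norm (indicator K x * (a x * f x)) \<le> norm (C * (indicator K x * f x))"
    proof (rule AE_I2)
      fix x show "norm (indicator K x * (a x * f x)) \<le> norm (C * (indicator K x * f x))"
        using order_trans[OF C[of x] abs_ge_self] by (auto simp: indicator_def abs_mult intro!: mult_right_mono)
    qed
  qed (use i m in auto)
qed

text \<open>A pairing sees only the support of \<psi>. The function h stands for \<psi> itself or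
  for one of its derivatives.\<close>

lemma set_integral_test_function:
  fixes u h \<psi> :: "real^'n \<Rightarrow> real"
  assumes "\<psi> \<in> test_functions S" "supp \<psi> \<subseteq> T" "T \<subseteq> S'" "\<And>x. x \<notin> supp \<psi> \<Longrightarrow> h x = 0"
  shows "(LINT x:S'|lebesgue. u x * h x) = (LINT x|lebesgue. (indicator T x * u x) * h x)"
  unfolding set_lebesgue_integral_def
proof (rule Bochner_Integration.integral_cong[OF refl])
  fix x show "indicator S' x *\<^sub>R (u x * h x) = (indicator T x * u x) * h x"
    using assms(2,3) assms(4)[of x] by (cases "x \<in> supp \<psi>") (auto simp: indicator_def)
qed

lemma integrable_weak_pairing:
  fixes \<psi> :: "real^'n \<Rightarrow> real"
  assumes "\<psi> \<in> test_functions S" "locally_integrable S u" "smooth h" "\<And>x. x \<notin> supp \<psi> \<Longrightarrow> h x = 0"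
  shows "integrable lebesgue (\<lambda>x. indicator S x *\<^sub>R (u x * h x))"
proof -
  have "integrable lebesgue (\<lambda>x. indicator (supp \<psi>) x * (h x * u x))"
    by (rule locally_integrableD[OF locally_integrable_mult_smooth[OF assms(3,2)]])
       (use assms(1) in \<open>auto simp: test_functions_iff\<close>)
  moreover have "(\<lambda>x. indicator (supp \<psi>) x * (h x * u x)) = (\<lambda>x. indicator S x *\<^sub>R (u x * h x))"
    using assms(1,4) by (auto simp: fun_eq_iff indicator_def test_functions_iff)
  ultimately show ?thesis by simp
qed

text \<open>As a function of y, J (x - y) is an admissible test function once ball x e lies in S. So
  mollification commutes with weak differentiation away from the boundary; cutting off with the
  compact T makes the functions integrable and is invisible at such x.\<close>

lemma pderiv_conv_weak:
  fixes J u g :: "real^'n \<Rightarrow> real"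
  assumes w: "is_weak_deriv S i u g" and T: "compact T" "T \<subseteq> S" and J: "J \<in> test_functions (ball 0 e)" and x: "ball x e \<subseteq> T"
  shows "pderiv_at i (conv J (\<lambda>y. indicator T y * u y)) x = conv J (\<lambda>y. indicator T y * g y) x"
proof -
  have sm: "smooth J" using J test_functions_smooth by blast
  define \<psi> where "\<psi> = (\<lambda>y. J (x + (-1) *\<^sub>R y))"
  have \<psi>T: "\<psi> \<in> test_functions (ball x e)" unfolding \<psi>_def
    by (rule test_functions_affine[OF J]) (auto simp: dist_norm norm_minus_commute)
  then have \<psi>: "\<psi> \<in> test_functions S" using x T by (auto intro: test_functions_mono)
  have sT: "supp \<psi> \<subseteq> T" using \<psi>T x by (auto simp: test_functions_iff)
  have pd: "pderiv_at i \<psi> y = - pderiv_at i J (x - y)" for y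
    unfolding \<psi>_def using fun_cong[OF pderiv_affine[OF sm, of i x "-1"], of y] by simp
  have "(LINT y:S|lebesgue. u y * pderiv_at i \<psi> y) = - (LINT y:S|lebesgue. g y * \<psi> y)"
    using w \<psi> by (simp add: is_weak_deriv_def)
  also have "(LINT y:S|lebesgue. u y * pderiv_at i \<psi> y) = (LINT y|lebesgue. (indicator T y * u y) * pderiv_at i \<psi> y)"
    by (rule set_integral_test_function[OF \<psi> sT T(2) pderiv_eq_0])
  also have "(LINT y:S|lebesgue. g y * \<psi> y) = (LINT y|lebesgue. (indicator T y * g y) * \<psi> y)"
    by (rule set_integral_test_function[OF \<psi> sT T(2) not_in_supp])
  finally have "(LINT y|lebesgue. pderiv_at i J (x - y) * (indicator T y * u y)) = (LINT y|lebesgue. J (x - y) * (indicator T y * g y))"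
    unfolding pd by (simp add: \<psi>_def mult.commute mult.left_commute)
  then show ?thesis
    using w T by (subst pderiv_conv[OF J]) (auto simp: conv_def is_weak_deriv_def intro: locally_integrableD)
qed

lemma Lnorm_eq_0_imp:
  fixes f :: "real^'n \<Rightarrow> real"
  assumes "0 < p" "Lnorm p S f = 0" "S \<in> sets lebesgue" "f \<in> borel_measurable (lebesgue_on S)"
  shows "AE x in lebesgue. x \<in> S \<longrightarrow> f x = 0"
proof -
  have [measurable]: "f \<in> borel_measurable (lebesgue_on S)" by fact
  have "(\<integral>\<^sup>+x. ennreal (norm (f x) powr p) \<partial>lebesgue_on S) = 0"
    using assms(1,2) ennreal_root_le_iff[of p 0] by (simp add: Lnorm_def)
  then have "AE x in lebesgue_on S. ennreal (norm (f x) powr p) = 0" by (subst (asm) nn_integral_0_iff_AE) auto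
  then show ?thesis using assms(1,3) by (simp add: AE_restrict_space_iff)
qed

lemma Lnorm_1_integrable:
  fixes f :: "real^'n \<Rightarrow> real"
  assumes "integrable lebesgue f"
  shows "Lnorm 1 UNIV f = ennreal (LINT x|lebesgue. \<bar>f x\<bar>)"
proof -
  show ?thesis unfolding Lnorm_UNIV ennreal_root_1 using nn_integral_eq_integral[of lebesgue "\<lambda>x. \<bar>f x\<bar>"] assms by simp
qed

text \<open>Cutting off with T produces a global integrable function without changing v on S, so the
  global statement for mollifiers applies.\<close>

lemma conv_local_tendsto:
  fixes v :: "real^'n \<Rightarrow> real"
  assumes m: "mollifier J" and p: "1 \<le> p" and T: "compact T" "S \<in> sets lebesgue" "S \<subseteq> T"
    and vi: "integrable lebesgue (\<lambda>x. indicator T x * v x)" and fin: "Lnorm p T v < \<infinity>"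
  shows "(\<lambda>k. Lnorm p S (\<lambda>x. conv (J k) (\<lambda>x. indicator T x * v x) x - v x)) \<longlonglongrightarrow> 0"
proof -
  have "bounded T" using T compact_imp_bounded by blast
  then obtain R where R: "R > 0" "\<And>x. x \<in> T \<Longrightarrow> norm x \<le> R" by (auto simp: bounded_pos)
  have Ts: "T \<in> sets lebesgue" using T(1) by (simp add: compact_imp_closed)
  have "Lnorm p UNIV (\<lambda>x. indicator T x * v x) \<le> Lnorm p T v"
    using p Ts by (intro Lnorm_subset_mono) auto
  then have f: "Lnorm p UNIV (\<lambda>x. indicator T x * v x) < \<infinity>" using fin by simp
  have lim: "(\<lambda>k. Lnorm p UNIV (\<lambda>x. conv (J k) (\<lambda>x. indicator T x * v x) x - indicator T x * v x)) \<longlonglongrightarrow> 0"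
    by (rule conv_mollifier_tendsto[OF m p vi _ _ f, of R]) (use R in \<open>auto simp: indicator_def dest: leD\<close>)
  show ?thesis
  proof (rule tendsto_sandwich[OF _ _ tendsto_const lim])
    show "\<forall>\<^sub>F k in sequentially. Lnorm p S (\<lambda>x. conv (J k) (\<lambda>x. indicator T x * v x) x - v x)
       \<le> Lnorm p UNIV (\<lambda>x. conv (J k) (\<lambda>x. indicator T x * v x) x - indicator T x * v x)"
      using p T by (intro always_eventually allI Lnorm_subset_mono) auto
  qed simp
qed

text \<open>Near each point of S the mollifications of g and h coincide, both being a derivative of
  the mollified u, so their L^1 limits agree on a small ball. This makes the choice in
  \<open>weak_deriv\<close> harmless.\<close>

lemma weak_deriv_unique:
  fixes u :: "real^'n \<Rightarrow> real"
  assumes m: "mollifier (J :: nat \<Rightarrow> real^'n \<Rightarrow> real)" and S: "open S"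
    and g: "is_weak_deriv S i u g" and h: "is_weak_deriv S i u h"
  shows "AE x in lebesgue. x \<in> S \<longrightarrow> g x = h x"
proof -
  have loc: "\<exists>r>0. ball x r \<subseteq> S \<and> (AE y in lebesgue. y \<in> ball x r \<longrightarrow> g y = h y)" if x: "x \<in> S" for x
  proof -
    obtain r where r: "r > 0" "cball x (2 * r) \<subseteq> S"
      using S x open_contains_cball[of S] by (metis field_sum_of_halves half_gt_zero mult_2)
    let ?T = "cball x (2 * r)" and ?B = "ball x r"
    have T: "compact ?T" "?B \<in> sets lebesgue" "?B \<subseteq> ?T" using r(1) by auto
    have gi: "integrable lebesgue (\<lambda>y. indicator ?T y * g y)" and hi: "integrable lebesgue (\<lambda>y. indicator ?T y * h y)"
      using g h r T by (auto simp: is_weak_deriv_def intro!: locally_integrableD)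
    have fin: "Lnorm 1 ?T f < \<infinity>" if "integrable lebesgue (\<lambda>y. indicator ?T y * f y)" for f :: "real^'n \<Rightarrow> real"
    proof -
      have "Lnorm 1 ?T f \<le> Lnorm 1 UNIV (\<lambda>y. indicator ?T y * f y)" by (intro Lnorm_subset_mono) auto
      also have "\<dots> < \<infinity>" by (simp add: Lnorm_1_integrable[OF that])
      finally show ?thesis .
    qed
    have ms: "f \<in> borel_measurable (lebesgue_on ?B)" if "integrable lebesgue (\<lambda>y. indicator ?T y * f y)" for f :: "real^'n \<Rightarrow> real"
    proof -
      have "f \<in> borel_measurable (lebesgue_on ?T)"
        using that by (subst borel_measurable_lebesgue_on_iff) auto
      then show ?thesis using T(3) by (rule measurable_restrict_mono)
    qed
    note mgh = ms[OF gi] ms[OF hi]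
    have limg: "(\<lambda>k. Lnorm 1 ?B (\<lambda>y. conv (J k) (\<lambda>y. indicator ?T y * g y) y - g y)) \<longlonglongrightarrow> 0"
      by (rule conv_local_tendsto[OF m _ T gi fin[OF gi]]) simp
    have limh: "(\<lambda>k. Lnorm 1 ?B (\<lambda>y. conv (J k) (\<lambda>y. indicator ?T y * h y) y - h y)) \<longlonglongrightarrow> 0"
      by (rule conv_local_tendsto[OF m _ T hi fin[OF hi]]) simp
    have "(\<lambda>k. 2 * (Lnorm 1 ?B (\<lambda>y. conv (J k) (\<lambda>y. indicator ?T y * g y) y - g y) + Lnorm 1 ?B (\<lambda>y. conv (J k) (\<lambda>y. indicator ?T y * h y) y - h y))) \<longlonglongrightarrow> 2 * (0 + 0)"
      by (intro tendsto_add ennreal_tendsto_cmult limg limh) auto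
    then have lim: "(\<lambda>k. 2 * (Lnorm 1 ?B (\<lambda>y. conv (J k) (\<lambda>y. indicator ?T y * g y) y - g y) + Lnorm 1 ?B (\<lambda>y. conv (J k) (\<lambda>y. indicator ?T y * h y) y - h y))) \<longlonglongrightarrow> 0" by simp
    have ev: "\<forall>\<^sub>F k in sequentially. 1 / real (Suc k) < r"
      using order_tendstoD(2)[OF LIMSEQ_Suc[OF lim_1_over_n] r(1)] by simp
    have "Lnorm 1 ?B (\<lambda>y. g y - h y) \<le> 0"
    proof (rule tendsto_lowerbound[OF lim])
      show "\<forall>\<^sub>F k in sequentially. Lnorm 1 ?B (\<lambda>y. g y - h y) \<le>
         2 * (Lnorm 1 ?B (\<lambda>y. conv (J k) (\<lambda>y. indicator ?T y * g y) y - g y) + Lnorm 1 ?B (\<lambda>y. conv (J k) (\<lambda>y. indicator ?T y * h y) y - h y))"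
        using ev
      proof eventually_elim
        case (elim k)
        let ?cg = "conv (J k) (\<lambda>y. indicator ?T y * g y)" and ?ch = "conv (J k) (\<lambda>y. indicator ?T y * h y)"
        have JB: "J k \<in> test_functions (ball 0 (1 / real (Suc k)))" using m by (simp add: mollifier_def)
        have eq: "?cg y = ?ch y" if y: "y \<in> ?B" for y
        proof -
          have "ball y (1 / real (Suc k)) \<subseteq> ?T"
          proof
            fix z assume "z \<in> ball y (1 / real (Suc k))"
            then have "dist y z < r" using elim by simp
            then show "z \<in> ?T" using y dist_triangle[of x z y] by simp
          qed
          from pderiv_conv_weak[OF g T(1) r(2) JB this] pderiv_conv_weak[OF h T(1) r(2) JB this]
          show ?thesis by simp
        qed
        have sm: "?cg \<in> borel_measurable (lebesgue_on ?B)" "?ch \<in> borel_measurable (lebesgue_on ?B)"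
          by (intro smooth_measurable smooth_conv[OF JB gi] smooth_conv[OF JB hi] T(2))+
        have "Lnorm 1 ?B (\<lambda>y. g y - h y) = Lnorm 1 ?B (\<lambda>y. (-1) * (?cg y - g y) + (?ch y - h y))"
          using T(2) eq by (intro Lnorm_cong) auto
        also have "\<dots> \<le> 2 * (Lnorm 1 ?B (\<lambda>y. (-1) * (?cg y - g y)) + Lnorm 1 ?B (\<lambda>y. ?ch y - h y))"
          using T(2) sm mgh by (intro Lnorm_add_le) auto
        also have "Lnorm 1 ?B (\<lambda>y. (-1) * (?cg y - g y)) = Lnorm 1 ?B (\<lambda>y. ?cg y - g y)"
          using T(2) by (intro Lnorm_cong) auto
        finally show ?case .
      qed
    qed simp
    then have "AE y in lebesgue. y \<in> ?B \<longrightarrow> g y - h y = 0"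
      using T(2) mgh by (intro Lnorm_eq_0_imp[of 1]) auto
    then show ?thesis using r by (intro exI[of _ r]) (auto intro: order_trans[OF T(3)])
  qed
  \<comment> \<open>Each ball has its own exceptional null set, and there may be uncountably many
    balls; Lindelof's theorem leaves countably many.\<close>
  define \<B> where "\<B> = {B. open B \<and> (AE y in lebesgue. y \<in> B \<longrightarrow> g y = h y)}"
  obtain F where F: "F \<subseteq> \<B>" "countable F" "\<Union> F = \<Union> \<B>"
    using Lindelof[of \<B>] by (auto simp: \<B>_def)
  have "S \<subseteq> \<Union> \<B>"
  proof
    fix x assume "x \<in> S"
    from loc[OF this] obtain r where "r > 0" "AE y in lebesgue. y \<in> ball x r \<longrightarrow> g y = h y" by blast
    then have "ball x r \<in> \<B>" "x \<in> ball x r" unfolding \<B>_def by simp_all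
    then show "x \<in> \<Union> \<B>" by blast
  qed
  moreover have "AE y in lebesgue. \<forall>B\<in>F. y \<in> B \<longrightarrow> g y = h y"
    using F(1) by (subst AE_ball_countable[OF F(2)]) (auto simp: \<B>_def)
  ultimately show ?thesis
    using F(3) by (auto elim!: eventually_mono)
qed

lemma weak_deriv_AE_eq:
  fixes u :: "real^'n \<Rightarrow> real"
  assumes m: "mollifier (J :: nat \<Rightarrow> real^'n \<Rightarrow> real)" and S: "open S" and g: "is_weak_deriv S i u g"
  shows "is_weak_deriv S i u (weak_deriv S i u)" "AE x in lebesgue. x \<in> S \<longrightarrow> weak_deriv S i u x = g x"
proof -
  show *: "is_weak_deriv S i u (weak_deriv S i u)" unfolding weak_deriv_def by (rule someI[of "is_weak_deriv S i u", OF g])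
  show "AE x in lebesgue. x \<in> S \<longrightarrow> weak_deriv S i u x = g x" by (rule weak_deriv_unique[OF m S * g])
qed

text \<open>Serves \<open>weak_lap\<close>, whose outer derivative acts on a chosen representative
  of the inner one.\<close>

lemma is_weak_deriv_cong_AE:
  fixes u :: "real^'n \<Rightarrow> real"
  assumes g: "is_weak_deriv S i u g" and u': "locally_integrable S u'" and ae: "AE x in lebesgue. x \<in> S \<longrightarrow> u' x = u x"
  shows "is_weak_deriv S i u' g"
  unfolding is_weak_deriv_def
proof (intro conjI ballI)
  show "locally_integrable S g" using g by (simp add: is_weak_deriv_def)
  have u: "locally_integrable S u" using g by (simp add: is_weak_deriv_def)
  fix \<psi> assume \<psi>: "\<psi> \<in> test_functions S"
  have "(LINT x:S|lebesgue. u' x * pderiv_at i \<psi> x) = (LINT x:S|lebesgue. u x * pderiv_at i \<psi> x)"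
    unfolding set_lebesgue_integral_def
  proof (rule integral_cong_AE)
    show "AE x in lebesgue. indicat_real S x *\<^sub>R (u' x * pderiv_at i \<psi> x) = indicat_real S x *\<^sub>R (u x * pderiv_at i \<psi> x)"
      using ae by eventually_elim (auto simp: indicator_def)
    show "(\<lambda>x. indicat_real S x *\<^sub>R (u' x * pderiv_at i \<psi> x)) \<in> borel_measurable lebesgue"
      "(\<lambda>x. indicat_real S x *\<^sub>R (u x * pderiv_at i \<psi> x)) \<in> borel_measurable lebesgue"
      by (intro borel_measurable_integrable integrable_weak_pairing[OF \<psi>] u u' smooth_pderiv test_functions_smooth[OF \<psi>] pderiv_eq_0; assumption)+
  qed
  then show "(LINT x:S|lebesgue. u' x * pderiv_at i \<psi> x) = - (LINT x:S|lebesgue. g x * \<psi> x)"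
    using g \<psi> by (simp add: is_weak_deriv_def)
qed (rule u')

text \<open>Both derivatives in \<open>weak_lap\<close> are choices; uniqueness replaces them by
  given ones almost everywhere, in each of the finitely many directions.\<close>

lemma weak_lap_AE_eq:
  fixes u :: "real^'n \<Rightarrow> real"
  assumes m: "mollifier (J :: nat \<Rightarrow> real^'n \<Rightarrow> real)" and S: "open S"
    and v: "\<And>i. is_weak_deriv S i u (v i)" and w: "\<And>i. is_weak_deriv S i (v i) (w i)"
  shows "AE x in lebesgue. x \<in> S \<longrightarrow> weak_lap S u x = (\<Sum>i\<in>UNIV. w i x)"
proof -
  have 1: "AE x in lebesgue. x \<in> S \<longrightarrow> weak_deriv S i (weak_deriv S i u) x = w i x" for i
  proof (rule weak_deriv_AE_eq(2)[OF m S])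
    show "is_weak_deriv S i (weak_deriv S i u) (w i)"
      using weak_deriv_AE_eq[OF m S v[of i]] by (intro is_weak_deriv_cong_AE[OF w]) (auto simp: is_weak_deriv_def)
  qed
  have "AE x in lebesgue. \<forall>i\<in>UNIV. x \<in> S \<longrightarrow> weak_deriv S i (weak_deriv S i u) x = w i x"
    using 1 by (intro AE_finite_allI) auto
  then show ?thesis by eventually_elim (auto simp: weak_lap_def)
qed

lemma is_weak_deriv_subset:
  assumes "is_weak_deriv S i u g" "T \<subseteq> S" shows "is_weak_deriv T i u g"
  unfolding is_weak_deriv_def
proof (intro conjI ballI)
  show "locally_integrable T u" "locally_integrable T g"
    using assms locally_integrable_subset by (auto simp: is_weak_deriv_def)
  fix \<psi> assume \<psi>: "\<psi> \<in> test_functions T"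
  then have \<psi>': "\<psi> \<in> test_functions S" using assms(2) test_functions_mono by blast
  have s: "supp \<psi> \<subseteq> T" using \<psi> by (simp add: test_functions_iff)
  have "(LINT x:S|lebesgue. u x * pderiv_at i \<psi> x) = - (LINT x:S|lebesgue. g x * \<psi> x)"
    using assms(1) \<psi>' by (simp add: is_weak_deriv_def)
  then show "(LINT x:T|lebesgue. u x * pderiv_at i \<psi> x) = - (LINT x:T|lebesgue. g x * \<psi> x)"
    using set_integral_test_function[OF \<psi>' s assms(2), of "pderiv_at i \<psi>" u] set_integral_test_function[OF \<psi> s order_refl, of "pderiv_at i \<psi>" u]
      set_integral_test_function[OF \<psi>' s assms(2), of \<psi> g] set_integral_test_function[OF \<psi> s order_refl, of \<psi> g]
    by (simp add: pderiv_eq_0 not_in_supp)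
qed

lemma is_weak_deriv_add:
  assumes "is_weak_deriv S i u g" "is_weak_deriv S i u' g'"
  shows "is_weak_deriv S i (\<lambda>x. u x + u' x) (\<lambda>x. g x + g' x)"
  unfolding is_weak_deriv_def
proof (intro conjI ballI)
  have l: "locally_integrable S u" "locally_integrable S u'" "locally_integrable S g" "locally_integrable S g'"
    using assms by (auto simp: is_weak_deriv_def)
  show "locally_integrable S (\<lambda>x. u x + u' x)" "locally_integrable S (\<lambda>x. g x + g' x)"
    by (rule locally_integrable_add[OF l(1,2)], rule locally_integrable_add[OF l(3,4)])
  fix \<psi> assume \<psi>: "\<psi> \<in> test_functions S"
  have i: "integrable lebesgue (\<lambda>x. indicator S x *\<^sub>R (u x * pderiv_at i \<psi> x))" if "locally_integrable S u" for u
    using integrable_weak_pairing[OF \<psi> that smooth_pderiv[OF test_functions_smooth[OF \<psi>]]] pderiv_eq_0 by blast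
  have j: "integrable lebesgue (\<lambda>x. indicator S x *\<^sub>R (u x * \<psi> x))" if "locally_integrable S u" for u
    using integrable_weak_pairing[OF \<psi> that test_functions_smooth[OF \<psi>]] not_in_supp by blast
  show "(LINT x:S|lebesgue. (u x + u' x) * pderiv_at i \<psi> x) = - (LINT x:S|lebesgue. (g x + g' x) * \<psi> x)"
    using assms \<psi> i[OF l(1)] i[OF l(2)] j[OF l(3)] j[OF l(4)]
    by (simp add: is_weak_deriv_def set_lebesgue_integral_def distrib_right distrib_left)
qed

text \<open>The weak derivative of u is tested against the product of \<psi> and a, again a test
  function; the product rule is then solved for the term with the derivative of \<psi>.\<close>

lemma is_weak_deriv_mult_smooth:
  fixes a :: "real^'n \<Rightarrow> real"
  assumes "smooth a" "is_weak_deriv S i u g"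
  shows "is_weak_deriv S i (\<lambda>x. a x * u x) (\<lambda>x. a x * g x + pderiv_at i a x * u x)"
  unfolding is_weak_deriv_def
proof (intro conjI ballI)
  have l: "locally_integrable S u" "locally_integrable S g" using assms by (auto simp: is_weak_deriv_def)
  have sa: "smooth (pderiv_at i a)" by (rule smooth_pderiv[OF assms(1)])
  show "locally_integrable S (\<lambda>x. a x * u x)" "locally_integrable S (\<lambda>x. a x * g x + pderiv_at i a x * u x)"
    by (intro locally_integrable_add locally_integrable_mult_smooth assms(1) sa l)+
  fix \<psi> assume \<psi>: "\<psi> \<in> test_functions S"
  have s\<psi>: "smooth \<psi>" using \<psi> test_functions_smooth by blast
  have "(\<lambda>x. \<psi> x * a x) \<in> test_functions S" by (rule test_functions_mult[OF \<psi> assms(1)])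
  then have "(LINT x:S|lebesgue. u x * pderiv_at i (\<lambda>x. \<psi> x * a x) x) = - (LINT x:S|lebesgue. g x * (\<psi> x * a x))"
    using assms(2) by (simp add: is_weak_deriv_def)
  moreover have "(LINT x:S|lebesgue. u x * pderiv_at i (\<lambda>x. \<psi> x * a x) x)
     = (LINT x:S|lebesgue. u x * (a x * pderiv_at i \<psi> x)) + (LINT x:S|lebesgue. u x * (pderiv_at i a x * \<psi> x))"
  proof -
    have 1: "integrable lebesgue (\<lambda>x. indicator S x *\<^sub>R (u x * (a x * pderiv_at i \<psi> x)))"
      by (rule integrable_weak_pairing[OF \<psi> l(1)]) (auto intro!: smooth_mult assms smooth_pderiv s\<psi> pderiv_eq_0)
    have 2: "integrable lebesgue (\<lambda>x. indicator S x *\<^sub>R (u x * (pderiv_at i a x * \<psi> x)))"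
      by (rule integrable_weak_pairing[OF \<psi> l(1)]) (auto intro!: smooth_mult assms smooth_pderiv s\<psi> not_in_supp)
    show ?thesis unfolding set_lebesgue_integral_def
      using 1 2 by (subst Bochner_Integration.integral_add[symmetric])
       (auto simp: pderiv_mult[OF s\<psi> assms(1)] algebra_simps)
  qed
  moreover have "(LINT x:S|lebesgue. (a x * g x + pderiv_at i a x * u x) * \<psi> x)
     = (LINT x:S|lebesgue. g x * (\<psi> x * a x)) + (LINT x:S|lebesgue. u x * (pderiv_at i a x * \<psi> x))"
  proof -
    have 1: "integrable lebesgue (\<lambda>x. indicator S x *\<^sub>R (g x * (\<psi> x * a x)))"
      by (rule integrable_weak_pairing[OF \<psi> l(2)]) (auto intro!: smooth_mult assms smooth_pderiv s\<psi> not_in_supp)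
    have 2: "integrable lebesgue (\<lambda>x. indicator S x *\<^sub>R (u x * (pderiv_at i a x * \<psi> x)))"
      by (rule integrable_weak_pairing[OF \<psi> l(1)]) (auto intro!: smooth_mult assms smooth_pderiv s\<psi> not_in_supp)
    show ?thesis unfolding set_lebesgue_integral_def
      using 1 2 by (subst Bochner_Integration.integral_add[symmetric]) (auto simp: algebra_simps)
  qed
  moreover have "(\<lambda>x. u x * (a x * pderiv_at i \<psi> x)) = (\<lambda>x. a x * u x * pderiv_at i \<psi> x)" by (simp add: mult_ac)
  ultimately show "(LINT x:S|lebesgue. a x * u x * pderiv_at i \<psi> x) = - (LINT x:S|lebesgue. (a x * g x + pderiv_at i a x * u x) * \<psi> x)"
    by simp
qed

text \<open>Identifies the weak Laplacian of \<phi> u in the theorem with the limit of classical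
  Laplacians that \<open>lap_mult_tendsto\<close> yields.\<close>

lemma weak_lap_mult_smooth:
  fixes u a :: "real^'n \<Rightarrow> real"
  assumes m: "mollifier (J :: nat \<Rightarrow> real^'n \<Rightarrow> real)" and S: "open S" and a: "smooth a"
    and v: "\<And>i. is_weak_deriv S i u (v i)" and w: "\<And>i. is_weak_deriv S i (v i) (w i)"
  shows "AE x in lebesgue. x \<in> S \<longrightarrow> weak_lap S (\<lambda>x. a x * u x) x
     = a x * (\<Sum>i\<in>UNIV. w i x) + 2 * (\<Sum>i\<in>UNIV. pderiv_at i a x * v i x) + lap a x * u x"
proof -
  have 1: "is_weak_deriv S i (\<lambda>x. a x * u x) (\<lambda>x. a x * v i x + pderiv_at i a x * u x)" for i
    by (rule is_weak_deriv_mult_smooth[OF a v])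
  have 2: "is_weak_deriv S i (\<lambda>x. a x * v i x + pderiv_at i a x * u x)
     (\<lambda>x. (a x * w i x + pderiv_at i a x * v i x) + (pderiv_at i a x * v i x + pderiv_at i (pderiv_at i a) x * u x))" for i
    by (intro is_weak_deriv_add is_weak_deriv_mult_smooth a smooth_pderiv v w)
  from weak_lap_AE_eq[OF m S 1 2] show ?thesis
    by eventually_elim (auto simp: lap_def sum.distrib sum_distrib_left sum_distrib_right algebra_simps)
qed

lemma locally_integrable_smooth:
  fixes f :: "real^'n \<Rightarrow> real"
  assumes "smooth f" shows "locally_integrable S f"
proof -
  have "integrable lebesgue (\<lambda>x::real^'n. indicator K x * (1::real))" if "compact K" for K :: "(real^'n) set"
    using integrable_real_indicator[of K lebesgue] lmeasurable_compact[OF that] by (auto simp: fmeasurable_def)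
  then have "locally_integrable S (\<lambda>x::real^'n. 1)" by (intro locally_integrableI)
  from locally_integrable_mult_smooth[OF assms this] show ?thesis by simp
qed

text \<open>Integration by parts: the derivative of the test function obtained as the product of
  \<psi> and f has integral 0.\<close>

lemma is_weak_deriv_smooth:
  fixes f :: "real^'n \<Rightarrow> real"
  assumes "smooth f" shows "is_weak_deriv S i f (pderiv_at i f)"
  unfolding is_weak_deriv_def
proof (intro conjI ballI locally_integrable_smooth smooth_pderiv assms)
  fix \<psi> assume \<psi>: "\<psi> \<in> test_functions S"
  have s\<psi>: "smooth \<psi>" using \<psi> test_functions_smooth by blast
  have s: "supp \<psi> \<subseteq> S" using \<psi> by (simp add: test_functions_iff)
  have 0: "(LINT x|lebesgue. pderiv_at i (\<lambda>x. \<psi> x * f x) x) = 0"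
    by (rule integral_pderiv_eq_0[OF test_functions_mult[OF \<psi> assms]])
  have e1: "indicator S x *\<^sub>R (f x * pderiv_at i \<psi> x) = pderiv_at i \<psi> x * f x" for x
    using pderiv_eq_0[of x \<psi> i] s by (auto simp: indicator_def)
  have e2: "indicator S x *\<^sub>R (pderiv_at i f x * \<psi> x) = \<psi> x * pderiv_at i f x" for x
    using not_in_supp[of x \<psi>] s by (auto simp: indicator_def)
  have "integrable lebesgue (\<lambda>x. \<psi> x * pderiv_at i f x)" "integrable lebesgue (\<lambda>x. pderiv_at i \<psi> x * f x)"
    by (intro test_functions_integrable[of _ S] test_functions_mult test_functions_pderiv \<psi> smooth_pderiv assms)+
  then show "(LINT x:S|lebesgue. f x * pderiv_at i \<psi> x) = - (LINT x:S|lebesgue. pderiv_at i f x * \<psi> x)"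
    using 0 unfolding set_lebesgue_integral_def e1 e2 by (simp add: pderiv_mult[OF s\<psi> assms])
qed

subsection \<open>The Sobolev and Carleman inequalities on balls\<close>

definition grad :: "(real^'n \<Rightarrow> real) \<Rightarrow> real^'n \<Rightarrow> real^'n" where
  "grad f x = (\<chi> i. pderiv_at i f x)"

lemma norm_grad_sq: "(norm (grad f x))\<^sup>2 = (\<Sum>i\<in>UNIV. (pderiv_at i f x)\<^sup>2)"
  by (simp add: grad_def norm_vec_def L2_set_def sum_nonneg)

lemma grad_measurable:
  fixes f :: "real^'n \<Rightarrow> real"
  assumes "smooth f" "S \<in> sets lebesgue"
  shows "(\<lambda>x. norm (grad f x)) \<in> borel_measurable (lebesgue_on S)"
proof -
  have [measurable]: "pderiv_at i f \<in> borel_measurable (lebesgue_on S)" for i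
    by (intro smooth_measurable smooth_pderiv assms)
  have "(\<lambda>x. sqrt (\<Sum>i\<in>UNIV. (pderiv_at i f x)\<^sup>2)) \<in> borel_measurable (lebesgue_on S)" by measurable
  then show ?thesis by (simp add: norm_grad_sq[symmetric])
qed

lemma Lnorm_norm: "Lnorm p S (\<lambda>x. norm (f x)) = Lnorm p S f"
  by (simp add: Lnorm_def)

lemma Lnorm_finite_bounded:
  fixes f :: "real^'n \<Rightarrow> 'b::real_normed_vector"
  assumes "0 < p" "S \<in> lmeasurable" "\<And>x. x \<in> S \<Longrightarrow> norm (f x) \<le> C"
  shows "Lnorm p S f < \<infinity>"
proof -
  have "Lnorm p S f = Lnorm p S (\<lambda>x. norm (f x))" by (simp add: Lnorm_norm)
  also have "\<dots> \<le> Lnorm p S (\<lambda>x. C)"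
    using assms by (intro Lnorm_mono) (auto intro: order_trans[OF _ abs_ge_self])
  also have "\<dots> < \<infinity>" using assms by (simp add: Lnorm_const)
  finally show ?thesis .
qed

lemma grad_bounded:
  fixes f :: "real^'n \<Rightarrow> real"
  assumes "f \<in> test_functions S" shows "\<exists>C\<ge>0. \<forall>x. norm (grad f x) \<le> C"
proof -
  have "\<forall>i. \<exists>C\<ge>0. \<forall>x. \<bar>pderiv_at i f x\<bar> \<le> C"
    using test_functions_bounded[OF test_functions_pderiv[OF assms]] by blast
  then obtain C where C: "\<And>i. C i \<ge> 0" "\<And>i x. \<bar>pderiv_at i f x\<bar> \<le> C i" by metis
  have "norm (grad f x) \<le> (\<Sum>i\<in>UNIV. C i)" for x
  proof -
    have "norm (grad f x) \<le> (\<Sum>i\<in>UNIV. \<bar>grad f x $ i\<bar>)" by (rule norm_le_l1_cart)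
    also have "\<dots> \<le> (\<Sum>i\<in>UNIV. C i)" using C by (intro sum_mono) (simp add: grad_def)
    finally show ?thesis .
  qed
  then show ?thesis using C(1) by (intro exI[of _ "\<Sum>i\<in>UNIV. C i"]) (auto intro: sum_nonneg)
qed

lemma weak_grad_AE_eq:
  fixes f :: "real^'n \<Rightarrow> real"
  assumes m: "mollifier (J :: nat \<Rightarrow> real^'n \<Rightarrow> real)" and S: "open S" and f: "smooth f"
  shows "AE x in lebesgue. x \<in> S \<longrightarrow> weak_grad S f x = grad f x"
proof -
  have "AE x in lebesgue. \<forall>i\<in>UNIV. x \<in> S \<longrightarrow> weak_deriv S i f x = pderiv_at i f x"
    using weak_deriv_AE_eq(2)[OF m S is_weak_deriv_smooth[OF f]] by (intro AE_finite_allI) auto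
  then show ?thesis by eventually_elim (auto simp: weak_grad_def grad_def)
qed

text \<open>The approximating test function is \<psi> itself. Even the weak gradient of the zero
  function is a choice, so its norm is computed from an almost everywhere identity.\<close>

lemma test_functions_H1_0:
  fixes \<psi> :: "real^'n \<Rightarrow> real"
  assumes m: "mollifier (J :: nat \<Rightarrow> real^'n \<Rightarrow> real)" and S: "open S" "S \<in> lmeasurable" and \<psi>: "\<psi> \<in> test_functions S"
  shows "\<psi> \<in> H1_0 S"
proof -
  have Ss: "S \<in> sets lebesgue" using S by auto
  have L: "f \<in> Lspace 2 S" if f: "f \<in> test_functions S" for f
  proof -
    obtain C where "\<And>x. \<bar>f x\<bar> \<le> C" using test_functions_bounded[OF f] by blast
    then have "Lnorm 2 S f < \<infinity>" using S by (intro Lnorm_finite_bounded[of _ _ _ C]) auto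
    then show ?thesis using smooth_measurable[OF test_functions_smooth[OF f] Ss] by (simp add: Lspace_def)
  qed
  have "\<psi> \<in> sobolev 1 2 S"
    using L[OF \<psi>] L[OF test_functions_pderiv[OF \<psi>]] is_weak_deriv_smooth[OF test_functions_smooth[OF \<psi>]]
    by (auto simp: One_nat_def)
  moreover have "Lnorm 2 S (weak_grad S (\<lambda>x. \<psi> x - \<psi> x)) = 0"
  proof -
    have "Lnorm 2 S (weak_grad S (\<lambda>x. 0)) = Lnorm 2 S (\<lambda>x. 0::real)"
      using Ss weak_grad_AE_eq[OF m S(1) smooth_const[of 0]]
      by (intro Lnorm_cong_AE) (auto elim!: eventually_mono simp: grad_def pderiv_const zero_vec_def[symmetric])
    then show ?thesis by simp
  qed
  ultimately show ?thesis using \<psi> unfolding H1_0_def by (auto intro!: bexI[of _ \<psi>])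
qed

text \<open>The gradient is continuous, so it is nonzero on an open set, and a negligible open set
  is empty. Hence \<psi> is constant, and compactness of its support leaves only the constant
  0.\<close>

lemma test_function_grad_zero:
  fixes \<psi> :: "real^'n \<Rightarrow> real"
  assumes \<psi>: "\<psi> \<in> test_functions S" and z: "AE x in lebesgue. norm (grad \<psi> x) = 0"
  shows "\<psi> x = 0"
proof -
  have sm: "smooth \<psi>" using \<psi> test_functions_smooth by blast
  have "continuous_on UNIV (\<lambda>x. \<Sum>i\<in>UNIV. (pderiv_at i \<psi> x)\<^sup>2)"
    by (intro continuous_intros smooth_continuous smooth_pderiv sm)
  then have o: "open {x. (\<Sum>i\<in>UNIV. (pderiv_at i \<psi> x)\<^sup>2) \<noteq> 0}"
    by (intro open_Collect_neq) auto
  have "AE x in lebesgue. x \<notin> {x. (\<Sum>i\<in>UNIV. (pderiv_at i \<psi> x)\<^sup>2) \<noteq> 0}"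
    using z by eventually_elim (simp add: norm_grad_sq[symmetric])
  then have "negligible {x. (\<Sum>i\<in>UNIV. (pderiv_at i \<psi> x)\<^sup>2) \<noteq> 0}"
    unfolding negligible_iff_null_sets using o by (subst AE_iff_null_sets) (auto simp: borel_open)
  then have "{x. (\<Sum>i\<in>UNIV. (pderiv_at i \<psi> x)\<^sup>2) \<noteq> 0} = {}"
    using o open_not_negligible by blast
  then have g: "pderiv_at i \<psi> y = 0" for i y by (auto simp: sum_nonneg_eq_0_iff)
  have "\<exists>c. \<forall>x\<in>UNIV. \<psi> x = c"
    using smooth_has_derivative'[OF sm] g by (intro has_derivative_zero_constant) auto
  then obtain c where c: "\<And>x. \<psi> x = c" by auto
  have "bounded (supp \<psi>)" using \<psi> compact_imp_bounded by (auto simp: test_functions_iff)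
  then have "supp \<psi> \<noteq> UNIV" using not_bounded_UNIV by auto
  then obtain y where "y \<notin> supp \<psi>" by blast
  then show ?thesis using c not_in_supp by metis
qed

text \<open>Division by the gradient norm makes \<psi> a competitor in the supremum. If that norm is
  zero, \<open>test_function_grad_zero\<close> applies.\<close>

lemma sobolev_inequality_unit_ball:
  fixes \<psi> :: "real^'n \<Rightarrow> real"
  assumes m: "mollifier (J :: nat \<Rightarrow> real^'n \<Rightarrow> real)" and n: "CARD('n) \<ge> 3"
    and \<psi>: "\<psi> \<in> test_functions (ball 0 1)"
  shows "Lnorm (crit_p' CARD('n)) (ball 0 1) \<psi> \<le> sobolev_const TYPE('n) * Lnorm 2 (ball 0 1) (grad \<psi>)"
proof -
  let ?B = "ball (0::real^'n) 1"
  have p': "crit_p' CARD('n) > 0" using n by (simp add: crit_p'_def)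
  have sm: "smooth \<psi>" using \<psi> test_functions_smooth by blast
  obtain C where "\<And>x. norm (grad \<psi> x) \<le> C" using grad_bounded[OF \<psi>] by blast
  then have fin: "Lnorm 2 ?B (grad \<psi>) < \<infinity>" by (intro Lnorm_finite_bounded[of _ _ _ C]) auto
  show ?thesis
  proof (cases "Lnorm 2 ?B (grad \<psi>) = 0")
    case True
    have "AE x in lebesgue. x \<in> ?B \<longrightarrow> norm (grad \<psi> x) = 0"
      using True grad_measurable[OF sm] by (intro Lnorm_eq_0_imp[of 2]) (auto simp: Lnorm_norm)
    moreover have "norm (grad \<psi> x) = 0" if "x \<notin> ?B" for x
    proof -
      have "x \<notin> supp \<psi>" using that \<psi> by (auto simp: test_functions_iff)
      then show ?thesis by (simp add: grad_def pderiv_eq_0 vec_eq_iff)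
    qed
    ultimately have "AE x in lebesgue. norm (grad \<psi> x) = 0" by (auto elim!: eventually_mono)
    then have "\<psi> = (\<lambda>x. 0)" using test_function_grad_zero[OF \<psi>] by blast
    then show ?thesis by simp
  next
    case False
    then obtain a where a: "Lnorm 2 ?B (grad \<psi>) = ennreal a" "a > 0"
      using fin by (cases "Lnorm 2 ?B (grad \<psi>)") (auto simp: less_le)
    define w where "w = (\<lambda>x. inverse a * \<psi> x)"
    have w: "w \<in> test_functions ?B" unfolding w_def by (rule test_functions_mult'[OF \<psi> smooth_const])
    have gw: "norm (grad w x) = inverse a * norm (grad \<psi> x)" for x
    proof -
      have "grad w x = inverse a *\<^sub>R grad \<psi> x" unfolding grad_def w_def pderiv_cmult[OF sm] by (simp add: vec_eq_iff)
      then show ?thesis using a by simp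
    qed
    have "Lnorm 2 ?B (weak_grad ?B w) = Lnorm 2 ?B (grad w)"
      using weak_grad_AE_eq[OF m _ test_functions_smooth[OF w], of ?B]
      by (intro Lnorm_cong_AE) (auto elim!: eventually_mono)
    also have "\<dots> = Lnorm 2 ?B (\<lambda>x. norm (grad w x))" by (simp add: Lnorm_norm)
    also have "\<dots> = ennreal (inverse a) * ennreal a"
      unfolding gw using a grad_measurable[OF sm] by (subst Lnorm_cmult) (auto simp: Lnorm_norm)
    also have "\<dots> = 1" using a by (simp add: ennreal_mult[symmetric])
    finally have "Lnorm (crit_p' CARD('n)) ?B w \<le> sobolev_const TYPE('n)"
      unfolding sobolev_const_def using test_functions_H1_0[OF m _ _ w] by (intro SUP_upper) auto
    then have "ennreal a * Lnorm (crit_p' CARD('n)) ?B w \<le> ennreal a * sobolev_const TYPE('n)"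
      by (rule mult_left_mono) simp
    moreover have "ennreal a * Lnorm (crit_p' CARD('n)) ?B w = Lnorm (crit_p' CARD('n)) ?B (\<lambda>x. a * w x)"
      using p' a smooth_measurable[OF test_functions_smooth[OF w]] by (subst Lnorm_cmult) auto
    moreover have "(\<lambda>x. a * w x) = \<psi>" using a by (simp add: w_def fun_eq_iff)
    ultimately show ?thesis by (simp add: a(1) mult.commute)
  qed
qed

text \<open>Write p and p' for the critical exponents. The identities for n / p and n / p' are
  scaling exponents for \<open>Lnorm_affine\<close>; the others are Hoelder relations: n/2 with p'
  and n with 2 both give p, n with p' gives 2, and p is dual to p'.\<close>

lemma crit_exponents:
  assumes "n \<ge> 3"
  shows "crit_p n > 1" "crit_p' n > 0" "real n / crit_p n = real n / 2 + 1" "real n / crit_p' n = real n / 2 - 1"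
    "1 / crit_p n = 2 / real n + 1 / crit_p' n" "1 / crit_p n = 1 / real n + 1 / 2" "1 / 2 = 1 / real n + 1 / crit_p' n"
    "1 / crit_p n + 1 / crit_p' n = 1"
  using assms by (auto simp: crit_p_def crit_p'_def field_simps)

text \<open>Scale invariance: n / 2 - 1 from the norm on the left plus 1 from differentiating the
  dilation is n / 2, the exponent of the gradient norm. The constant is thus the same for all
  balls.\<close>

lemma sobolev_inequality_ball:
  fixes \<psi> :: "real^'n \<Rightarrow> real"
  assumes m: "mollifier (J :: nat \<Rightarrow> real^'n \<Rightarrow> real)" and n: "CARD('n) \<ge> 3" and d: "d > 0"
    and \<psi>: "\<psi> \<in> test_functions (ball a d)"
  shows "Lnorm (crit_p' CARD('n)) (ball a d) \<psi> \<le> sobolev_const TYPE('n) * Lnorm 2 (ball a d) (grad \<psi>)"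
proof -
  let ?B = "ball (0::real^'n) 1" and ?p = "crit_p' CARD('n)" and ?N = "real CARD('n)"
  have p': "?p > 0" using crit_exponents[OF n] by simp
  have sm: "smooth \<psi>" using \<psi> test_functions_smooth by blast
  define w where "w = (\<lambda>x. \<psi> (a + d *\<^sub>R x))"
  have w: "w \<in> test_functions ?B" unfolding w_def
    by (rule test_functions_affine[OF \<psi>]) (use d in \<open>auto simp: dist_norm\<close>)
  have gw: "norm (grad w x) = d * norm (grad \<psi> (a + d *\<^sub>R x))" for x
  proof -
    have "grad w x = d *\<^sub>R grad \<psi> (a + d *\<^sub>R x)" unfolding grad_def w_def pderiv_affine[OF sm] by (simp add: vec_eq_iff)
    then show ?thesis using d by simp
  qed
  define g where "g = (\<lambda>x. norm (grad \<psi> (a + d *\<^sub>R x)))"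
  have mg: "g \<in> borel_measurable (lebesgue_on ?B)"
    unfolding g_def by (rule Lnorm_affine(2)[OF p' d grad_measurable[OF sm]]) simp
  have A: "Lnorm 2 ?B (grad w) = ennreal d * Lnorm 2 ?B g"
  proof -
    have "Lnorm 2 ?B (grad w) = Lnorm 2 ?B (\<lambda>x. d * g x)"
      using d by (intro Lnorm_cong) (auto simp: gw g_def)
    also have "\<dots> = ennreal \<bar>d\<bar> * Lnorm 2 ?B g" using mg by (intro Lnorm_cmult) auto
    finally show ?thesis using d by simp
  qed
  have B: "ennreal (d powr (?N / 2 - 1)) * ennreal d = ennreal (d powr (?N / 2))"
    using d powr_add[of d "?N / 2 - 1" 1] by (simp add: ennreal_mult[symmetric])
  have C: "Lnorm 2 (ball a d) (grad \<psi>) = ennreal (d powr (?N / 2)) * Lnorm 2 ?B g"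
    using Lnorm_affine(1)[OF zero_less_numeral d grad_measurable[OF sm, of "ball a d"], of "num.Bit0 num.One"]
    by (simp add: g_def Lnorm_norm)
  have "Lnorm ?p (ball a d) \<psi> = ennreal (d powr (?N / 2 - 1)) * Lnorm ?p ?B w"
    using Lnorm_affine(1)[OF p' d, of \<psi> a] smooth_measurable[OF sm] crit_exponents(4)[OF n] by (simp add: w_def)
  also have "\<dots> \<le> ennreal (d powr (?N / 2 - 1)) * (sobolev_const TYPE('n) * Lnorm 2 ?B (grad w))"
    by (intro mult_left_mono sobolev_inequality_unit_ball[OF m n w]) simp
  also have "\<dots> = sobolev_const TYPE('n) * ((ennreal (d powr (?N / 2 - 1)) * ennreal d) * Lnorm 2 ?B g)"
    unfolding A by (simp only: mult_ac)
  also have "\<dots> = sobolev_const TYPE('n) * Lnorm 2 (ball a d) (grad \<psi>)"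
    unfolding B C ..
  finally show ?thesis .
qed

text \<open>Scale invariance again: the weight contributes d powr (-\<tau>) on both sides, and the
  exponents n / 2 - 1 and n / 2 + 1 differ by the d^2 that the Laplacian produces, so that \<kappa>
  survives unchanged.\<close>

lemma carleman_ball:
  fixes u q :: "real^'n \<Rightarrow> real"
  assumes n: "CARD('n) \<ge> 3" and C: "carleman TYPE('n) r \<kappa>" and d: "d > 0"
    and u: "u \<in> test_functions (ball a d - {a})" and \<tau>: "\<tau> \<in> Lambda CARD('n)"
    and q: "q \<in> borel_measurable (lebesgue_on (ball a d))" "Lnorm (real CARD('n) / 2) (ball a d) q \<le> ennreal r"
  shows "Lnorm (crit_p' CARD('n)) (ball a d) (\<lambda>y. norm (y - a) powr (-\<tau>) * u y)
     \<le> ennreal \<kappa> * Lnorm (crit_p CARD('n)) (ball a d) (\<lambda>y. norm (y - a) powr (-\<tau>) * (lap u y + q y * u y))"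
proof -
  let ?B = "ball (0::real^'n) 1" and ?p' = "crit_p' CARD('n)" and ?p = "crit_p CARD('n)" and ?N = "real CARD('n)"
  have p: "?p > 0" "?p' > 0" "?N / 2 > 0" "?N > 0" using crit_exponents[OF n] n by auto
  have sm: "smooth u" using u test_functions_smooth by blast
  have mu[measurable]: "u \<in> borel_measurable (lebesgue_on (ball a d))" "lap u \<in> borel_measurable (lebesgue_on (ball a d))"
    by (intro smooth_measurable sm smooth_lap; simp)+
  have mq[measurable]: "q \<in> borel_measurable (lebesgue_on (ball a d))" by fact
  have mn[measurable]: "(\<lambda>y. norm (y - b) powr (-\<tau>)) \<in> borel_measurable (lebesgue_on S)" for b :: "real^'n" and S
    by (intro measurable_restrict_space1 measurable_completion) measurable
  define w where "w = (\<lambda>x. u (a + d *\<^sub>R x))"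
  \<comment> \<open>With the factor d^2 the potential scales like the Laplacian, and its L^{n/2}
    norm is preserved.\<close>
  define q' where "q' = (\<lambda>x. d\<^sup>2 * q (a + d *\<^sub>R x))"
  have w: "w \<in> test_functions (?B - {0})" unfolding w_def
    by (rule test_functions_affine[OF u]) (use d in \<open>auto simp: dist_norm\<close>)
  have mqa: "(\<lambda>x. q (a + d *\<^sub>R x)) \<in> borel_measurable (lebesgue_on ?B)"
    by (rule Lnorm_affine(2)[OF p(1) d mq])
  then have mq': "q' \<in> borel_measurable (lebesgue_on ?B)" unfolding q'_def by measurable
  have nq': "Lnorm (?N / 2) ?B q' \<le> ennreal r"
  proof -
    have "Lnorm (?N / 2) (ball a d) q = ennreal (d\<^sup>2) * Lnorm (?N / 2) ?B (\<lambda>x. q (a + d *\<^sub>R x))"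
      using Lnorm_affine(1)[OF p(3) d mq] p(4) d by (simp add: powr_numeral)
    also have "\<dots> = Lnorm (?N / 2) ?B q'"
      unfolding q'_def using mqa p(3) by (subst Lnorm_cmult) auto
    finally show ?thesis using q(2) by simp
  qed
  have q'L: "q' \<in> Lspace (?N / 2) ?B"
    using mq' le_less_trans[OF nq', of \<infinity>] by (simp add: Lspace_def)
  have main: "Lnorm ?p' ?B (\<lambda>x. norm x powr (-\<tau>) * w x) \<le> ennreal \<kappa> * Lnorm ?p ?B (\<lambda>x. norm x powr (-\<tau>) * (lap w x + q' x * w x))"
    using C w q'L \<tau> nq' unfolding carleman_def by blast
  have nrm: "norm (a + d *\<^sub>R x - a) powr (-\<tau>) = d powr (-\<tau>) * norm x powr (-\<tau>)" for x
    using d by (simp add: powr_mult)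
  have mw: "w \<in> borel_measurable (lebesgue_on ?B)" "lap w \<in> borel_measurable (lebesgue_on ?B)"
    by (intro smooth_measurable smooth_lap test_functions_smooth[OF w]; simp)+
  note [measurable] = mw mq'
  have "Lnorm ?p' (ball a d) (\<lambda>y. norm (y - a) powr (-\<tau>) * u y)
     = ennreal (d powr (?N / 2 - 1)) * Lnorm ?p' ?B (\<lambda>x. d powr (-\<tau>) * (norm x powr (-\<tau>) * w x))"
  proof -
    have "(\<lambda>y. norm (y - a) powr (-\<tau>) * u y) \<in> borel_measurable (lebesgue_on (ball a d))" by measurable
    from Lnorm_affine(1)[OF p(2) d this] show ?thesis
      unfolding nrm crit_exponents(4)[OF n] by (simp add: w_def mult.assoc)
  qed
  also have "\<dots> = ennreal (d powr (?N / 2 - 1)) * (ennreal (d powr (-\<tau>)) * Lnorm ?p' ?B (\<lambda>x. norm x powr (-\<tau>) * w x))"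
    using p(2) mn[of 0] by (subst Lnorm_cmult) auto
  also have "\<dots> \<le> ennreal (d powr (?N / 2 - 1)) * (ennreal (d powr (-\<tau>)) * (ennreal \<kappa> * Lnorm ?p ?B (\<lambda>x. norm x powr (-\<tau>) * (lap w x + q' x * w x))))"
    by (intro mult_left_mono main) auto
  also have "\<dots> = ennreal \<kappa> * Lnorm ?p (ball a d) (\<lambda>y. norm (y - a) powr (-\<tau>) * (lap u y + q y * u y))"
  proof -
    have lq: "lap w x + q' x * w x = d\<^sup>2 * (lap u (a + d *\<^sub>R x) + q (a + d *\<^sub>R x) * u (a + d *\<^sub>R x))" for x
      unfolding w_def lap_affine[OF sm] q'_def by (simp add: algebra_simps)
    have m1: "(\<lambda>y. norm (y - a) powr (-\<tau>) * (lap u y + q y * u y)) \<in> borel_measurable (lebesgue_on (ball a d))" by measurable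
    have m2: "(\<lambda>x. norm x powr (-\<tau>) * (lap u (a + d *\<^sub>R x) + q (a + d *\<^sub>R x) * u (a + d *\<^sub>R x))) \<in> borel_measurable (lebesgue_on ?B)"
    proof -
      have "(\<lambda>x. inverse (d\<^sup>2) * (norm x powr (-\<tau>) * (lap w x + q' x * w x))) \<in> borel_measurable (lebesgue_on ?B)"
        using mn[of 0] by simp
      moreover have "inverse (d\<^sup>2) * (norm x powr (-\<tau>) * (lap w x + q' x * w x)) = norm x powr (-\<tau>) * (lap u (a + d *\<^sub>R x) + q (a + d *\<^sub>R x) * u (a + d *\<^sub>R x))" for x
        using d by (simp add: lq)
      ultimately show ?thesis by simp
    qed
    have "Lnorm ?p (ball a d) (\<lambda>y. norm (y - a) powr (-\<tau>) * (lap u y + q y * u y))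
      = ennreal (d powr (?N / 2 + 1)) * Lnorm ?p ?B (\<lambda>x. d powr (-\<tau>) * (norm x powr (-\<tau>) * (lap u (a + d *\<^sub>R x) + q (a + d *\<^sub>R x) * u (a + d *\<^sub>R x))))"
      using Lnorm_affine(1)[OF p(1) d m1] unfolding nrm crit_exponents(3)[OF n] by (simp add: mult.assoc)
    also have "\<dots> = ennreal (d powr (?N / 2 + 1)) * (ennreal (d powr (-\<tau>)) * Lnorm ?p ?B (\<lambda>x. norm x powr (-\<tau>) * (lap u (a + d *\<^sub>R x) + q (a + d *\<^sub>R x) * u (a + d *\<^sub>R x))))"
      using p(1) m2 by (subst Lnorm_cmult) auto
    finally have A': "Lnorm ?p (ball a d) (\<lambda>y. norm (y - a) powr (-\<tau>) * (lap u y + q y * u y)) =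
      ennreal (d powr (?N / 2 + 1)) * (ennreal (d powr (-\<tau>)) * Lnorm ?p ?B (\<lambda>x. norm x powr (-\<tau>) * (lap u (a + d *\<^sub>R x) + q (a + d *\<^sub>R x) * u (a + d *\<^sub>R x))))" .
    have A2: "ennreal (d powr (?N / 2 + 1)) = ennreal (d powr (?N / 2 - 1)) * ennreal (d\<^sup>2)"
      using d powr_add[of d "?N / 2 - 1" 2] by (simp add: ennreal_mult[symmetric] powr_numeral add.commute)
    from A'[unfolded A2] have A: "Lnorm ?p (ball a d) (\<lambda>y. norm (y - a) powr (-\<tau>) * (lap u y + q y * u y)) =
      ennreal (d powr (?N / 2 - 1)) * ennreal (d\<^sup>2) * (ennreal (d powr (-\<tau>)) * Lnorm ?p ?B (\<lambda>x. norm x powr (-\<tau>) * (lap u (a + d *\<^sub>R x) + q (a + d *\<^sub>R x) * u (a + d *\<^sub>R x))))" by (simp only: mult.assoc)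
    have B: "Lnorm ?p ?B (\<lambda>x. norm x powr (-\<tau>) * (lap w x + q' x * w x)) = ennreal (d\<^sup>2) * Lnorm ?p ?B (\<lambda>x. norm x powr (-\<tau>) * (lap u (a + d *\<^sub>R x) + q (a + d *\<^sub>R x) * u (a + d *\<^sub>R x)))"
      unfolding lq using Lnorm_cmult[OF p(1) _ m2, of "d\<^sup>2"] by (simp add: mult.left_commute)
    show ?thesis unfolding A B by (simp add: mult_ac)
  qed
  finally show ?thesis .
qed

section \<open>Smooth approximation of Sobolev functions\<close>

lemma Lnorm_sum_finite:
  fixes f :: "'i \<Rightarrow> real^'n \<Rightarrow> real"
  assumes "1 \<le> p" "S \<in> sets lebesgue" "finite I" "\<And>i. i \<in> I \<Longrightarrow> f i \<in> borel_measurable (lebesgue_on S)" "\<And>i. i \<in> I \<Longrightarrow> Lnorm p S (f i) < \<infinity>"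
  shows "Lnorm p S (\<lambda>x. \<Sum>i\<in>I. f i x) < \<infinity>"
  using assms(3-5)
proof (induction I rule: finite_induct)
  case (insert j I)
  have "Lnorm p S (\<lambda>x. \<Sum>i\<in>insert j I. f i x) = Lnorm p S (\<lambda>x. f j x + (\<Sum>i\<in>I. f i x))" using insert by simp
  also have "\<dots> \<le> 2 * (Lnorm p S (f j) + Lnorm p S (\<lambda>x. \<Sum>i\<in>I. f i x))"
    using insert assms by (intro Lnorm_add_le borel_measurable_sum) auto
  also have "\<dots> < \<infinity>" using insert by (auto simp: ennreal_mult_less_top)
  finally show ?case .
qed simp

lemma conv_sum:
  fixes f :: "'i \<Rightarrow> real^'n \<Rightarrow> real"
  assumes "J \<in> test_functions S" "\<And>i. i \<in> I \<Longrightarrow> integrable lebesgue (f i)"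
  shows "conv J (\<lambda>x. \<Sum>i\<in>I. f i x) x = (\<Sum>i\<in>I. conv J (f i) x)"
  unfolding conv_def sum_distrib_left by (rule Bochner_Integration.integral_sum) (rule integrable_conv[OF assms])

text \<open>The function u is cut off at radius R and mollified. On the smaller ball this commutes
  with differentiation as soon as 1 / (k + 1) < R - R'.\<close>

lemma smooth_approximation:
  fixes u :: "real^'n \<Rightarrow> real"
  assumes m: "mollifier (J :: nat \<Rightarrow> real^'n \<Rightarrow> real)" and R: "0 < R'" "R' < R" "cball a R \<subseteq> S" and p: "1 \<le> p"
    and u2: "Lnorm 2 (cball a R) u < \<infinity>" and up: "Lnorm p (cball a R) u < \<infinity>"
    and v: "\<And>i. is_weak_deriv S i u (v i)" "\<And>i. Lnorm p (cball a R) (v i) < \<infinity>"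
    and w: "\<And>i. is_weak_deriv S i (v i) (w i)" "\<And>i. Lnorm p (cball a R) (w i) < \<infinity>"
  shows "\<exists>U. (\<forall>k. smooth (U k)) \<and>
    (\<lambda>k. Lnorm 2 (ball a R') (\<lambda>x. U k x - u x)) \<longlonglongrightarrow> 0 \<and>
    (\<lambda>k. Lnorm p (ball a R') (\<lambda>x. U k x - u x)) \<longlonglongrightarrow> 0 \<and>
    (\<forall>i. (\<lambda>k. Lnorm p (ball a R') (\<lambda>x. pderiv_at i (U k) x - v i x)) \<longlonglongrightarrow> 0) \<and>
    (\<lambda>k. Lnorm p (ball a R') (\<lambda>x. lap (U k) x - (\<Sum>i\<in>UNIV. w i x))) \<longlonglongrightarrow> 0 \<and>
    (AE x in lebesgue. x \<in> ball a R' \<longrightarrow> (\<lambda>k. U k x) \<longlonglongrightarrow> u x)"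
proof -
  let ?T = "cball a R" and ?B = "ball a R'"
  have T: "compact ?T" "?B \<in> sets lebesgue" "?B \<subseteq> ?T" "?T \<in> sets lebesgue" using R by auto
  define cut where "cut f x = indicator ?T x * f x" for f :: "real^'n \<Rightarrow> real" and x
  define W where "W x = (\<Sum>i\<in>UNIV. w i x)" for x
  have ui: "integrable lebesgue (cut u)" and vi: "integrable lebesgue (cut (v i))" and wi: "integrable lebesgue (cut (w i))" for i
    unfolding cut_def using v(1)[of i] w(1)[of i] T R by (auto simp: is_weak_deriv_def intro!: locally_integrableD)
  have cW: "cut W = (\<lambda>x. \<Sum>i\<in>UNIV. cut (w i) x)" by (simp add: cut_def W_def sum_distrib_left fun_eq_iff)
  have Wi: "integrable lebesgue (cut W)" unfolding cW using wi by (intro Bochner_Integration.integrable_sum) auto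
  have mw: "w i \<in> borel_measurable (lebesgue_on ?T)" for i
    using wi[of i] T unfolding cut_def by (subst borel_measurable_lebesgue_on_iff) auto
  have Wp: "Lnorm p ?T W < \<infinity>" unfolding W_def using p T mw w by (intro Lnorm_sum_finite) auto
  note J = mollifierD[OF m]
  have lim: "(\<lambda>k. Lnorm r ?B (\<lambda>x. conv (J k) (cut f) x - f x)) \<longlonglongrightarrow> 0"
    if "1 \<le> r" "integrable lebesgue (cut f)" "Lnorm r ?T f < \<infinity>" for r f
    using conv_local_tendsto[OF m that(1) T(1-3), of f] that unfolding cut_def by blast
  define U where "U k = conv (J k) (cut u)" for k
  have ev: "\<forall>\<^sub>F k in sequentially. 1 / real (Suc k) < R - R'"
    using order_tendstoD(2)[OF LIMSEQ_Suc[OF lim_1_over_n], of "R - R'"] R by simp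
  have inT: "ball x (1 / real (Suc k)) \<subseteq> ?T" if "x \<in> ?B" "1 / real (Suc k) < R - R'" for x k
  proof
    fix z assume "z \<in> ball x (1 / real (Suc k))"
    then have "dist x z < R - R'" using that by simp
    then show "z \<in> ?T" using that dist_triangle[of a z x] by simp
  qed
  have JB: "J k \<in> test_functions (ball 0 (1 / real (Suc k)))" for k using m by (simp add: mollifier_def)
  have pd: "pderiv_at i (U k) x = conv (J k) (cut (v i)) x" if "x \<in> ?B" "1 / real (Suc k) < R - R'" for i k x
    using pderiv_conv_weak[OF v(1) T(1) R(3) JB inT[OF that]] unfolding U_def cut_def .
  have pd2: "pderiv_at i (pderiv_at i (U k)) x = conv (J k) (cut (w i)) x" if x: "x \<in> ?B" "1 / real (Suc k) < R - R'" for i k x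
  proof -
    \<comment> \<open>The formula for first derivatives holds on an open ball, hence may be
      differentiated once more.\<close>
    have "pderiv_at i (pderiv_at i (U k)) x = pderiv_at i (conv (J k) (cut (v i))) x"
      by (rule pderiv_local[of ?B]) (use pd x in auto)
    also have "\<dots> = conv (J k) (cut (w i)) x"
      using pderiv_conv_weak[OF w(1) T(1) R(3) JB inT[OF x]] unfolding cut_def .
    finally show ?thesis .
  qed
  have lp: "lap (U k) x = conv (J k) (cut W) x" if "x \<in> ?B" "1 / real (Suc k) < R - R'" for k x
    unfolding lap_def cW using pd2[OF that] conv_sum[OF J(1), of UNIV "\<lambda>i. cut (w i)"] wi by simp
  have l2: "(\<lambda>k. Lnorm 2 ?B (\<lambda>x. U k x - u x)) \<longlonglongrightarrow> 0" unfolding U_def by (rule lim[OF _ ui u2]) simp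
  have lp0: "(\<lambda>k. Lnorm p ?B (\<lambda>x. U k x - u x)) \<longlonglongrightarrow> 0" unfolding U_def by (rule lim[OF p ui up])
  have l1: "(\<lambda>k. Lnorm p ?B (\<lambda>x. pderiv_at i (U k) x - v i x)) \<longlonglongrightarrow> 0" for i
  proof (rule Lim_transform_eventually[OF lim[OF p vi v(2)]])
    show "\<forall>\<^sub>F k in sequentially. Lnorm p ?B (\<lambda>x. conv (J k) (cut (v i)) x - v i x) = Lnorm p ?B (\<lambda>x. pderiv_at i (U k) x - v i x)"
      using ev by eventually_elim (use p T pd in \<open>auto intro!: Lnorm_cong\<close>)
  qed
  have ll: "(\<lambda>k. Lnorm p ?B (\<lambda>x. lap (U k) x - W x)) \<longlonglongrightarrow> 0"
  proof (rule Lim_transform_eventually[OF lim[OF p Wi Wp]])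
    show "\<forall>\<^sub>F k in sequentially. Lnorm p ?B (\<lambda>x. conv (J k) (cut W) x - W x) = Lnorm p ?B (\<lambda>x. lap (U k) x - W x)"
      using ev by eventually_elim (use p T lp in \<open>auto intro!: Lnorm_cong\<close>)
  qed
  have sU: "smooth (U k)" for k unfolding U_def by (rule smooth_conv[OF J(1) ui])
  \<comment> \<open>Convergence almost everywhere, which Fatou's lemma will use, is extracted from
    convergence in L^1 along a subsequence; the norm limits pass to it.\<close>
  obtain s where s: "strict_mono s" and ae: "AE x in lebesgue. (\<lambda>k. indicator ?B x * (U (s k) x - u x)) \<longlonglongrightarrow> 0"
  proof -
    have i: "integrable lebesgue (\<lambda>x. indicator ?B x * (U k x - u x))" for k
    proof -
      have "integrable lebesgue (\<lambda>x. indicator ?T x * U k x)"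
        using locally_integrableD[OF locally_integrable_smooth[OF sU] T(1), of UNIV] by auto
      then have "integrable lebesgue (\<lambda>x. indicator ?T x * U k x - cut u x)" using ui by auto
      then have "integrable lebesgue (\<lambda>x. indicator ?B x * (indicator ?T x * U k x - cut u x))"
        using integrable_mult_indicator[OF T(2), of "\<lambda>x. indicator ?T x * U k x - cut u x"] by simp
      moreover have "(\<lambda>x. indicator ?B x * (indicator ?T x * U k x - cut u x)) = (\<lambda>x. indicator ?B x * (U k x - u x))"
        using T(3) by (auto simp: fun_eq_iff cut_def indicator_def)
      ultimately show ?thesis by simp
    qed
    have e: "Lnorm 1 ?B (\<lambda>x. U k x - u x) = ennreal (LINT x|lebesgue. norm (indicator ?B x * (U k x - u x)))" for k
    proof -
      have "Lnorm 1 ?B (\<lambda>x. U k x - u x) = Lnorm 1 UNIV (\<lambda>x. indicator ?B x * (U k x - u x))"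
        using T(2) by (intro antisym Lnorm_subset_mono) auto
      then show ?thesis using Lnorm_1_integrable[OF i] by simp
    qed
    have "Lnorm 1 ?T u \<le> Lnorm 1 UNIV (cut u)" using T by (intro Lnorm_subset_mono) (auto simp: cut_def)
    also have "\<dots> < \<infinity>" by (simp add: Lnorm_1_integrable[OF ui])
    finally have "(\<lambda>k. Lnorm 1 ?B (\<lambda>x. U k x - u x)) \<longlonglongrightarrow> 0"
      unfolding U_def by (intro lim ui) auto
    then have "(\<lambda>k. LINT x|lebesgue. norm (indicator ?B x * (U k x - u x))) \<longlonglongrightarrow> 0"
      unfolding e by (subst (asm) ennreal_tendsto_0_iff) auto
    from tendsto_L1_AE_subseq[OF i this] show ?thesis using that by blast
  qed
  have ae': "AE x in lebesgue. x \<in> ?B \<longrightarrow> (\<lambda>k. U (s k) x) \<longlonglongrightarrow> u x"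
    using ae by eventually_elim (auto simp: LIM_zero_cancel)
  show ?thesis
    using sU ae' LIMSEQ_subseq_LIMSEQ[OF l2 s] LIMSEQ_subseq_LIMSEQ[OF lp0 s] LIMSEQ_subseq_LIMSEQ[OF l1 s] LIMSEQ_subseq_LIMSEQ[OF ll s]
    by (intro exI[of _ "\<lambda>k. U (s k)"]) (auto simp: o_def W_def)
qed

subsection \<open>A Caccioppoli estimate\<close>

lemma ennreal_root_2_sq: "(ennreal_root 2 X)\<^sup>2 = X"
proof (cases X)
  case (real r)
  have "(r powr (1/2))\<^sup>2 = r" using real by (simp add: powr_half_sqrt)
  then show ?thesis using real by (simp add: ennreal_root_ennreal ennreal_power)
qed (simp add: power2_eq_square ennreal_mult_top)

lemma Lnorm_2_sq: "(Lnorm 2 S f)\<^sup>2 = (\<integral>\<^sup>+x. ennreal ((norm (f x))\<^sup>2) \<partial>lebesgue_on S)"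
  unfolding Lnorm_def ennreal_root_2_sq by (intro nn_integral_cong) (simp add: powr_numeral)

lemma Lnorm_1: "Lnorm 1 S f = (\<integral>\<^sup>+x. ennreal (norm (f x)) \<partial>lebesgue_on S)"
  by (simp add: Lnorm_def)

lemma integral_le_nn_integral:
  assumes "integrable M f" shows "ennreal (integral\<^sup>L M f) \<le> (\<integral>\<^sup>+x. ennreal (f x) \<partial>M)"
proof -
  have "integral\<^sup>L M f \<le> integral\<^sup>L M (\<lambda>x. max 0 (f x))"
    using assms by (intro integral_mono) auto
  then have "ennreal (integral\<^sup>L M f) \<le> ennreal (integral\<^sup>L M (\<lambda>x. max 0 (f x)))" by (rule ennreal_leI)
  also have "\<dots> = (\<integral>\<^sup>+x. ennreal (max 0 (f x)) \<partial>M)"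
    using assms by (intro nn_integral_eq_integral[symmetric]) auto
  also have "\<dots> = (\<integral>\<^sup>+x. ennreal (f x) \<partial>M)"
    by (intro nn_integral_cong) (auto simp: max_def ennreal_neg)
  finally show ?thesis .
qed

text \<open>If g exceeded 2 \<nu> + 2 s, then \<nu>^2 \<le> \<nu> g, and moving t g^2 to the left
  would give g^2 \<le> (2 \<nu> + 2 s) g < g^2.\<close>

lemma quadratic_absorb:
  fixes g \<nu> s t :: real
  assumes "0 \<le> g" "0 \<le> \<nu>" "0 \<le> s" "t \<le> 1/2" "g\<^sup>2 \<le> \<nu>\<^sup>2 + s * g + t * g\<^sup>2"
  shows "g \<le> 2 * \<nu> + 2 * s"
proof (rule ccontr)
  assume "\<not> g \<le> 2 * \<nu> + 2 * s"
  then have g: "g > 2 * \<nu> + 2 * s" by simp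
  have "t * g\<^sup>2 \<le> 1/2 * g\<^sup>2" using assms by (intro mult_right_mono) auto
  then have "g\<^sup>2 \<le> 2 * \<nu>\<^sup>2 + 2 * (s * g)" using assms(5) by linarith
  also have "\<dots> \<le> 2 * (\<nu> * g) + 2 * (s * g)"
    using g assms by (simp add: power2_eq_square mult_left_mono)
  also have "\<dots> = (2 * \<nu> + 2 * s) * g" by (simp add: algebra_simps)
  also have "\<dots> < g * g" using g assms by (intro mult_strict_right_mono) auto
  finally show False by (simp add: power2_eq_square)
qed

text \<open>Integrating \<open>div (\<xi>\<^sup>2 U \<nabla>U)\<close> gives \<open>\<integral>|\<nabla>(\<xi>U)|\<^sup>2 = \<integral>|\<nabla>\<xi>|\<^sup>2U\<^sup>2 - \<integral>\<xi>\<^sup>2 U \<Delta>U\<close>; the potential term is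
  absorbed by the Sobolev inequality because \<open>\<theta>\<sigma>\<^sup>2 \<le> 1/2\<close>.\<close>

lemma caccioppoli:
  fixes U q \<xi> :: "real^'n \<Rightarrow> real"
  assumes n: "CARD('n) \<ge> 3" and U: "smooth U" and \<xi>: "\<xi> \<in> test_functions D" and D: "D \<in> sets lebesgue"
    and sob: "\<And>\<psi>. \<psi> \<in> test_functions D \<Longrightarrow> Lnorm (crit_p' CARD('n)) D \<psi> \<le> ennreal \<sigma> * Lnorm 2 D (grad \<psi>)"
    and \<sigma>: "0 \<le> \<sigma>" "0 \<le> \<theta>" "\<theta> * \<sigma>\<^sup>2 \<le> 1/2"
    and q: "q \<in> borel_measurable (lebesgue_on D)" "Lnorm (real CARD('n) / 2) D q \<le> ennreal \<theta>"
  shows "Lnorm 2 D (grad (\<lambda>x. \<xi> x * U x)) \<le> 2 * Lnorm 2 D (\<lambda>x. norm (grad \<xi> x) * U x)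
     + 2 * (ennreal \<sigma> * Lnorm (crit_p CARD('n)) D (\<lambda>x. \<xi> x * (lap U x + q x * U x)))"
proof -
  let ?p = "crit_p CARD('n)" and ?p' = "crit_p' CARD('n)"
  have p: "?p > 0" "?p' > 0" "real CARD('n) / 2 > 0" using crit_exponents[OF n] n by auto
  have s\<xi>: "smooth \<xi>" using \<xi> test_functions_smooth by blast
  define w where "w = (\<lambda>x. \<xi> x * U x)"
  have w: "w \<in> test_functions D" unfolding w_def by (rule test_functions_mult[OF \<xi> U])
  have sw: "smooth w" using w test_functions_smooth by blast
  define F where "F = (\<lambda>x. lap U x + q x * U x)"
  have [measurable]: "U \<in> borel_measurable (lebesgue_on D)" "lap U \<in> borel_measurable (lebesgue_on D)" "w \<in> borel_measurable (lebesgue_on D)"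
      "\<xi> \<in> borel_measurable (lebesgue_on D)" "q \<in> borel_measurable (lebesgue_on D)"
    using D q by (auto intro!: smooth_measurable U smooth_lap sw s\<xi>)
  have [measurable]: "F \<in> borel_measurable (lebesgue_on D)" unfolding F_def by measurable
  have [measurable]: "(\<lambda>x. norm (grad \<xi> x)) \<in> borel_measurable (lebesgue_on D)" by (rule grad_measurable[OF s\<xi> D])
  define G where "G = Lnorm 2 D (grad w)"
  define N where "N = Lnorm 2 D (\<lambda>x. norm (grad \<xi> x) * U x)"
  define \<Phi> where "\<Phi> = Lnorm ?p D (\<lambda>x. \<xi> x * F x)"
  define A where "A x = (norm (grad \<xi> x))\<^sup>2 * (U x)\<^sup>2 - w x * \<xi> x * lap U x" for x
  define V where "V i x = \<xi> x * (w x * pderiv_at i U x)" for i x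
  have V: "V i \<in> test_functions D" for i
    unfolding V_def by (intro test_functions_mult \<xi> smooth_mult sw smooth_pderiv U)
  have point: "(norm (grad w x))\<^sup>2 = A x + (\<Sum>i\<in>UNIV. pderiv_at i (V i) x)" for x
  proof -
    have "(pderiv_at i w x)\<^sup>2 = (pderiv_at i \<xi> x)\<^sup>2 * (U x)\<^sup>2 - w x * \<xi> x * pderiv_at i (pderiv_at i U) x + pderiv_at i (V i) x" for i
      unfolding V_def w_def
      by (simp add: pderiv_mult s\<xi> U smooth_pderiv smooth_mult algebra_simps power2_eq_square)
    then show ?thesis unfolding norm_grad_sq A_def lap_def
      by (simp add: sum.distrib sum_subtractf sum_distrib_left sum_distrib_right)
  qed
  have Vi: "integrable lebesgue (pderiv_at i (V i))" for i
    by (rule test_functions_integrable[OF test_functions_pderiv[OF V]])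
  have gwi: "integrable lebesgue (\<lambda>x. (norm (grad w x))\<^sup>2)"
  proof -
    have "(\<lambda>x. pderiv_at i w x * pderiv_at i w x) \<in> test_functions D" for i
      by (intro test_functions_mult test_functions_pderiv w smooth_pderiv sw)
    then have "integrable lebesgue (\<lambda>x. \<Sum>i\<in>UNIV. pderiv_at i w x * pderiv_at i w x)"
      by (intro Bochner_Integration.integrable_sum test_functions_integrable)
    then show ?thesis unfolding norm_grad_sq by (simp add: power2_eq_square)
  qed
  have Aeq: "A = (\<lambda>x. (norm (grad w x))\<^sup>2 - (\<Sum>i\<in>UNIV. pderiv_at i (V i) x))" using point by (simp add: fun_eq_iff)
  have Ai: "integrable lebesgue A" unfolding Aeq using gwi Vi by auto
  have IA: "(LINT x|lebesgue. (norm (grad w x))\<^sup>2) = (LINT x|lebesgue. A x)"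
    unfolding Aeq using gwi Vi integral_pderiv_eq_0[OF V] by (simp add: Bochner_Integration.integral_sum)
  have out: "A x = 0" if "x \<notin> D" for x
  proof -
    have "x \<notin> supp \<xi>" using that \<xi> by (auto simp: test_functions_iff)
    then have "\<xi> x = 0" "grad \<xi> x = 0" by (simp_all add: not_in_supp grad_def pderiv_eq_0 vec_eq_iff)
    then show ?thesis by (simp add: A_def)
  qed
  have Gsq: "G\<^sup>2 \<le> (\<integral>\<^sup>+x. ennreal (A x) \<partial>lebesgue_on D)"
  proof -
    have "G\<^sup>2 \<le> (\<integral>\<^sup>+x. ennreal ((norm (grad w x))\<^sup>2) \<partial>lebesgue)"
      unfolding G_def Lnorm_2_sq using D by (auto simp: nn_integral_restrict_space indicator_def intro!: nn_integral_mono)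
    also have "\<dots> = ennreal (LINT x|lebesgue. A x)"
      using gwi by (subst nn_integral_eq_integral) (auto simp: IA)
    \<comment> \<open>\<open>A\<close> may change sign, and \<open>ennreal\<close> keeps only its
      positive part; hence an inequality.\<close>
    also have "\<dots> \<le> (\<integral>\<^sup>+x. ennreal (A x) \<partial>lebesgue)" by (rule integral_le_nn_integral[OF Ai])
    also have "\<dots> = (\<integral>\<^sup>+x. ennreal (A x) \<partial>lebesgue_on D)"
      using D out by (auto simp: nn_integral_restrict_space indicator_def intro!: nn_integral_cong)
    finally show ?thesis .
  qed
  also have "\<dots> \<le> (\<integral>\<^sup>+x. ennreal ((norm (norm (grad \<xi> x) * U x))\<^sup>2) + (ennreal (norm (w x * (\<xi> x * F x))) + ennreal (norm (q x * w x * w x))) \<partial>lebesgue_on D)"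
  proof (rule nn_integral_mono)
    fix x
    have "A x = (norm (grad \<xi> x) * U x)\<^sup>2 - w x * (\<xi> x * F x) + q x * w x * w x"
      unfolding A_def F_def w_def by (simp add: algebra_simps power2_eq_square)
    also have "\<dots> \<le> (norm (norm (grad \<xi> x) * U x))\<^sup>2 + (norm (w x * (\<xi> x * F x)) + norm (q x * w x * w x))"
      unfolding real_norm_def power2_abs by linarith
    finally show "ennreal (A x) \<le> ennreal ((norm (norm (grad \<xi> x) * U x))\<^sup>2) + (ennreal (norm (w x * (\<xi> x * F x))) + ennreal (norm (q x * w x * w x)))"
      by (simp add: ennreal_plus[symmetric] ennreal_leI del: ennreal_plus)
  qed
  also have "\<dots> = N\<^sup>2 + (Lnorm 1 D (\<lambda>x. w x * (\<xi> x * F x)) + Lnorm 1 D (\<lambda>x. q x * w x * w x))"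
    unfolding N_def Lnorm_2_sq Lnorm_1 by (simp add: nn_integral_add)
  also have "\<dots> \<le> N\<^sup>2 + ((ennreal \<sigma> * G) * \<Phi> + (ennreal \<theta> * (ennreal \<sigma> * G)) * (ennreal \<sigma> * G))"
  proof (intro add_mono order_refl)
    have sw': "Lnorm ?p' D w \<le> ennreal \<sigma> * G" unfolding G_def by (rule sob[OF w])
    have "Lnorm 1 D (\<lambda>x. w x * (\<xi> x * F x)) \<le> Lnorm ?p' D w * \<Phi>"
      unfolding \<Phi>_def using p crit_exponents(8)[OF n] D by (intro Lnorm_Holder) auto
    also have "\<dots> \<le> (ennreal \<sigma> * G) * \<Phi>" by (intro mult_right_mono sw') simp
    finally show "Lnorm 1 D (\<lambda>x. w x * (\<xi> x * F x)) \<le> (ennreal \<sigma> * G) * \<Phi>" .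
    have "Lnorm 1 D (\<lambda>x. q x * w x * w x) \<le> Lnorm ?p D (\<lambda>x. q x * w x) * Lnorm ?p' D w"
      using p crit_exponents(8)[OF n] D by (intro Lnorm_Holder) auto
    also have "\<dots> \<le> (Lnorm (real CARD('n) / 2) D q * Lnorm ?p' D w) * Lnorm ?p' D w"
      using p crit_exponents(5)[OF n] D by (intro mult_right_mono Lnorm_Holder) auto
    also have "\<dots> \<le> (ennreal \<theta> * (ennreal \<sigma> * G)) * (ennreal \<sigma> * G)"
      by (intro mult_mono sw' q(2)) auto
    finally show "Lnorm 1 D (\<lambda>x. q x * w x * w x) \<le> (ennreal \<theta> * (ennreal \<sigma> * G)) * (ennreal \<sigma> * G)" .
  qed
  finally have main: "G\<^sup>2 \<le> N\<^sup>2 + ((ennreal \<sigma> * \<Phi>) * G + ennreal (\<theta> * \<sigma>\<^sup>2) * G\<^sup>2)"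
    using \<sigma> by (simp add: ennreal_mult power2_eq_square mult_ac)
  have "integral\<^sup>N lebesgue (\<lambda>x. ennreal ((norm (grad w x))\<^sup>2)) < \<infinity>"
    using gwi by (subst nn_integral_eq_integral) auto
  moreover have "G\<^sup>2 \<le> (\<integral>\<^sup>+x. ennreal ((norm (grad w x))\<^sup>2) \<partial>lebesgue)"
    unfolding G_def Lnorm_2_sq using D by (auto simp: nn_integral_restrict_space indicator_def intro!: nn_integral_mono)
  ultimately have "G\<^sup>2 < \<infinity>" by simp
  \<comment> \<open>\<open>G\<close> has to be finite before its square can be absorbed; this holds
    because \<open>w\<close> is a test function.\<close>
  then obtain g where g: "G = ennreal g" "0 \<le> g" by (cases G) (auto simp: power2_eq_square ennreal_mult_top)
  show ?thesis
  proof (cases "N = top \<or> ennreal \<sigma> * \<Phi> = top")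
    case True
    have "2 * N + 2 * (ennreal \<sigma> * \<Phi>) = top" using True by (auto simp: ennreal_mult_eq_top_iff)
    then show ?thesis unfolding N_def \<Phi>_def F_def by (simp only: top_greatest)
  next
    case False
    then obtain \<nu> s where ns: "N = ennreal \<nu>" "0 \<le> \<nu>" "ennreal \<sigma> * \<Phi> = ennreal s" "0 \<le> s"
      by (cases N; cases "ennreal \<sigma> * \<Phi>") auto
    have "ennreal (g\<^sup>2) \<le> ennreal (\<nu>\<^sup>2 + (s * g + \<theta> * \<sigma>\<^sup>2 * g\<^sup>2))"
      using main g ns \<sigma> by (simp add: ennreal_power[symmetric] ennreal_mult)
    then have "g\<^sup>2 \<le> \<nu>\<^sup>2 + (s * g + \<theta> * \<sigma>\<^sup>2 * g\<^sup>2)"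
      using g ns \<sigma> by (subst (asm) ennreal_le_iff) auto
    then have "g \<le> 2 * \<nu> + 2 * s" using g ns \<sigma> by (intro quadratic_absorb[of g \<nu> s "\<theta> * \<sigma>\<^sup>2"]) auto
    then have "ennreal g \<le> ennreal (2 * \<nu> + 2 * s)" by (rule ennreal_leI)
    also have "\<dots> = 2 * N + 2 * (ennreal \<sigma> * \<Phi>)" using ns by (simp add: ennreal_mult)
    finally show ?thesis using g unfolding G_def N_def \<Phi>_def F_def w_def by simp
  qed
qed

section \<open>Dilated cut-offs\<close>

definition dil :: "(real^'n \<Rightarrow> real) \<Rightarrow> real^'n \<Rightarrow> real \<Rightarrow> real^'n \<Rightarrow> real" where
  "dil f a r y = f ((y - a) /\<^sub>R r)"

lemma dil_affine: "dil f a r = (\<lambda>y. f (- (inverse r *\<^sub>R a) + inverse r *\<^sub>R y))"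
  by (simp add: dil_def fun_eq_iff algebra_simps)

lemma test_functions_dil:
  fixes f :: "real^'n \<Rightarrow> real"
  assumes "f \<in> test_functions (ball 0 1)" "r > 0"
  shows "dil f a r \<in> test_functions (ball a r)"
  unfolding dil_affine
proof (rule test_functions_affine[OF assms(1)])
  fix y assume "- (inverse r *\<^sub>R a) + inverse r *\<^sub>R y \<in> ball 0 1"
  moreover have "- (inverse r *\<^sub>R a) + inverse r *\<^sub>R y = inverse r *\<^sub>R (y - a)" by (simp add: scaleR_diff_right)
  ultimately have "norm (inverse r *\<^sub>R (y - a)) < 1" by simp
  then have "norm (y - a) / r < 1" using assms(2) by (simp add: divide_inverse mult.commute)
  then show "y \<in> ball a r" using assms(2) by (simp add: dist_norm norm_minus_commute)
qed (use assms(2) in simp)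

lemma pderiv_dil: "smooth f \<Longrightarrow> pderiv_at i (dil f a r) y = inverse r * pderiv_at i f ((y - a) /\<^sub>R r)"
  unfolding dil_affine by (subst pderiv_affine, assumption) (simp add: scaleR_diff_right)

lemma lap_dil: "smooth f \<Longrightarrow> lap (dil f a r) y = (inverse r)\<^sup>2 * lap f ((y - a) /\<^sub>R r)"
  unfolding dil_affine by (subst lap_affine, assumption) (simp add: scaleR_diff_right)

lemma norm_grad_dil: "smooth f \<Longrightarrow> r > 0 \<Longrightarrow> norm (grad (dil f a r) y) = norm (grad f ((y - a) /\<^sub>R r)) / r"
proof -
  assume f: "smooth f" and r: "r > 0"
  have "grad (dil f a r) y = inverse r *\<^sub>R grad f ((y - a) /\<^sub>R r)"
    by (simp add: grad_def pderiv_dil[OF f] vec_eq_iff)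
  then show ?thesis using r by (simp add: divide_inverse mult.commute)
qed

text \<open>These are the requirements of the theorem on \<phi>, imposed on the auxiliary
  \<open>f\<close> as well. The cut-off of the theorem around x0 is
  \<open>dil \<phi> x0 d\<close>.\<close>

definition is_bump :: "(real^'n \<Rightarrow> real) \<Rightarrow> bool" where
  "is_bump f \<longleftrightarrow> f \<in> test_functions (ball 0 1) \<and> (\<forall>x\<in>ball 0 (1/2). f x = 1) \<and> (\<forall>x. 0 \<le> f x \<and> f x \<le> 1)"

lemma is_bump_dil:
  assumes "is_bump f" "r > 0"
  shows "dil f a r \<in> test_functions (ball a r)" "smooth (dil f a r)" "0 \<le> dil f a r y" "dil f a r y \<le> 1"
    "dist a y < r / 2 \<Longrightarrow> dil f a r y = 1" "dist a y < r / 2 \<Longrightarrow> pderiv_at i (dil f a r) y = 0" "dist a y < r / 2 \<Longrightarrow> lap (dil f a r) y = 0"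
    "dist a y \<ge> r \<Longrightarrow> y \<notin> supp (dil f a r)"
proof -
  show T: "dil f a r \<in> test_functions (ball a r)" using assms by (simp add: is_bump_def test_functions_dil)
  show "smooth (dil f a r)" using T test_functions_smooth by blast
  show "0 \<le> dil f a r y" "dil f a r y \<le> 1" using assms by (auto simp: is_bump_def dil_def)
  show "y \<notin> supp (dil f a r)" if "dist a y \<ge> r" using T that by (auto simp: test_functions_iff)
  have one: "dil f a r y = 1" if "dist a y < r / 2" for y
  proof -
    have "norm ((y - a) /\<^sub>R r) = dist a y / r" using assms(2) by (simp add: dist_norm norm_minus_commute divide_inverse mult.commute)
    also have "\<dots> < 1/2" using that assms(2) by (simp add: pos_divide_less_eq)
    finally show ?thesis using assms(1) by (simp add: is_bump_def dil_def)
  qed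
  then show "dist a y < r / 2 \<Longrightarrow> dil f a r y = 1" .
  show "pderiv_at i (dil f a r) y = 0" if "dist a y < r / 2"
    using pderiv_local[of "ball a (r/2)" y "dil f a r" "\<lambda>x. 1" i] one that by (simp add: pderiv_const)
  show "lap (dil f a r) y = 0" if "dist a y < r / 2"
    using lap_local[of "ball a (r/2)" y "dil f a r" "\<lambda>x. 1"] one that by (simp add: lap_def pderiv_const)
qed

subsection \<open>Carleman estimate for smooth functions\<close>

text \<open>The factor r gained here compensates one factor 1 / r from the gradient of a cut-off at
  scale r.\<close>

lemma Lnorm_one_ball:
  assumes "CARD('n) \<ge> 1" "0 < r"
  shows "Lnorm (real CARD('n)) (ball (a::real^'n) r) (\<lambda>x. 1::real) = ennreal r * Lnorm (real CARD('n)) (ball (0::real^'n) 1) (\<lambda>x. 1::real)"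
  using Lnorm_affine(1)[of "real CARD('n)" r "\<lambda>x. 1" a] assms by simp

lemma abs_sum_pderiv_le_grad: "\<bar>\<Sum>i\<in>UNIV. pderiv_at i f x * pderiv_at i g x\<bar> \<le> norm (grad f x) * norm (grad g x)"
  using Cauchy_Schwarz_ineq2[of "grad f x" "grad g x"] by (simp add: grad_def inner_vec_def)

text \<open>A bump of radius r is 1 up to r / 2. So the factor of radius 3 s is 1 up to 3/2 s, and
  the bump of radius 3/4 s has vanished from there on: \<xi> is 1 on the whole annulus where the
  cut-off of radius 3/2 s may vary, at the price of living on the larger shell from 3/8 s to 3
  s.\<close>

lemma cutoff_annulus:
  fixes f :: "real^'n \<Rightarrow> real" and a :: "real^'n"
  assumes f: "is_bump f" and b: "\<And>x. norm (grad f x) \<le> b" and s: "0 < s" "3 * s < d"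
  defines "\<xi> \<equiv> (\<lambda>y. dil f a (3 * s) y * (1 - dil f a (3/4 * s) y))"
  shows "\<xi> \<in> test_functions (ball a d)"
    "\<And>y. \<bar>\<xi> y\<bar> \<le> 1" "\<And>y. dist a y < 3/8 * s \<or> dist a y \<ge> 3 * s \<Longrightarrow> \<xi> y = 0"
    "\<And>y. norm (grad \<xi> y) \<le> 2 * b / s" "\<And>y. dist a y \<ge> 3 * s \<Longrightarrow> norm (grad \<xi> y) = 0"
    "\<And>y. 3/4 * s \<le> dist a y \<Longrightarrow> dist a y < 3/2 * s \<Longrightarrow> \<xi> y = 1"
    "\<And>y i. 3/4 * s \<le> dist a y \<Longrightarrow> dist a y < 3/2 * s \<Longrightarrow> pderiv_at i \<xi> y = 0"
proof -
  let ?g = "dil f a (3 * s)" and ?k = "dil f a (3/4 * s)"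
  have s3: "3 * s > 0" "3/4 * s > 0" using s by auto
  note g = is_bump_dil[OF f s3(1), of a] and k = is_bump_dil[OF f s3(2), of a]
  have b0: "b \<ge> 0" using b[of 0] norm_ge_zero order_trans by blast
  have sf: "smooth f" using f test_functions_smooth by (auto simp: is_bump_def)
  have s1k: "smooth (\<lambda>y. 1 - ?k y)" by (intro smooth_diff smooth_const k)
  have "\<xi> \<in> test_functions (ball a (3 * s))" unfolding \<xi>_def by (intro test_functions_mult g s1k)
  then show T: "\<xi> \<in> test_functions (ball a d)" using s by (elim test_functions_mono[rotated]) auto
  show "\<bar>\<xi> y\<bar> \<le> 1" for y
    unfolding \<xi>_def abs_mult using g(3,4)[of y] k(3,4)[of y] by (intro mult_le_one) auto
  show "\<xi> y = 0" if "dist a y < 3/8 * s \<or> dist a y \<ge> 3 * s" for y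
    unfolding \<xi>_def using that k(5)[of y] not_in_supp[OF g(8)[of y]] by auto
  have pd: "pderiv_at i \<xi> y = pderiv_at i ?g y * (1 - ?k y) - ?g y * pderiv_at i ?k y" for i y
    unfolding \<xi>_def using pderiv_mult[OF g(2) s1k, of i] pderiv_diff[OF smooth_const k(2), of i 1]
    by (simp add: pderiv_const)
  have gr: "grad \<xi> y = (1 - ?k y) *\<^sub>R grad ?g y - ?g y *\<^sub>R grad ?k y" for y
    by (simp add: grad_def vec_eq_iff pd)
  show "norm (grad \<xi> y) \<le> 2 * b / s" for y
  proof -
    have "norm (grad \<xi> y) \<le> \<bar>1 - ?k y\<bar> * norm (grad ?g y) + \<bar>?g y\<bar> * norm (grad ?k y)"
      unfolding gr by (rule order_trans[OF norm_triangle_ineq4]) simp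
    also have "\<dots> \<le> 1 * norm (grad ?g y) + 1 * norm (grad ?k y)"
      using g(3,4)[of y] k(3,4)[of y] by (intro add_mono mult_right_mono) auto
    also have "\<dots> \<le> b / (3 * s) + b / (3/4 * s)"
      unfolding mult_1_left norm_grad_dil[OF sf s3(1)] norm_grad_dil[OF sf s3(2)]
      using b s3 by (intro add_mono divide_right_mono) (auto intro: less_imp_le)
    \<comment> \<open>This is 1/3 + 4/3 \<le> 2.\<close>
    also have "\<dots> \<le> 2 * b / s" using s b0 by (simp add: field_simps)
    finally show ?thesis .
  qed
  show "norm (grad \<xi> y) = 0" if "dist a y \<ge> 3 * s" for y
    using pderiv_eq_0[OF g(8)[OF that]] not_in_supp[OF g(8)[OF that]] unfolding gr by (simp add: grad_def vec_eq_iff)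
  fix y assume y: "3/4 * s \<le> dist a y" "dist a y < 3/2 * s"
  have k0: "?k y = 0" "pderiv_at i ?k y = 0" for i
    using k(8)[OF y(1)] not_in_supp pderiv_eq_0 by blast+
  have g1: "?g y = 1" "pderiv_at i ?g y = 0" for i using g(5)[of y] g(6)[of y] y by auto
  show "\<xi> y = 1" unfolding \<xi>_def k0 g1 by simp
  show "pderiv_at i \<xi> y = 0" for i unfolding pd k0 g1 by simp
qed

text \<open>The nested factors are 2, 4, 8 and 8.\<close>

lemma Lnorm_add4_le:
  fixes f1 f2 f3 f4 :: "real^'n \<Rightarrow> real"
  assumes "1 \<le> p" "S \<in> sets lebesgue" and [measurable]: "f1 \<in> borel_measurable (lebesgue_on S)" "f2 \<in> borel_measurable (lebesgue_on S)"
    "f3 \<in> borel_measurable (lebesgue_on S)" "f4 \<in> borel_measurable (lebesgue_on S)"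
  shows "Lnorm p S (\<lambda>x. f1 x + (f2 x + (f3 x + f4 x))) \<le> 8 * (Lnorm p S f1 + (Lnorm p S f2 + (Lnorm p S f3 + Lnorm p S f4)))"
proof -
  have "Lnorm p S (\<lambda>x. f1 x + (f2 x + (f3 x + f4 x))) \<le> 2 * (Lnorm p S f1 + Lnorm p S (\<lambda>x. f2 x + (f3 x + f4 x)))"
    using assms(1,2) by (intro Lnorm_add_le) auto
  also have "\<dots> \<le> 2 * (Lnorm p S f1 + 2 * (Lnorm p S f2 + Lnorm p S (\<lambda>x. f3 x + f4 x)))"
    using assms(1,2) by (intro mult_left_mono add_mono order_refl Lnorm_add_le) auto
  also have "\<dots> \<le> 2 * (Lnorm p S f1 + 2 * (Lnorm p S f2 + 2 * (Lnorm p S f3 + Lnorm p S f4)))"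
    using assms(1,2) by (intro mult_left_mono add_mono order_refl Lnorm_add_le) auto
  also have "\<dots> = 2 * Lnorm p S f1 + (4 * Lnorm p S f2 + (8 * Lnorm p S f3 + 8 * Lnorm p S f4))"
    by (simp add: distrib_left mult.assoc[symmetric])
  also have "\<dots> \<le> 8 * Lnorm p S f1 + (8 * Lnorm p S f2 + (8 * Lnorm p S f3 + 8 * Lnorm p S f4))"
    by (intro add_mono mult_right_mono order_refl) auto
  finally show ?thesis by (simp add: distrib_left)
qed

text \<open>W vanishes up to 3/4 s, equals U from 3/2 s to d / 2 and \<phi> U beyond; only the
  annulus in between carries a commutator. The weight is bounded by its value at 3/4 s inside ball a
  (d/2) and at d / 2 outside. The condition 6 s < d keeps the Caccioppoli shell inside ball a (d/2),
  so its right-hand side is part of the first term, whose domain therefore starts at 3/8 s.\<close>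

lemma weighted_cutoff_estimate:
  fixes U q f \<phi> :: "real^'n \<Rightarrow> real" and a :: "real^'n"
  assumes n: "CARD('n) \<ge> 3" and U: "smooth U" and f: "is_bump f" and \<phi>: "is_bump \<phi>"
    and b: "\<And>x. norm (grad f x) \<le> b" "\<And>x. \<bar>lap f x\<bar> \<le> b"
    and M: "Lnorm (real CARD('n)) (ball (0::real^'n) 1) (\<lambda>x. 1::real) \<le> ennreal M" "0 \<le> M"
    and s: "0 < s" "6 * s < d" and \<tau>: "0 < \<tau>"
    and sob: "\<And>\<psi>. \<psi> \<in> test_functions (ball a d) \<Longrightarrow> Lnorm (crit_p' CARD('n)) (ball a d) \<psi> \<le> ennreal \<sigma> * Lnorm 2 (ball a d) (grad \<psi>)"
    and \<sigma>: "0 \<le> \<sigma>" "0 \<le> \<theta>" "\<theta> * \<sigma>\<^sup>2 \<le> 1/2"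
    and q: "q \<in> borel_measurable (lebesgue_on (ball a d))" "Lnorm (real CARD('n) / 2) (ball a d) q \<le> ennreal \<theta>"
  defines "W \<equiv> (\<lambda>y. dil \<phi> a d y * U y - dil f a (3/2 * s) y * U y)"
  shows "Lnorm (crit_p CARD('n)) (ball a d) (\<lambda>y. norm (y - a) powr (-\<tau>) * (lap W y + q y * W y)) \<le>
    ennreal (8 * (1 + 4 * b * M * \<sigma> + 8 * b\<^sup>2 * M + b * M)) *
     (ennreal ((3/4 * s) powr (-\<tau>)) * Lnorm (crit_p CARD('n)) (ball a (d/2) - ball a (3/8 * s)) (\<lambda>y. lap U y + q y * U y)
      + ennreal ((d/2) powr (-\<tau>)) * Lnorm (crit_p CARD('n)) (ball a d - ball a (d/2)) (\<lambda>y. lap (\<lambda>y. dil \<phi> a d y * U y) y + q y * (dil \<phi> a d y * U y))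
      + ennreal ((3/4 * s) powr (-\<tau>) / s) * Lnorm 2 (ball a (3 * s)) U)"
proof -
  let ?p = "crit_p CARD('n)" and ?D = "ball a d" and ?n = "real CARD('n)"
  define S1 where "S1 = ball a (d/2) - ball a (3/8 * s)"
  define S2 where "S2 = ball a d - ball a (d/2)"
  define A where "A = ball a (3/2 * s) - ball a (3/4 * s)"
  have sets: "S1 \<in> sets lebesgue" "S2 \<in> sets lebesgue" "A \<in> sets lebesgue" "?D \<in> sets lebesgue"
    by (auto simp: S1_def S2_def A_def)
  have p: "?p \<ge> 1" "?p > 0" using crit_exponents[OF n] by auto
  have n0: "?n > 0" "CARD('n) \<ge> 1" using n by auto
  have d: "d > 0" using s by simp
  have b0: "b \<ge> 0" using b(1)[of 0] norm_ge_zero order_trans by blast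
  have s32: "3/2 * s > 0" using s by simp
  let ?h = "dil f a (3/2 * s)" and ?f = "dil \<phi> a d"
  note h = is_bump_dil[OF f s32, of a] and ff = is_bump_dil[OF \<phi> d, of a]
  have sf: "smooth f" using f test_functions_smooth by (auto simp: is_bump_def)
  define \<xi> where "\<xi> = (\<lambda>y. dil f a (3 * s) y * (1 - dil f a (3/4 * s) y))"
  have s3d: "3 * s < d" using s by simp
  note \<xi> = cutoff_annulus[OF f b(1) s(1) s3d, of a, folded \<xi>_def]
  have \<xi>2: "\<bar>\<xi> y\<bar> \<le> 1" for y using \<xi>(2)[of y] by (simp only: \<xi>_def)
  have \<xi>3: "\<xi> y = 0" if "dist a y < 3/8 * s \<or> dist a y \<ge> 3 * s" for y using \<xi>(3)[OF that] by (simp only: \<xi>_def)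
  have s\<xi>: "smooth \<xi>" using \<xi>(1) test_functions_smooth by blast
  define w where "w = (\<lambda>x. \<xi> x * U x)"
  have sw: "smooth w" unfolding w_def by (rule smooth_mult[OF s\<xi> U])
  define F where "F = (\<lambda>y. lap U y + q y * U y)"
  define E where "E = (\<lambda>y. lap (\<lambda>y. ?f y * U y) y + q y * (?f y * U y))"
  define w1 where "w1 = (3/4 * s) powr (-\<tau>)"
  define w2 where "w2 = (d/2) powr (-\<tau>)"
  have w12: "w1 > 0" "w2 > 0" using s d by (auto simp: w1_def w2_def)
  define L1 where "L1 = Lnorm ?p S1 F"
  define L2 where "L2 = Lnorm ?p S2 E"
  define N3 where "N3 = Lnorm 2 (ball a (3 * s)) U"
  have [measurable]: "U \<in> borel_measurable (lebesgue_on ?D)" "lap U \<in> borel_measurable (lebesgue_on ?D)" "w \<in> borel_measurable (lebesgue_on ?D)"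
      "\<xi> \<in> borel_measurable (lebesgue_on ?D)" "q \<in> borel_measurable (lebesgue_on ?D)" "?f \<in> borel_measurable (lebesgue_on ?D)"
      "lap (\<lambda>y. ?f y * U y) \<in> borel_measurable (lebesgue_on ?D)"
    using q by (auto intro!: smooth_measurable U smooth_lap sw s\<xi> ff smooth_mult)
  have [measurable]: "F \<in> borel_measurable (lebesgue_on ?D)" "E \<in> borel_measurable (lebesgue_on ?D)" unfolding F_def E_def by measurable
  have mgw[measurable]: "(\<lambda>x. norm (grad w x)) \<in> borel_measurable (lebesgue_on ?D)" by (rule grad_measurable[OF sw sets(4)])
  have ind[measurable]: "(indicator X :: real^'n \<Rightarrow> real) \<in> borel_measurable (lebesgue_on ?D)" if "X \<in> sets lebesgue" for X
    using that by (intro measurable_restrict_space1 borel_measurable_indicator)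
  note indS = ind[OF sets(1)] ind[OF sets(2)] ind[OF sets(3)]
  note [measurable] = indS
  \<comment> \<open>Majorants: \<open>T1\<close> for the equation of U inside, \<open>T2\<close> for
    that of \<phi> U outside, \<open>T3\<close> and \<open>T4\<close> for the commutator. Their
    constants are 2 b / (3/2 s) and b / (3/2 s)^2, from the gradient and the Laplacian of the
    dilated bump.\<close>
  define T1 where "T1 y = w1 * (indicator S1 y * \<bar>F y\<bar>)" for y
  define T2 where "T2 y = w2 * (indicator S2 y * \<bar>E y\<bar>)" for y
  define T3 where "T3 y = (w1 * (4 * b / (3 * s))) * (indicator A y * norm (grad w y))" for y
  define T4 where "T4 y = (w1 * (4 * b / (9 * s\<^sup>2))) * (indicator A y * \<bar>U y\<bar>)" for y
  have Tpos: "0 \<le> T1 y" "0 \<le> T2 y" "0 \<le> T3 y" "0 \<le> T4 y" for y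
    using w12 b0 s by (auto simp: T1_def T2_def T3_def T4_def)
  have point: "norm (norm (y - a) powr (-\<tau>) * (lap W y + q y * W y)) \<le> norm (T1 y + (T2 y + (T3 y + T4 y)))" if y: "y \<in> ?D" for y
  proof -
    \<comment> \<open>The commutator of the Laplacian and \<open>?h\<close>, applied to U.\<close>
    define X where "X = 2 * (\<Sum>i\<in>UNIV. pderiv_at i ?h y * pderiv_at i U y) + lap ?h y * U y"
    define Q where "Q = lap W y + q y * W y"
    define \<omega> where "\<omega> = norm (y - a) powr (-\<tau>)"
    have ya: "norm (y - a) = dist a y" by (simp add: dist_norm norm_minus_commute)
    have lW: "lap W y = lap (\<lambda>y. ?f y * U y) y - (?h y * lap U y + X)"
      unfolding W_def X_def
      unfolding lap_diff[OF smooth_mult[OF ff(2) U] smooth_mult[OF h(2) U]] lap_mult[OF h(2) U] by (simp only: add.assoc)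
    have *: "\<omega> * \<bar>Q\<bar> \<le> T1 y + (T2 y + (T3 y + T4 y))"
    proof (cases "dist a y < d / 2")
      case True
      have l: "lap (\<lambda>y. ?f y * U y) y = lap U y"
        by (rule lap_local[of "ball a (d/2)"]) (use True ff(5) in auto)
      have Q: "Q = (1 - ?h y) * F y - X"
        unfolding Q_def lW l F_def using ff(5)[OF True] by (simp add: W_def algebra_simps)
      consider "dist a y < 3/4 * s" | "3/4 * s \<le> dist a y" "dist a y < 3/2 * s" | "3/2 * s \<le> dist a y" by linarith
      then show ?thesis
      proof cases
        case 1
        then have "?h y = 1" "X = 0" using h(5,6,7)[of y] by (auto simp: X_def)
        then show ?thesis using Q Tpos[of y] by simp
      next
        case 2
        have yS: "y \<in> S1" "y \<in> A" using True 2 s by (auto simp: S1_def A_def)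
        have om: "\<omega> \<le> w1" "\<omega> \<ge> 0" unfolding \<omega>_def w1_def ya using 2 s \<tau> by (auto intro!: powr_mono2')
        \<comment> \<open>On the annulus \<xi> is 1 with vanishing derivatives, so the gradient of U
          may be exchanged for that of the test function \<open>w\<close>, to which the Caccioppoli
          estimate applies.\<close>
        have gU: "grad U y = grad w y"
        proof -
          have "\<xi> y = 1" using \<xi>(6)[OF 2] by (simp only: \<xi>_def)
          then show ?thesis unfolding w_def grad_def pderiv_mult[OF s\<xi> U] using \<xi>(7)[OF 2] by simp
        qed
        have "\<bar>X\<bar> \<le> 2 * (norm (grad ?h y) * norm (grad w y)) + \<bar>lap ?h y\<bar> * \<bar>U y\<bar>"
          unfolding X_def gU[symmetric] using abs_sum_pderiv_le_grad[of ?h y U] by (simp add: abs_mult[symmetric])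
        also have "\<dots> \<le> 2 * (b / (3/2 * s) * norm (grad w y)) + b / (3/2 * s)\<^sup>2 * \<bar>U y\<bar>"
        proof (intro add_mono mult_left_mono mult_right_mono)
          show "norm (grad ?h y) \<le> b / (3/2 * s)"
            unfolding norm_grad_dil[OF sf s32] using b(1) s by (intro divide_right_mono) auto
          have "(inverse (3/2 * s))\<^sup>2 * \<bar>lap f ((y - a) /\<^sub>R (3/2 * s))\<bar> \<le> (inverse (3/2 * s))\<^sup>2 * b"
            using b(2) by (intro mult_left_mono) auto
          moreover have "\<bar>lap ?h y\<bar> = (inverse (3/2 * s))\<^sup>2 * \<bar>lap f ((y - a) /\<^sub>R (3/2 * s))\<bar>"
            unfolding lap_dil[OF sf] abs_mult abs_power2 ..
          moreover have "(inverse (3/2 * s))\<^sup>2 * b = b / (3/2 * s)\<^sup>2" by (simp only: divide_inverse power_inverse mult.commute)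
          ultimately show "\<bar>lap ?h y\<bar> \<le> b / (3/2 * s)\<^sup>2" by simp
        qed auto
        also have "\<dots> = (4 * b / (3 * s)) * norm (grad w y) + (4 * b / (9 * s\<^sup>2)) * \<bar>U y\<bar>"
          by (simp add: power2_eq_square field_simps)
        finally have Xb: "\<bar>X\<bar> \<le> (4 * b / (3 * s)) * norm (grad w y) + (4 * b / (9 * s\<^sup>2)) * \<bar>U y\<bar>" .
        have "\<bar>(1 - ?h y) * F y\<bar> \<le> 1 * \<bar>F y\<bar>"
          unfolding abs_mult using h(3,4)[of y] by (intro mult_right_mono) auto
        then have "\<bar>Q\<bar> \<le> \<bar>F y\<bar> + ((4 * b / (3 * s)) * norm (grad w y) + (4 * b / (9 * s\<^sup>2)) * \<bar>U y\<bar>)"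
          unfolding Q using Xb by linarith
        then have "\<omega> * \<bar>Q\<bar> \<le> w1 * (\<bar>F y\<bar> + ((4 * b / (3 * s)) * norm (grad w y) + (4 * b / (9 * s\<^sup>2)) * \<bar>U y\<bar>))"
          using om by (intro mult_mono) auto
        also have "\<dots> = T1 y + (T3 y + T4 y)"
          using yS by (simp add: T1_def T3_def T4_def algebra_simps)
        finally show ?thesis using Tpos[of y] by linarith
      next
        case 3
        have yS: "y \<in> S1" using True 3 s by (auto simp: S1_def)
        have om: "\<omega> \<le> w1" "\<omega> \<ge> 0" unfolding \<omega>_def w1_def ya using 3 s \<tau> by (auto intro!: powr_mono2')
        have "?h y = 0" "X = 0" using not_in_supp[OF h(8)[OF 3]] pderiv_eq_0[OF h(8)[OF 3]] lap_eq_0[OF h(8)[OF 3]] by (auto simp: X_def)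
        then have "\<omega> * \<bar>Q\<bar> \<le> w1 * \<bar>F y\<bar>" unfolding Q using om by (intro mult_mono) auto
        also have "\<dots> = T1 y" using yS by (simp add: T1_def)
        finally show ?thesis using Tpos[of y] by linarith
      qed
    next
      case False
      have yS: "y \<in> S2" using y False by (auto simp: S2_def)
      have om: "\<omega> \<le> w2" "\<omega> \<ge> 0" unfolding \<omega>_def w2_def ya using False d \<tau> by (auto intro!: powr_mono2')
      have "3/2 * s \<le> dist a y" using False s by simp
      note hz = h(8)[OF this]
      have z: "?h y = 0" "X = 0" using not_in_supp[OF hz] pderiv_eq_0[OF hz] lap_eq_0[OF hz] by (auto simp: X_def)
      have "W y = ?f y * U y" unfolding W_def z by simp
      then have "Q = E y" unfolding Q_def lW E_def z by simp
      then have "\<omega> * \<bar>Q\<bar> \<le> w2 * \<bar>E y\<bar>" using om by (auto intro: mult_right_mono)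
      also have "\<dots> = T2 y" using yS by (simp add: T2_def)
      finally show ?thesis using Tpos[of y] by linarith
    qed
    have "norm (\<omega> * Q) \<le> norm (T1 y + (T2 y + (T3 y + T4 y)))"
      using * Tpos[of y] by (simp add: abs_mult \<omega>_def)
    then show ?thesis by (simp add: \<omega>_def Q_def)
  qed
  have mT: "T1 \<in> borel_measurable (lebesgue_on ?D)" "T2 \<in> borel_measurable (lebesgue_on ?D)" "T3 \<in> borel_measurable (lebesgue_on ?D)" "T4 \<in> borel_measurable (lebesgue_on ?D)"
    unfolding T1_def T2_def T3_def T4_def by measurable
  have LT: "Lnorm ?p ?D (\<lambda>y. norm (y - a) powr (-\<tau>) * (lap W y + q y * W y)) \<le> 8 * (Lnorm ?p ?D T1 + (Lnorm ?p ?D T2 + (Lnorm ?p ?D T3 + Lnorm ?p ?D T4)))"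
    by (rule order_trans[OF Lnorm_mono[OF p(2) sets(4) point] Lnorm_add4_le[OF p(1) sets(4) mT]])
  have indle: "Lnorm r ?D (\<lambda>y. indicator X y * \<bar>g y\<bar>) \<le> Lnorm r Y g" if "X \<in> sets lebesgue" "Y \<in> sets lebesgue" "X \<subseteq> Y" "r > 0" for X Y r and g :: "real^'n \<Rightarrow> real"
    by (rule Lnorm_subset_mono) (use that in \<open>auto simp: indicator_def\<close>)
  have L1b: "Lnorm ?p ?D T1 \<le> ennreal w1 * L1"
  proof -
    have "Lnorm ?p ?D T1 = ennreal \<bar>w1\<bar> * Lnorm ?p ?D (\<lambda>y. indicator S1 y * \<bar>F y\<bar>)"
      unfolding T1_def by (rule Lnorm_cmult[OF p(2) sets(4)]) measurable
    also have "\<dots> \<le> ennreal w1 * L1" unfolding L1_def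
      using w12 p indle[OF sets(1) sets(1) order_refl p(2)] by (intro mult_mono) auto
    finally show ?thesis .
  qed
  have L2b: "Lnorm ?p ?D T2 \<le> ennreal w2 * L2"
  proof -
    have "Lnorm ?p ?D T2 = ennreal \<bar>w2\<bar> * Lnorm ?p ?D (\<lambda>y. indicator S2 y * \<bar>E y\<bar>)"
      unfolding T2_def by (rule Lnorm_cmult[OF p(2) sets(4)]) measurable
    also have "\<dots> \<le> ennreal w2 * L2" unfolding L2_def
      using w12 p indle[OF sets(2) sets(2) order_refl p(2)] by (intro mult_mono) auto
    finally show ?thesis .
  qed
  have Ab: "Lnorm ?n ?D (indicator A :: real^'n \<Rightarrow> real) \<le> ennreal (3/2 * s * M)"
  proof -
    have "Lnorm ?n ?D (indicator A :: real^'n \<Rightarrow> real) \<le> Lnorm ?n (ball a (3/2 * s)) (\<lambda>x. 1::real)"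
      using n0 by (intro Lnorm_subset_mono) (auto simp: A_def indicator_def)
    also have "\<dots> = ennreal (3/2 * s) * Lnorm ?n (ball (0::real^'n) 1) (\<lambda>x. 1::real)"
      by (rule Lnorm_one_ball[OF n0(2) s32])
    also have "\<dots> \<le> ennreal (3/2 * s) * ennreal M" by (intro mult_left_mono M) simp
    also have "\<dots> = ennreal (3/2 * s * M)" using s M by (intro ennreal_mult[symmetric]) auto
    finally show ?thesis .
  qed
  \<comment> \<open>Passing from L^p to L^2 on the annulus gains its L^n norm, which is of order
    s.\<close>
  have AH: "Lnorm ?p ?D (\<lambda>y. indicator A y * g y) \<le> ennreal (3/2 * s * M) * Lnorm 2 ?D (\<lambda>y. indicator A y * g y)"
    if [measurable]: "g \<in> borel_measurable (lebesgue_on ?D)" for g :: "real^'n \<Rightarrow> real"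
  proof -
    have "(\<lambda>y. indicator A y * g y) = (\<lambda>y. indicator A y * (indicator A y * g y))"
      by (auto simp: fun_eq_iff indicator_def)
    then have "Lnorm ?p ?D (\<lambda>y. indicator A y * g y) = Lnorm ?p ?D (\<lambda>y. indicator A y * (indicator A y * g y))" by simp
    also have "\<dots> \<le> Lnorm ?n ?D (indicator A :: real^'n \<Rightarrow> real) * Lnorm 2 ?D (\<lambda>y. indicator A y * g y)"
      using p n0 crit_exponents(6)[OF n] sets by (intro Lnorm_Holder borel_measurable_times indS that) auto
    also have "\<dots> \<le> ennreal (3/2 * s * M) * Lnorm 2 ?D (\<lambda>y. indicator A y * g y)"
      by (intro mult_right_mono Ab) simp
    finally show ?thesis .
  qed
  have L3b: "Lnorm ?p ?D T3 \<le> ennreal (w1 * (4 * b / (3 * s))) * (ennreal (3/2 * s * M) * Lnorm 2 ?D (grad w))"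
  proof -
    have "Lnorm ?p ?D T3 = ennreal \<bar>w1 * (4 * b / (3 * s))\<bar> * Lnorm ?p ?D (\<lambda>y. indicator A y * norm (grad w y))"
      unfolding T3_def by (rule Lnorm_cmult[OF p(2) sets(4)]) measurable
    also have "\<dots> \<le> ennreal (w1 * (4 * b / (3 * s))) * (ennreal (3/2 * s * M) * Lnorm 2 ?D (\<lambda>y. indicator A y * norm (grad w y)))"
      using w12 b0 s by (intro mult_mono AH) auto
    also have "\<dots> \<le> ennreal (w1 * (4 * b / (3 * s))) * (ennreal (3/2 * s * M) * Lnorm 2 ?D (grad w))"
      by (intro mult_left_mono Lnorm_mono) (auto simp: indicator_def)
    finally show ?thesis .
  qed
  have L4b: "Lnorm ?p ?D T4 \<le> ennreal (w1 * (4 * b / (9 * s\<^sup>2))) * (ennreal (3/2 * s * M) * N3)"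
  proof -
    have "Lnorm ?p ?D T4 = ennreal \<bar>w1 * (4 * b / (9 * s\<^sup>2))\<bar> * Lnorm ?p ?D (\<lambda>y. indicator A y * \<bar>U y\<bar>)"
      unfolding T4_def by (rule Lnorm_cmult[OF p(2) sets(4)]) measurable
    also have "\<dots> \<le> ennreal (w1 * (4 * b / (9 * s\<^sup>2))) * (ennreal (3/2 * s * M) * Lnorm 2 ?D (\<lambda>y. indicator A y * \<bar>U y\<bar>))"
      using w12 b0 s by (intro mult_mono AH) auto
    also have "\<dots> \<le> ennreal (w1 * (4 * b / (9 * s\<^sup>2))) * (ennreal (3/2 * s * M) * N3)"
      unfolding N3_def using s by (intro mult_left_mono indle sets) (auto simp: A_def)
    finally show ?thesis .
  qed
  have Gb: "Lnorm 2 ?D (grad w) \<le> 2 * (ennreal (2 * b / s) * N3) + 2 * (ennreal \<sigma> * L1)"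
  proof -
    have "Lnorm 2 ?D (grad w) \<le> 2 * Lnorm 2 ?D (\<lambda>x. norm (grad \<xi> x) * U x) + 2 * (ennreal \<sigma> * Lnorm ?p ?D (\<lambda>x. \<xi> x * (lap U x + q x * U x)))"
      unfolding w_def by (rule caccioppoli[OF n U \<xi>(1) sets(4) sob \<sigma> q])
    also have "\<dots> \<le> 2 * (ennreal (2 * b / s) * N3) + 2 * (ennreal \<sigma> * L1)"
    proof (intro add_mono mult_left_mono)
      have "Lnorm 2 ?D (\<lambda>x. norm (grad \<xi> x) * U x) \<le> Lnorm 2 (ball a (3 * s)) (\<lambda>x. (2 * b / s) * U x)"
      proof (rule Lnorm_subset_mono)
        show "norm (grad \<xi> x) * U x = 0" if "x \<notin> ball a (3 * s)" for x using \<xi>(5)[of x] that by simp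
        show "norm (norm (grad \<xi> x) * U x) \<le> norm ((2 * b / s) * U x)" for x
          using \<xi>(4)[of x] b0 s unfolding norm_mult by (intro mult_right_mono) auto
      qed auto
      also have "\<dots> = ennreal \<bar>2 * b / s\<bar> * N3"
        unfolding N3_def by (rule Lnorm_cmult) (auto intro: smooth_measurable[OF U])
      finally show "Lnorm 2 ?D (\<lambda>x. norm (grad \<xi> x) * U x) \<le> ennreal (2 * b / s) * N3" using b0 s by simp
      show "Lnorm ?p ?D (\<lambda>x. \<xi> x * (lap U x + q x * U x)) \<le> L1"
        unfolding L1_def
      proof (rule Lnorm_subset_mono[OF p(2) sets(4) sets(1)])
        show "\<xi> x * (lap U x + q x * U x) = 0" if "x \<in> ?D" "x \<notin> S1" for x
        proof -
          have "dist a x < 3/8 * s \<or> dist a x \<ge> 3 * s" using that s by (auto simp: S1_def)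
          then show ?thesis using \<xi>3[of x] by simp
        qed
        show "norm (\<xi> x * (lap U x + q x * U x)) \<le> norm (F x)" for x
          unfolding F_def norm_mult using \<xi>2[of x] mult_right_mono[of "\<bar>\<xi> x\<bar>" 1 "\<bar>lap U x + q x * U x\<bar>"] by simp
      qed
    qed auto
    finally show ?thesis .
  qed
  \<comment> \<open>The 8 is that of \<open>Lnorm_add4_le\<close>. In the gradient term, 4 b / (3 s)
    times 3/2 s M is 2 b M, which multiplies the Caccioppoli bound with its constants 4 b / s and 2
    \<sigma>; the Laplacian term contributes 2/3 b M, rounded up to b M.\<close>
  define K where "K = 8 * (1 + 4 * b * M * \<sigma> + 8 * b\<^sup>2 * M + b * M)"
  have K: "K > 0" using b0 M \<sigma> by (auto simp: K_def intro!: add_pos_nonneg)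
  have "Lnorm ?p ?D (\<lambda>y. norm (y - a) powr (-\<tau>) * (lap W y + q y * W y)) \<le> ennreal K * (ennreal w1 * L1 + ennreal w2 * L2 + ennreal (w1 / s) * N3)"
  proof (cases "L1 = top \<or> L2 = top \<or> N3 = top")
    case True
    then have "ennreal K * (ennreal w1 * L1 + ennreal w2 * L2 + ennreal (w1 / s) * N3) = top"
      using K w12 s by (auto simp: ennreal_mult_eq_top_iff ennreal_mult_top)
    then show ?thesis by simp
  next
    case False
    then obtain l1 l2 n3 where ln: "L1 = ennreal l1" "0 \<le> l1" "L2 = ennreal l2" "0 \<le> l2" "N3 = ennreal n3" "0 \<le> n3"
      by (cases L1; cases L2; cases N3) auto
    have g: "Lnorm 2 ?D (grad w) \<le> ennreal (4 * b / s * n3 + 2 * \<sigma> * l1)"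
    proof -
      define c where "c = 2 * b / s"
      have c0: "0 \<le> c" using b0 s by (simp add: c_def)
      have "ennreal (2 * (c * n3)) = 2 * (ennreal c * ennreal n3)" "ennreal (2 * (\<sigma> * l1)) = 2 * (ennreal \<sigma> * ennreal l1)"
        using c0 \<sigma> by (simp_all add: ennreal_mult')
      then have "2 * (ennreal c * N3) + 2 * (ennreal \<sigma> * L1) = ennreal (2 * (c * n3) + 2 * (\<sigma> * l1))"
        unfolding ln using ln c0 \<sigma> by (subst ennreal_plus) auto
      then have "Lnorm 2 ?D (grad w) \<le> ennreal (2 * (c * n3) + 2 * (\<sigma> * l1))" using Gb unfolding c_def by simp
      also have "2 * (c * n3) + 2 * (\<sigma> * l1) = 4 * b / s * n3 + 2 * \<sigma> * l1" by (simp add: c_def)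
      finally show ?thesis .
    qed
    have l3: "Lnorm ?p ?D T3 \<le> ennreal (w1 * (4 * b / (3 * s)) * (3/2 * s * M * (4 * b / s * n3 + 2 * \<sigma> * l1)))"
    proof -
      have "Lnorm ?p ?D T3 \<le> ennreal (w1 * (4 * b / (3 * s))) * (ennreal (3/2 * s * M) * ennreal (4 * b / s * n3 + 2 * \<sigma> * l1))"
        by (rule order_trans[OF L3b]) (intro mult_left_mono g; simp)
      also have "\<dots> = ennreal (w1 * (4 * b / (3 * s)) * (3/2 * s * M * (4 * b / s * n3 + 2 * \<sigma> * l1)))"
        using ln b0 s \<sigma> M w12 by (subst ennreal_mult[symmetric], simp, simp, subst ennreal_mult[symmetric]) auto
      finally show ?thesis .
    qed
    have l4: "Lnorm ?p ?D T4 \<le> ennreal (w1 * (4 * b / (9 * s\<^sup>2)) * (3/2 * s * M * n3))"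
    proof -
      have "ennreal (w1 * (4 * b / (9 * s\<^sup>2))) * (ennreal (3/2 * s * M) * N3) = ennreal (w1 * (4 * b / (9 * s\<^sup>2)) * (3/2 * s * M * n3))"
        unfolding ln using ln b0 s \<sigma> M w12 by (subst ennreal_mult[symmetric], simp, simp, subst ennreal_mult[symmetric]) auto
      then show ?thesis using L4b by simp
    qed
    have "8 * (Lnorm ?p ?D T1 + (Lnorm ?p ?D T2 + (Lnorm ?p ?D T3 + Lnorm ?p ?D T4))) \<le>
      8 * (ennreal (w1 * l1) + (ennreal (w2 * l2) + (ennreal (w1 * (4 * b / (3 * s)) * (3/2 * s * M * (4 * b / s * n3 + 2 * \<sigma> * l1))) + ennreal (w1 * (4 * b / (9 * s\<^sup>2)) * (3/2 * s * M * n3)))))"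
      using L1b L2b l3 l4 ln w12 by (intro mult_left_mono add_mono) (auto simp: ennreal_mult)
    also have "\<dots> = ennreal (8 * (w1 * l1 + (w2 * l2 + (w1 * (4 * b / (3 * s)) * (3/2 * s * M * (4 * b / s * n3 + 2 * \<sigma> * l1)) + w1 * (4 * b / (9 * s\<^sup>2)) * (3/2 * s * M * n3)))))"
    proof -
      have gen: "8 * (ennreal a1 + (ennreal a2 + (ennreal a3 + ennreal a4))) = ennreal (8 * (a1 + (a2 + (a3 + a4))))"
        if "0 \<le> a1" "0 \<le> a2" "0 \<le> a3" "0 \<le> a4" for a1 a2 a3 a4
        using that by (simp add: ennreal_mult')
      show ?thesis by (rule gen) (use ln b0 s \<sigma> M w12 in auto)
    qed
    also have "\<dots> \<le> ennreal (K * (w1 * l1 + w2 * l2 + w1 / s * n3))"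
    proof (rule ennreal_leI)
      have e3: "w1 * (4 * b / (3 * s)) * (3/2 * s * M * (4 * b / s * n3 + 2 * \<sigma> * l1)) = 8 * b\<^sup>2 * M * (w1 / s * n3) + 4 * b * M * \<sigma> * (w1 * l1)"
        using s by (simp add: field_simps power2_eq_square)
      have e4: "w1 * (4 * b / (9 * s\<^sup>2)) * (3/2 * s * M * n3) = 2/3 * (b * M) * (w1 / s * n3)"
        using s by (simp add: field_simps power2_eq_square)
      define x where "x = w1 * l1"
      define y where "y = w2 * l2"
      define z where "z = w1 / s * n3"
      have xyz: "x \<ge> 0" "y \<ge> 0" "z \<ge> 0" using w12 ln s by (auto simp: x_def y_def z_def)
      define \<alpha> where "\<alpha> = 4 * b * M * \<sigma>"
      define \<beta> where "\<beta> = 8 * b\<^sup>2 * M"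
      define \<gamma> where "\<gamma> = b * M"
      have abc: "\<alpha> \<ge> 0" "\<beta> \<ge> 0" "\<gamma> \<ge> 0" using b0 M \<sigma> by (auto simp: \<alpha>_def \<beta>_def \<gamma>_def)
      have "0 \<le> \<alpha> * y" "0 \<le> \<alpha> * z" "0 \<le> \<beta> * x" "0 \<le> \<beta> * y" "0 \<le> \<gamma> * x" "0 \<le> \<gamma> * y" "0 \<le> \<gamma> * z" using xyz abc by auto
      then have "8 * (x + (y + (\<beta> * z + \<alpha> * x + 2/3 * \<gamma> * z))) \<le> 8 * (1 + \<alpha> + \<beta> + \<gamma>) * (x + y + z)"
        using xyz by (simp add: algebra_simps)
      then show "8 * (w1 * l1 + (w2 * l2 + (w1 * (4 * b / (3 * s)) * (3/2 * s * M * (4 * b / s * n3 + 2 * \<sigma> * l1)) + w1 * (4 * b / (9 * s\<^sup>2)) * (3/2 * s * M * n3))))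
         \<le> K * (w1 * l1 + w2 * l2 + w1 / s * n3)"
        unfolding e3 e4 K_def x_def y_def z_def \<alpha>_def \<beta>_def \<gamma>_def .
    qed
    also have "\<dots> = ennreal K * (ennreal w1 * L1 + ennreal w2 * L2 + ennreal (w1 / s) * N3)"
    proof -
      have "ennreal (w1 * l1 + w2 * l2 + w1 / s * n3) = ennreal w1 * L1 + ennreal w2 * L2 + ennreal (w1 / s) * N3"
      proof -
        have "ennreal (w1 * l1 + w2 * l2 + v * n3) = ennreal w1 * L1 + ennreal w2 * L2 + ennreal v * N3" if "0 \<le> v" for v
          using ln w12 that by (simp add: ennreal_mult)
        note this[of "w1 / s"]
        moreover have "0 \<le> w1 / s" using w12 s by simp
        ultimately show ?thesis by blast
      qed
      then show ?thesis using K by (simp add: ennreal_mult')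
    qed
    finally show ?thesis using LT by (rule order_trans[rotated])
  qed
  then show ?thesis unfolding K_def w1_def w2_def L1_def L2_def N3_def S1_def S2_def F_def E_def .
qed

text \<open>Both cut-offs equal 1 on ball a (t/2), so the difference vanishes around a. The
  condition 2 t < d places the support of the inner cut-off where the outer one is 1.\<close>

lemma test_functions_punctured:
  fixes V f \<phi> :: "real^'n \<Rightarrow> real"
  assumes f: "is_bump f" and \<phi>: "is_bump \<phi>" and t: "0 < t" "2 * t < d" and V: "smooth V"
  shows "(\<lambda>y. dil \<phi> a d y * V y - dil f a t y * V y) \<in> test_functions (ball a d - {a})"
proof (rule test_functionsI)
  have d: "d > 0" using t by simp
  note h = is_bump_dil[OF f t(1), of a] and ff = is_bump_dil[OF \<phi> d, of a]
  show "smooth (\<lambda>y. dil \<phi> a d y * V y - dil f a t y * V y)"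
    by (intro smooth_diff smooth_mult h ff V)
  show "compact (supp (dil \<phi> a d) - ball a (t/2))"
    using ff(1) by (intro compact_diff) (auto simp: test_functions_iff)
  show "supp (dil \<phi> a d) - ball a (t/2) \<subseteq> ball a d - {a}"
    using ff(1) t by (auto simp: test_functions_iff)
  fix y assume y: "y \<notin> supp (dil \<phi> a d) - ball a (t/2)"
  show "dil \<phi> a d y * V y - dil f a t y * V y = 0"
  proof (cases "dist a y < t / 2")
    case True then show ?thesis using h(5)[of y] ff(5)[of y] t by simp
  next
    case False
    then have ys: "y \<notin> supp (dil \<phi> a d)" using y by auto
    have "\<not> dist a y < d / 2" using not_in_supp[OF ys] ff(5)[of y] by auto
    then have "dil f a t y = 0" using not_in_supp[OF h(8)[of y]] t by auto
    then show ?thesis using not_in_supp[OF ys] by simp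
  qed
qed

text \<open>On S the weight is at least R powr (-\<tau>); multiplying by the inverse leaves the
  plain norm.\<close>

lemma weighted_norm_ge:
  fixes Z :: "real^'n \<Rightarrow> real"
  assumes p: "0 < p" and S: "S \<in> sets lebesgue" "T \<in> sets lebesgue" "S \<subseteq> T" and R: "0 < R" "0 < \<tau>"
    and V: "V \<in> borel_measurable (lebesgue_on S)" "\<And>y. y \<in> S \<Longrightarrow> y \<noteq> a \<and> dist a y \<le> R \<and> Z y = V y"
  shows "Lnorm p S V \<le> ennreal (R powr \<tau>) * Lnorm p T (\<lambda>y. norm (y - a) powr (-\<tau>) * Z y)"
proof -
  have "ennreal (R powr (-\<tau>)) * Lnorm p S V = Lnorm p S (\<lambda>y. R powr (-\<tau>) * V y)"
    using Lnorm_cmult[OF p S(1) V(1), of "R powr (-\<tau>)"] by simp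
  also have "\<dots> \<le> Lnorm p T (\<lambda>y. norm (y - a) powr (-\<tau>) * Z y)"
  proof (rule Lnorm_subset_mono[OF p S(1,2)])
    show "norm (R powr (-\<tau>) * V y) \<le> norm (norm (y - a) powr (-\<tau>) * Z y)" if "y \<in> S" for y
    proof -
      have "R powr (-\<tau>) \<le> norm (y - a) powr (-\<tau>)"
        using V(2)[OF that] R by (intro powr_mono2') (auto simp: dist_norm norm_minus_commute)
      then show ?thesis using V(2)[OF that] unfolding norm_mult by (intro mult_mono) auto
    qed
  qed (use S in auto)
  finally have "ennreal (R powr \<tau>) * (ennreal (R powr (-\<tau>)) * Lnorm p S V) \<le> ennreal (R powr \<tau>) * Lnorm p T (\<lambda>y. norm (y - a) powr (-\<tau>) * Z y)"
    by (rule mult_left_mono) simp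
  moreover have "ennreal (R powr \<tau>) * ennreal (R powr (-\<tau>)) = 1"
    using R by (simp add: ennreal_mult[symmetric] powr_add[symmetric])
  ultimately show ?thesis by (simp add: mult.assoc[symmetric])
qed

text \<open>On the shell between 3/2 d \<eta> and d \<rho> / 2 both W = U and a lower bound for the
  weight hold, so the Carleman inequality for W controls U there; its right-hand side is
  \<open>weighted_cutoff_estimate\<close>.\<close>

lemma smooth_carleman_estimate:
  fixes U q f \<phi> :: "real^'n \<Rightarrow> real" and a :: "real^'n"
  assumes n: "CARD('n) \<ge> 3" and C: "carleman TYPE('n) r \<kappa>" and \<kappa>: "0 \<le> \<kappa>" and U: "smooth U" and f: "is_bump f" and \<phi>: "is_bump \<phi>"
    and b: "\<And>x. norm (grad f x) \<le> b" "\<And>x. \<bar>lap f x\<bar> \<le> b"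
    and M: "Lnorm (real CARD('n)) (ball (0::real^'n) 1) (\<lambda>x. 1::real) \<le> ennreal M" "0 \<le> M"
    and d: "0 < d" and \<rho>: "0 < \<eta>" "\<eta> < \<rho> / 4" "\<rho> < 1/2" and \<tau>: "\<tau> \<in> Lambda CARD('n)"
    and sob: "\<And>\<psi>. \<psi> \<in> test_functions (ball a d) \<Longrightarrow> Lnorm (crit_p' CARD('n)) (ball a d) \<psi> \<le> ennreal \<sigma> * Lnorm 2 (ball a d) (grad \<psi>)"
    and \<sigma>: "0 \<le> \<sigma>" "0 \<le> \<theta>" "\<theta> * \<sigma>\<^sup>2 \<le> 1/2"
    and q: "q \<in> borel_measurable (lebesgue_on (ball a d))" "Lnorm (real CARD('n) / 2) (ball a d) q \<le> ennreal \<theta>" "Lnorm (real CARD('n) / 2) (ball a d) q \<le> ennreal r"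
  shows "Lnorm 2 (ball a (d * \<rho> / 2) - ball a (3/2 * (d * \<eta>))) U \<le>
    ennreal (M * d * \<kappa> * (8 * (1 + 4 * b * M * \<sigma> + 8 * b\<^sup>2 * M + b * M))) *
     (ennreal (\<eta> powr (-\<tau>)) * Lnorm (crit_p CARD('n)) (ball a (d/2) - ball a (3/8 * (d * \<eta>))) (\<lambda>y. lap U y + q y * U y)
      + ennreal (2 powr (-\<tau>)) * Lnorm (crit_p CARD('n)) (ball a d - ball a (d/2)) (\<lambda>y. lap (\<lambda>y. dil \<phi> a d y * U y) y + q y * (dil \<phi> a d y * U y))
      + ennreal (\<eta> powr (-\<tau>) / (d * \<eta>)) * Lnorm 2 (ball a (3 * (d * \<eta>))) U)"
proof -
  let ?p = "crit_p CARD('n)" and ?p' = "crit_p' CARD('n)" and ?D = "ball a d" and ?n = "real CARD('n)"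
  define s where "s = d * \<eta>"
  have \<eta>8: "\<eta> < 1/8" using \<rho> by simp
  have "d * \<eta> < d * (1/8)" using d \<eta>8 by (intro mult_strict_left_mono)
  then have s: "0 < s" "6 * s < d" using d \<rho> by (auto simp: s_def)
  have \<tau>0: "0 < \<tau>" using \<tau> by (simp add: Lambda_def)
  have p: "?p > 0" "?p' > 0" using crit_exponents[OF n] by auto
  have n0: "?n > 0" "CARD('n) \<ge> 1" using n by auto
  have b0: "b \<ge> 0" using b(1)[of 0] norm_ge_zero order_trans by blast
  define P where "P = ball a (d * \<rho> / 2) - ball a (3/2 * s)"
  have \<rho>0: "0 < \<rho>" using \<rho> by simp
  have dr: "d * \<rho> / 2 < d / 2" "0 < d * \<rho> / 2" "d * \<rho> / 2 \<le> d" using d \<rho> \<rho>0 mult_left_mono[of \<rho> 1 d] by auto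
  have P: "P \<in> sets lebesgue" "P \<subseteq> ?D" using dr by (auto simp: P_def)
  define W where "W = (\<lambda>y. dil \<phi> a d y * U y - dil f a (3/2 * s) y * U y)"
  have s32: "0 < 3/2 * s" "2 * (3/2 * s) < d" using s by auto
  have W: "W \<in> test_functions (?D - {a})" unfolding W_def
    by (rule test_functions_punctured[OF f \<phi> s32 U])
  define LW where "LW = Lnorm ?p ?D (\<lambda>y. norm (y - a) powr (-\<tau>) * (lap W y + q y * W y))"
  have mU: "U \<in> borel_measurable (lebesgue_on P)" by (rule smooth_measurable[OF U P(1)])
  have WU: "y \<noteq> a \<and> dist a y \<le> d * \<rho> / 2 \<and> W y = U y" if y: "y \<in> P" for y
  proof -
    have y1: "dist a y < d * \<rho> / 2" "3/2 * s \<le> dist a y" using y by (auto simp: P_def)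
    have "dist a y < d / 2" "3/2 * s \<le> dist a y" "dist a y \<le> d * \<rho> / 2"
      using less_trans[OF y1(1) dr(1)] y1 by simp_all
    moreover have "dil \<phi> a d y = 1" using is_bump_dil(5)[OF \<phi> d] calculation by blast
    moreover have "dil f a (3/2 * s) y = 0" using not_in_supp[OF is_bump_dil(8)[OF f s32(1)]] calculation by blast
    ultimately show ?thesis using s unfolding W_def by auto
  qed
  \<comment> \<open>The constant 1 in L^n lowers the exponent from p' to 2, at the cost of a factor
    M * d.\<close>
  have "Lnorm 2 P U = Lnorm 2 P (\<lambda>x. 1 * U x)" by simp
  also have "\<dots> \<le> Lnorm ?n P (\<lambda>x. 1::real) * Lnorm ?p' P U"
    using n0 p crit_exponents(7)[OF n] P mU by (intro Lnorm_Holder) auto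
  also have "\<dots> \<le> ennreal (M * d) * (ennreal ((d * \<rho> / 2) powr \<tau>) * (ennreal \<kappa> * LW))"
  proof (intro mult_mono)
    have "Lnorm ?n P (\<lambda>x. 1::real) \<le> Lnorm ?n ?D (\<lambda>x. 1::real)" using P n0 by (intro Lnorm_subset) auto
    also have "\<dots> = ennreal d * Lnorm ?n (ball (0::real^'n) 1) (\<lambda>x. 1::real)" by (rule Lnorm_one_ball[OF n0(2) d])
    also have "\<dots> \<le> ennreal d * ennreal M" by (intro mult_left_mono M) simp
    also have "\<dots> = ennreal (M * d)" using d M by (simp add: ennreal_mult[symmetric] mult.commute)
    finally show "Lnorm ?n P (\<lambda>x. 1::real) \<le> ennreal (M * d)" .
    have "Lnorm ?p' P U \<le> ennreal ((d * \<rho> / 2) powr \<tau>) * Lnorm ?p' ?D (\<lambda>y. norm (y - a) powr (-\<tau>) * W y)"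
      using P by (intro weighted_norm_ge[OF p(2) P(1) _ P(2) dr(2) \<tau>0 mU WU]) auto
    also have "\<dots> \<le> ennreal ((d * \<rho> / 2) powr \<tau>) * (ennreal \<kappa> * LW)"
      unfolding LW_def by (intro mult_left_mono carleman_ball[OF n C d W \<tau> q(1,3)]) simp
    finally show "Lnorm ?p' P U \<le> ennreal ((d * \<rho> / 2) powr \<tau>) * (ennreal \<kappa> * LW)" .
  qed auto
  finally have 1: "Lnorm 2 P U \<le> ennreal (M * d) * (ennreal ((d * \<rho> / 2) powr \<tau>) * (ennreal \<kappa> * LW))" .
  define K where "K = 8 * (1 + 4 * b * M * \<sigma> + 8 * b\<^sup>2 * M + b * M)"
  have K: "0 \<le> K" using b0 M \<sigma> by (simp add: K_def)
  define w1 where "w1 = (3/4 * s) powr (-\<tau>)"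
  define w2 where "w2 = (d/2) powr (-\<tau>)"
  define wr where "wr = (d * \<rho> / 2) powr \<tau>"
  define L1 where "L1 = Lnorm ?p (ball a (d/2) - ball a (3/8 * s)) (\<lambda>y. lap U y + q y * U y)"
  define L2 where "L2 = Lnorm ?p (ball a d - ball a (d/2)) (\<lambda>y. lap (\<lambda>y. dil \<phi> a d y * U y) y + q y * (dil \<phi> a d y * U y))"
  define N3 where "N3 = Lnorm 2 (ball a (3 * s)) U"
  have 2: "LW \<le> ennreal K * (ennreal w1 * L1 + ennreal w2 * L2 + ennreal (w1 / s) * N3)"
    unfolding LW_def W_def K_def w1_def w2_def L1_def L2_def N3_def
    by (rule weighted_cutoff_estimate[OF n U f \<phi> b M s \<tau>0 sob \<sigma> q(1,2)])
  have powr_inv: "x powr \<tau> * x powr (-\<tau>) = 1" if "x > 0" for x :: real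
    using that by (simp add: powr_add[symmetric])
  \<comment> \<open>The quotient of the radii d \<rho> / 2 and 3/4 d \<eta> is at most 1 / \<eta>,
    which amounts to \<rho> \<le> 3/2.\<close>
  have r1: "wr * w1 \<le> \<eta> powr (-\<tau>)"
  proof -
    have "w1 \<le> (\<eta> * (d * \<rho> / 2)) powr (-\<tau>)"
      unfolding w1_def s_def using d \<rho> \<rho>0 \<tau>0 by (intro powr_mono2') (auto simp: field_simps)
    also have "\<dots> = \<eta> powr (-\<tau>) * (d * \<rho> / 2) powr (-\<tau>)" by (rule powr_mult)
    finally have "wr * w1 \<le> wr * (\<eta> powr (-\<tau>) * (d * \<rho> / 2) powr (-\<tau>))" by (intro mult_left_mono) (auto simp: wr_def)
    also have "\<dots> = \<eta> powr (-\<tau>) * ((d * \<rho> / 2) powr \<tau> * (d * \<rho> / 2) powr (-\<tau>))" by (simp only: wr_def mult_ac)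
    also have "(d * \<rho> / 2) powr \<tau> * (d * \<rho> / 2) powr (-\<tau>) = 1" by (rule powr_inv[OF dr(2)])
    finally show ?thesis by simp
  qed
  \<comment> \<open>Here \<rho> < 1/2 enters: d / 2 is at least twice the radius d \<rho> /
    2.\<close>
  have r2: "wr * w2 \<le> 2 powr (-\<tau>)"
  proof -
    have "w2 \<le> (2 * (d * \<rho> / 2)) powr (-\<tau>)"
      unfolding w2_def using d \<rho> \<rho>0 \<tau>0 by (intro powr_mono2') (auto simp: field_simps)
    also have "\<dots> = 2 powr (-\<tau>) * (d * \<rho> / 2) powr (-\<tau>)" by (rule powr_mult)
    finally have "wr * w2 \<le> wr * (2 powr (-\<tau>) * (d * \<rho> / 2) powr (-\<tau>))" by (intro mult_left_mono) (auto simp: wr_def)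
    also have "\<dots> = 2 powr (-\<tau>) * ((d * \<rho> / 2) powr \<tau> * (d * \<rho> / 2) powr (-\<tau>))" by (simp only: wr_def mult_ac)
    also have "(d * \<rho> / 2) powr \<tau> * (d * \<rho> / 2) powr (-\<tau>) = 1" by (rule powr_inv[OF dr(2)])
    finally show ?thesis by simp
  qed
  have r3: "wr * (w1 / s) \<le> \<eta> powr (-\<tau>) / s" using divide_right_mono[OF r1, of s] s by simp
  have w0: "0 \<le> w1" "0 \<le> w2" "0 \<le> wr" "0 \<le> w1 / s" using s by (auto simp: w1_def w2_def wr_def)
  have "Lnorm 2 P U \<le> ennreal (M * d) * (ennreal wr * (ennreal \<kappa> * (ennreal K * (ennreal w1 * L1 + ennreal w2 * L2 + ennreal (w1 / s) * N3))))"
    unfolding wr_def by (rule order_trans[OF 1]) (intro mult_left_mono 2; simp)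
  also have "\<dots> = ennreal (M * d) * (ennreal \<kappa> * (ennreal K * (ennreal wr * ennreal w1 * L1 + ennreal wr * ennreal w2 * L2 + ennreal wr * ennreal (w1 / s) * N3)))"
    by (simp only: distrib_left mult_ac)
  also have "\<dots> \<le> ennreal (M * d) * (ennreal \<kappa> * (ennreal K * (ennreal (\<eta> powr (-\<tau>)) * L1 + ennreal (2 powr (-\<tau>)) * L2 + ennreal (\<eta> powr (-\<tau>) / s) * N3)))"
  proof -
    have e: "ennreal wr * ennreal w1 = ennreal (wr * w1)" "ennreal wr * ennreal w2 = ennreal (wr * w2)" "ennreal wr * ennreal (w1 / s) = ennreal (wr * (w1 / s))"
      using w0 by (simp_all only: ennreal_mult)
    show ?thesis unfolding e by (intro mult_left_mono add_mono mult_right_mono ennreal_leI r1 r2 r3) auto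
  qed
  also have "\<dots> = ennreal (M * d * \<kappa> * K) * (ennreal (\<eta> powr (-\<tau>)) * L1 + ennreal (2 powr (-\<tau>)) * L2 + ennreal (\<eta> powr (-\<tau>) / s) * N3)"
    using M d \<kappa> K by (simp add: ennreal_mult mult.assoc)
  finally show ?thesis unfolding P_def K_def L1_def L2_def N3_def s_def .
qed

subsection \<open>Passage to Sobolev functions\<close>

lemma Lnorm_tendsto_add:
  fixes f g :: "nat \<Rightarrow> real^'n \<Rightarrow> real"
  assumes p: "1 \<le> p" and S: "S \<in> sets lebesgue" and m: "\<And>k. f k \<in> borel_measurable (lebesgue_on S)" "\<And>k. g k \<in> borel_measurable (lebesgue_on S)"
   and l: "(\<lambda>k. Lnorm p S (f k)) \<longlonglongrightarrow> 0" "(\<lambda>k. Lnorm p S (g k)) \<longlonglongrightarrow> 0"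
  shows "(\<lambda>k. Lnorm p S (\<lambda>x. f k x + g k x)) \<longlonglongrightarrow> 0"
proof (rule tendsto_sandwich[OF _ _ tendsto_const])
  have "(\<lambda>k. 2 * (Lnorm p S (f k) + Lnorm p S (g k))) \<longlonglongrightarrow> 2 * (0 + 0)"
    by (intro ennreal_tendsto_cmult tendsto_add l) simp
  then show "(\<lambda>k. 2 * (Lnorm p S (f k) + Lnorm p S (g k))) \<longlonglongrightarrow> 0" by simp
  show "\<forall>\<^sub>F k in sequentially. Lnorm p S (\<lambda>x. f k x + g k x) \<le> 2 * (Lnorm p S (f k) + Lnorm p S (g k))"
    using Lnorm_add_le[OF p S m] by simp
qed simp

lemma Lnorm_tendsto_sum:
  fixes f :: "'i \<Rightarrow> nat \<Rightarrow> real^'n \<Rightarrow> real"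
  assumes p: "1 \<le> p" and S: "S \<in> sets lebesgue" and "finite I" and m: "\<And>i k. f i k \<in> borel_measurable (lebesgue_on S)"
   and l: "\<And>i. (\<lambda>k. Lnorm p S (f i k)) \<longlonglongrightarrow> 0"
  shows "(\<lambda>k. Lnorm p S (\<lambda>x. \<Sum>i\<in>I. f i k x)) \<longlonglongrightarrow> 0"
  using assms(3)
proof (induction I rule: finite_induct)
  case (insert j I)
  have "(\<lambda>k. Lnorm p S (\<lambda>x. f j k x + (\<Sum>i\<in>I. f i k x))) \<longlonglongrightarrow> 0"
    by (intro Lnorm_tendsto_add p S m l insert.IH borel_measurable_sum)
  then show ?case using insert by simp
qed simp

lemma Lnorm_tendsto_mult:
  fixes g :: "nat \<Rightarrow> real^'n \<Rightarrow> real"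
  assumes p: "0 < p" and S: "S \<in> sets lebesgue" "B \<in> sets lebesgue" and m: "\<And>k. g k \<in> borel_measurable (lebesgue_on B)"
   and c: "\<And>x. \<bar>c x\<bar> \<le> C" "\<And>x. x \<notin> B \<Longrightarrow> c x = 0"
   and l: "(\<lambda>k. Lnorm p B (g k)) \<longlonglongrightarrow> 0"
  shows "(\<lambda>k. Lnorm p S (\<lambda>x. c x * g k x)) \<longlonglongrightarrow> 0"
proof (rule tendsto_sandwich[OF _ _ tendsto_const])
  have C: "C \<ge> 0" using c(1)[of 0] by simp
  have "(\<lambda>k. ennreal C * Lnorm p B (g k)) \<longlonglongrightarrow> ennreal C * 0"
    by (intro ennreal_tendsto_cmult l) simp
  then show "(\<lambda>k. ennreal C * Lnorm p B (g k)) \<longlonglongrightarrow> 0" by simp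
  have "Lnorm p S (\<lambda>x. c x * g k x) \<le> ennreal C * Lnorm p B (g k)" for k
  proof -
    have "Lnorm p S (\<lambda>x. c x * g k x) \<le> Lnorm p B (\<lambda>x. C * g k x)"
      using p S c C by (intro Lnorm_subset_mono) (auto simp: abs_mult intro!: mult_right_mono)
    then show ?thesis using Lnorm_cmult[OF p S(2) m, of C] C by simp
  qed
  then show "\<forall>\<^sub>F k in sequentially. Lnorm p S (\<lambda>x. c x * g k x) \<le> ennreal C * Lnorm p B (g k)" by simp
qed simp

text \<open>Leibniz rule: the coefficients are bounded and supported in B, so convergence on B
  becomes convergence on D.\<close>

lemma lap_mult_tendsto:
  fixes U :: "nat \<Rightarrow> real^'n \<Rightarrow> real" and u c :: "real^'n \<Rightarrow> real"
  assumes p: "1 \<le> p" and D: "D \<in> sets lebesgue" "B \<in> sets lebesgue" "B \<subseteq> D" and c: "c \<in> test_functions B" and U: "\<And>k. smooth (U k)"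
    and m: "u \<in> borel_measurable (lebesgue_on D)" "\<And>i. v i \<in> borel_measurable (lebesgue_on D)" "W \<in> borel_measurable (lebesgue_on D)"
    and l0: "(\<lambda>k. Lnorm p B (\<lambda>x. U k x - u x)) \<longlonglongrightarrow> 0"
    and l1: "\<And>i. (\<lambda>k. Lnorm p B (\<lambda>x. pderiv_at i (U k) x - v i x)) \<longlonglongrightarrow> 0"
    and l2: "(\<lambda>k. Lnorm p B (\<lambda>x. lap (U k) x - W x)) \<longlonglongrightarrow> 0"
  shows "(\<lambda>k. Lnorm p D (\<lambda>x. lap (\<lambda>y. c y * U k y) x - (c x * W x + 2 * (\<Sum>i\<in>UNIV. pderiv_at i c x * v i x) + lap c x * u x))) \<longlonglongrightarrow> 0"
proof -
  have p0: "0 < p" using p by simp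
  have sc: "smooth c" using c test_functions_smooth by blast
  have out: "x \<notin> supp c" if "x \<notin> B" for x using that c by (auto simp: test_functions_iff)
  have "\<exists>C\<ge>0. \<forall>x. \<bar>c x\<bar> \<le> C" by (rule test_functions_bounded[OF c])
  then obtain C0 where C0: "\<And>x. \<bar>c x\<bar> \<le> C0" by blast
  have "\<forall>i. \<exists>C\<ge>0. \<forall>x. \<bar>pderiv_at i c x\<bar> \<le> C"
    using test_functions_bounded[OF test_functions_pderiv[OF c]] by blast
  then obtain C1 where C1': "\<And>i. C1 i \<ge> 0" and C1: "\<And>i x. \<bar>pderiv_at i c x\<bar> \<le> C1 i" by metis
  have "compact (supp (lap c))"
    by (rule compact_supp[of "supp c"]) (use c in \<open>simp_all add: test_functions_iff lap_eq_0\<close>)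
  then obtain C2 where C2: "\<And>x. \<bar>lap c x\<bar> \<le> C2"
    using continuous_compact_bounded[OF smooth_continuous[OF smooth_lap[OF sc]]] by blast
  have mB: "g \<in> borel_measurable (lebesgue_on B)" if "g \<in> borel_measurable (lebesgue_on D)" for g :: "real^'n \<Rightarrow> real"
    using measurable_restrict_mono[OF that D(3)] .
  note mB' = mB[OF m(1)] mB[OF m(2)] mB[OF m(3)]
  have sm: "g \<in> borel_measurable (lebesgue_on D)" "g \<in> borel_measurable (lebesgue_on B)" if "smooth g" for g
    using smooth_measurable[OF that] D by auto
  have mdiff: "(\<lambda>x. lap (U k) x - W x) \<in> borel_measurable (lebesgue_on B)"
    "(\<lambda>x. pderiv_at i (U k) x - v i x) \<in> borel_measurable (lebesgue_on B)"
    "(\<lambda>x. U k x - u x) \<in> borel_measurable (lebesgue_on B)" for k i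
    by (rule borel_measurable_diff; (rule mB' | rule sm(2), rule smooth_lap smooth_pderiv U, (rule U)?))+
  have t0: "(\<lambda>k. Lnorm p D (\<lambda>x. c x * (lap (U k) x - W x))) \<longlonglongrightarrow> 0"
    by (rule Lnorm_tendsto_mult[OF p0 D(1,2) mdiff(1) C0 _ l2]) (simp add: not_in_supp out)
  have t1: "(\<lambda>k. Lnorm p D (\<lambda>x. pderiv_at i c x * (pderiv_at i (U k) x - v i x))) \<longlonglongrightarrow> 0" for i
    by (rule Lnorm_tendsto_mult[OF p0 D(1,2) mdiff(2) C1 _ l1]) (simp add: pderiv_eq_0 out)
  have t2: "(\<lambda>k. Lnorm p D (\<lambda>x. lap c x * (U k x - u x))) \<longlonglongrightarrow> 0"
    by (rule Lnorm_tendsto_mult[OF p0 D(1,2) mdiff(3) C2 _ l0]) (simp add: lap_eq_0 out)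
  have m1: "(\<lambda>x. pderiv_at i c x * (pderiv_at i (U k) x - v i x)) \<in> borel_measurable (lebesgue_on D)" for i k
    by (intro borel_measurable_times borel_measurable_diff sm smooth_pderiv sc U m)
  have t1': "(\<lambda>k. Lnorm p D (\<lambda>x. \<Sum>i\<in>UNIV. pderiv_at i c x * (pderiv_at i (U k) x - v i x))) \<longlonglongrightarrow> 0"
    by (rule Lnorm_tendsto_sum[OF p D(1) _ m1 t1]) simp
  \<comment> \<open>The factor 2 of the Leibniz rule is written as a repeated summand, to which
    \<open>Lnorm_tendsto_add\<close> applies.\<close>
  have "(\<lambda>k. Lnorm p D (\<lambda>x. c x * (lap (U k) x - W x) + (((\<Sum>i\<in>UNIV. pderiv_at i c x * (pderiv_at i (U k) x - v i x))
     + (\<Sum>i\<in>UNIV. pderiv_at i c x * (pderiv_at i (U k) x - v i x))) + lap c x * (U k x - u x)))) \<longlonglongrightarrow> 0"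
    by (intro Lnorm_tendsto_add p D t0 t1' t2 borel_measurable_add borel_measurable_sum m1 borel_measurable_times borel_measurable_diff sm smooth_lap sc U m)
  moreover have "c x * (lap (U k) x - W x) + (((\<Sum>i\<in>UNIV. pderiv_at i c x * (pderiv_at i (U k) x - v i x))
     + (\<Sum>i\<in>UNIV. pderiv_at i c x * (pderiv_at i (U k) x - v i x))) + lap c x * (U k x - u x))
     = lap (\<lambda>y. c y * U k y) x - (c x * W x + 2 * (\<Sum>i\<in>UNIV. pderiv_at i c x * v i x) + lap c x * u x)" for k x
    unfolding lap_mult[OF sc U] by (simp add: right_diff_distrib sum_subtractf algebra_simps)
  ultimately show ?thesis by simp
qed

text \<open>Away from a the weight lies between positive constants, so the Carleman inequality
  raises L^p convergence of Laplacians to a Cauchy property in L^p'. The limit is identified by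
  \<open>ae\<close>.\<close>

lemma critical_convergence:
  fixes U :: "nat \<Rightarrow> real^'n \<Rightarrow> real" and u f \<phi> :: "real^'n \<Rightarrow> real"
  assumes n: "CARD('n) \<ge> 3" and C: "carleman TYPE('n) r \<kappa>" and f: "is_bump f" and \<phi>: "is_bump \<phi>"
    and t: "0 < t" "2 * t < d" "t < R'" "R' < d" and supp: "supp (dil \<phi> a d) \<subseteq> ball a R'" and \<tau>: "\<tau> \<in> Lambda CARD('n)"
    and U: "\<And>k. smooth (U k)"
    and m: "u \<in> borel_measurable (lebesgue_on (ball a d))" "\<And>i. v i \<in> borel_measurable (lebesgue_on (ball a d))" "W \<in> borel_measurable (lebesgue_on (ball a d))"
    and l0: "(\<lambda>k. Lnorm (crit_p CARD('n)) (ball a R') (\<lambda>x. U k x - u x)) \<longlonglongrightarrow> 0"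
    and l1: "\<And>i. (\<lambda>k. Lnorm (crit_p CARD('n)) (ball a R') (\<lambda>x. pderiv_at i (U k) x - v i x)) \<longlonglongrightarrow> 0"
    and l2: "(\<lambda>k. Lnorm (crit_p CARD('n)) (ball a R') (\<lambda>x. lap (U k) x - W x)) \<longlonglongrightarrow> 0"
    and ae: "AE x in lebesgue. x \<in> ball a R' \<longrightarrow> (\<lambda>k. U k x) \<longlonglongrightarrow> u x"
  shows "(\<lambda>k. Lnorm (crit_p' CARD('n)) (ball a d - ball a t) (\<lambda>x. dil \<phi> a d x * (U k x - u x))) \<longlonglongrightarrow> 0"
proof -
  let ?p = "crit_p CARD('n)" and ?p' = "crit_p' CARD('n)" and ?D = "ball a d" and ?B = "ball a R'"
  define S where "S = ?D - ball a t"
  have d: "d > 0" using t by simp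
  have p: "?p > 0" "?p' > 0" "?p \<ge> 1" using crit_exponents[OF n] by auto
  have \<tau>0: "0 < \<tau>" using \<tau> by (simp add: Lambda_def)
  have sets: "S \<in> sets lebesgue" "?D \<in> sets lebesgue" "?B \<in> sets lebesgue" "S \<subseteq> ?D" "?B \<subseteq> ?D" using t by (auto simp: S_def)
  note h = is_bump_dil[OF f t(1), of a] and ff = is_bump_dil[OF \<phi> d, of a]
  \<comment> \<open>\<open>c\<close> combines both cut-offs. The Laplacians of the products of
    \<open>c\<close> and \<open>U k\<close> converge in L^p to \<open>T\<close>, and \<delta>
    measures their distance from it.\<close>
  define c where "c = (\<lambda>y. dil \<phi> a d y + (- 1) * dil f a t y)"
  have c: "c \<in> test_functions ?B" unfolding c_def
  proof (intro test_functions_add test_functions_mult' smooth_const)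
    show "dil \<phi> a d \<in> test_functions ?B" using ff(1) supp by (simp add: test_functions_iff)
    show "dil f a t \<in> test_functions ?B" using h(1) t by (elim test_functions_mono[rotated]) auto
  qed
  have sc: "smooth c" using c test_functions_smooth by blast
  define T where "T = (\<lambda>x. c x * W x + 2 * (\<Sum>i\<in>UNIV. pderiv_at i c x * v i x) + lap c x * u x)"
  define \<delta> where "\<delta> k = Lnorm ?p ?D (\<lambda>x. lap (\<lambda>y. c y * U k y) x - T x)" for k
  have \<delta>: "\<delta> \<longlonglongrightarrow> 0" unfolding \<delta>_def T_def
    by (rule lap_mult_tendsto[OF p(3) sets(2,3,5) c U m l0 l1 l2])
  have smD: "g \<in> borel_measurable (lebesgue_on ?D)" if "smooth g" for g using smooth_measurable[OF that] sets by auto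
  have mT: "T \<in> borel_measurable (lebesgue_on ?D)" unfolding T_def
    by (intro borel_measurable_add borel_measurable_times borel_measurable_sum smD smooth_pderiv smooth_lap sc m smooth_const)
  \<comment> \<open>The factors are the lower bound of the weight up to radius d, the Carleman
    constant, made nonnegative, the upper bound of the weight from t / 2 on, and the 2 of
    \<open>Lnorm_add_le\<close>.\<close>
  define A where "A = d powr \<tau> * \<bar>\<kappa>\<bar> * (t/2) powr (-\<tau>) * 2"
  have A0: "A \<ge> 0" by (simp add: A_def)
  have key: "Lnorm ?p' S (\<lambda>x. dil \<phi> a d x * (U k x - U l x)) \<le> ennreal A * (\<delta> k + \<delta> l)" for k l
  proof -
    define V where "V = (\<lambda>x. U k x - U l x)"
    have V: "smooth V" unfolding V_def by (intro smooth_diff U)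
    define Z where "Z = (\<lambda>y. dil \<phi> a d y * V y - dil f a t y * V y)"
    have Z: "Z \<in> test_functions (?D - {a})" unfolding Z_def by (rule test_functions_punctured[OF f \<phi> t(1,2) V])
    have sZ: "smooth Z" using Z test_functions_smooth by blast
    have fV: "(\<lambda>x. dil \<phi> a d x * V x) \<in> borel_measurable (lebesgue_on S)"
      by (intro smooth_measurable smooth_mult ff V sets)
    have "Lnorm ?p' S (\<lambda>x. dil \<phi> a d x * V x) \<le> ennreal (d powr \<tau>) * Lnorm ?p' ?D (\<lambda>y. norm (y - a) powr (-\<tau>) * Z y)"
    proof (rule weighted_norm_ge[OF p(2) sets(1,2,4) d \<tau>0 fV])
      fix y assume y: "y \<in> S"
      then have "t \<le> dist a y" by (simp add: S_def)
      then have "dil f a t y = 0" using not_in_supp[OF h(8)] by blast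
      then show "y \<noteq> a \<and> dist a y \<le> d \<and> Z y = dil \<phi> a d y * V y" using y t by (auto simp: S_def Z_def)
    qed
    also have "\<dots> \<le> ennreal (d powr \<tau>) * (ennreal \<kappa> * Lnorm ?p ?D (\<lambda>y. norm (y - a) powr (-\<tau>) * (lap Z y + 0 * Z y)))"
    proof (intro mult_left_mono carleman_ball[OF n C d Z \<tau>])
      show "(\<lambda>x. 0) \<in> borel_measurable (lebesgue_on ?D)" by simp
    qed auto
    \<comment> \<open>\<open>Z\<close> vanishes within radius t / 2, so only the weight beyond it
      counts.\<close>
    also have "\<dots> \<le> ennreal (d powr \<tau>) * (ennreal \<bar>\<kappa>\<bar> * Lnorm ?p ?D (\<lambda>y. (t/2) powr (-\<tau>) * lap Z y))"
    proof (intro mult_mono order_refl ennreal_leI Lnorm_mono p sets)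
      fix y assume y: "y \<in> ?D"
      show "norm (norm (y - a) powr (-\<tau>) * (lap Z y + 0 * Z y)) \<le> norm ((t/2) powr (-\<tau>) * lap Z y)"
      proof (cases "dist a y < t / 2")
        case True
        have "Z x = 0" if "x \<in> ball a (t/2)" for x using that h(5)[of x] ff(5)[of x] t by (simp add: Z_def)
        then have "lap Z y = lap (\<lambda>x. 0) y" using True by (intro lap_local[of "ball a (t/2)"]) auto
        then show ?thesis by (simp add: lap_def pderiv_const)
      next
        case False
        have "norm (y - a) powr (-\<tau>) \<le> (t/2) powr (-\<tau>)"
          using False t \<tau>0 by (intro powr_mono2') (auto simp: dist_norm norm_minus_commute)
        then show ?thesis unfolding norm_mult by (intro mult_mono) auto
      qed
    qed auto
    also have "Lnorm ?p ?D (\<lambda>y. (t/2) powr (-\<tau>) * lap Z y) = ennreal ((t/2) powr (-\<tau>)) * Lnorm ?p ?D (lap Z)"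
      using Lnorm_cmult[OF p(1) sets(2) smD[OF smooth_lap[OF sZ]], of "(t/2) powr (-\<tau>)"] by simp
    finally have 1: "Lnorm ?p' S (\<lambda>x. dil \<phi> a d x * V x) \<le> ennreal (d powr \<tau>) * (ennreal \<bar>\<kappa>\<bar> * (ennreal ((t/2) powr (-\<tau>)) * Lnorm ?p ?D (lap Z)))" .
    have ZU: "Z = (\<lambda>y. c y * U k y - c y * U l y)" by (simp add: Z_def c_def V_def fun_eq_iff algebra_simps)
    have lZ: "lap Z x = lap (\<lambda>y. c y * U k y) x - lap (\<lambda>y. c y * U l y) x" for x
      unfolding ZU by (rule lap_diff) (intro smooth_mult sc U)+
    have mc: "lap (\<lambda>y. c y * U j y) \<in> borel_measurable (lebesgue_on ?D)" for j by (intro smD smooth_lap smooth_mult sc U)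
    have "Lnorm ?p ?D (lap Z) = Lnorm ?p ?D (\<lambda>x. (lap (\<lambda>y. c y * U k y) x - T x) + (-1) * (lap (\<lambda>y. c y * U l y) x - T x))"
      by (intro Lnorm_cong p sets) (simp add: lZ)
    also have "\<dots> \<le> 2 * (\<delta> k + Lnorm ?p ?D (\<lambda>x. (-1) * (lap (\<lambda>y. c y * U l y) x - T x)))"
      unfolding \<delta>_def using mc mT by (intro Lnorm_add_le p sets) auto
    also have "Lnorm ?p ?D (\<lambda>x. (-1) * (lap (\<lambda>y. c y * U l y) x - T x)) = \<delta> l"
      unfolding \<delta>_def by (intro Lnorm_cong p sets) simp
    finally have 2: "Lnorm ?p ?D (lap Z) \<le> 2 * (\<delta> k + \<delta> l)" .
    have "Lnorm ?p' S (\<lambda>x. dil \<phi> a d x * V x) \<le> ennreal (d powr \<tau>) * (ennreal \<bar>\<kappa>\<bar> * (ennreal ((t/2) powr (-\<tau>)) * (2 * (\<delta> k + \<delta> l))))"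
      by (rule order_trans[OF 1]) (intro mult_left_mono 2; simp)
    also have "\<dots> = ennreal A * (\<delta> k + \<delta> l)"
      unfolding A_def by (simp add: ennreal_mult'' ennreal_mult mult.assoc)
    finally show ?thesis unfolding V_def .
  qed
  show ?thesis
    unfolding S_def[symmetric]
  proof (rule tendsto_ennreal_zeroI)
    fix e :: real assume e: "e > 0"
    define e' where "e' = e / (2 * (A + 1))"
    have e': "e' > 0" "A * (2 * e') \<le> e" using e A0 by (auto simp: e'_def field_simps)
    have ev: "\<forall>\<^sub>F k in sequentially. \<delta> k \<le> ennreal e'" by (rule tendsto_ennreal_zeroD[OF \<delta> e'(1)])
    then show "\<forall>\<^sub>F k in sequentially. Lnorm ?p' S (\<lambda>x. dil \<phi> a d x * (U k x - u x)) \<le> ennreal e"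
    proof eventually_elim
      case (elim k)
      \<comment> \<open>Here k is fixed and l tends to infinity.\<close>
      show ?case
      proof (rule Lnorm_Fatou[OF p(2) sets(1), where f="\<lambda>l x. dil \<phi> a d x * (U k x - U l x)"])
        show "(\<lambda>x. dil \<phi> a d x * (U k x - U l x)) \<in> borel_measurable (lebesgue_on S)" for l
          by (intro smooth_measurable smooth_mult smooth_diff U ff sets)
        show "AE x in lebesgue. x \<in> S \<longrightarrow> (\<lambda>l. dil \<phi> a d x * (U k x - U l x)) \<longlonglongrightarrow> dil \<phi> a d x * (U k x - u x)"
          using ae
        proof eventually_elim
          case (elim x)
          show ?case
          proof (cases "x \<in> ?B")
            case True
            then show ?thesis using elim by (auto intro!: tendsto_intros)
          next
            case False
            then have "x \<notin> supp (dil \<phi> a d)" using supp by blast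
            then show ?thesis by (simp add: not_in_supp)
          qed
        qed
        show "\<forall>\<^sub>F l in sequentially. Lnorm ?p' S (\<lambda>x. dil \<phi> a d x * (U k x - U l x)) \<le> ennreal e"
          using ev
        proof eventually_elim
          case (elim l)
          have "Lnorm ?p' S (\<lambda>x. dil \<phi> a d x * (U k x - U l x)) \<le> ennreal A * (ennreal e' + ennreal e')"
            by (rule order_trans[OF key]) (intro mult_left_mono add_mono elim \<open>\<delta> k \<le> ennreal e'\<close>; simp)
          also have "\<dots> = ennreal (A * (2 * e'))" using e' A0 by (simp add: ennreal_plus[symmetric] ennreal_mult[symmetric] del: ennreal_plus)
          also have "\<dots> \<le> ennreal e" by (intro ennreal_leI e')
          finally show ?case .
        qed
      qed (use e in auto)
    qed
  qed
qed

text \<open>The largest distance from a is attained on K, hence is below d. This leaves room for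
  mollification between the support of the cut-off and the boundary of the ball.\<close>

lemma compact_subset_ball_shrink:
  fixes K :: "(real^'n) set"
  assumes "compact K" "K \<subseteq> ball a d" "r < d"
  obtains R where "r \<le> R" "R < d" "K \<subseteq> ball a R"
proof (cases "K = {}")
  case True then show ?thesis using that[of r] assms by simp
next
  case False
  have "continuous_on K (dist a)" by (intro continuous_intros)
  then obtain x where x: "x \<in> K" "\<And>y. y \<in> K \<Longrightarrow> dist a y \<le> dist a x"
    using continuous_attains_sup[OF assms(1) False] by blast
  have "dist a x < d" using x assms(2) by auto
  show ?thesis
  proof (rule that[of "max r ((dist a x + d) / 2)"])
    show "K \<subseteq> ball a (max r ((dist a x + d) / 2))"
    proof
      fix y assume "y \<in> K"
      from x(2)[OF this] \<open>dist a x < d\<close> show "y \<in> ball a (max r ((dist a x + d) / 2))"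
        by (simp add: less_max_iff_disj)
    qed
  qed (use \<open>dist a x < d\<close> assms(3) in auto)
qed

text \<open>Limit of \<open>smooth_carleman_estimate\<close> along mollifications. The new factor 4
  is due to \<open>Lnorm_add_le\<close>, applied once to the left-hand side and once to each norm on
  the right.\<close>

lemma weak_carleman_estimate:
  fixes u q f \<phi> :: "real^'n \<Rightarrow> real" and a :: "real^'n"
  assumes n: "CARD('n) \<ge> 3" and C: "carleman TYPE('n) r \<kappa>" and \<kappa>: "0 \<le> \<kappa>" and f: "is_bump f" and \<phi>: "is_bump \<phi>"
    and mo: "mollifier (J :: nat \<Rightarrow> real^'n \<Rightarrow> real)"
    and b: "\<And>x. norm (grad f x) \<le> b" "\<And>x. \<bar>lap f x\<bar> \<le> b"
    and M: "Lnorm (real CARD('n)) (ball (0::real^'n) 1) (\<lambda>x. 1::real) \<le> ennreal M" "0 \<le> M"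
    and d: "0 < d" and \<rho>: "0 < \<eta>" "\<eta> < \<rho> / 4" "\<rho> < 1/2" and \<tau>: "\<tau> \<in> Lambda CARD('n)"
    and sob: "\<And>\<psi>. \<psi> \<in> test_functions (ball a d) \<Longrightarrow> Lnorm (crit_p' CARD('n)) (ball a d) \<psi> \<le> ennreal \<sigma> * Lnorm 2 (ball a d) (grad \<psi>)"
    and \<sigma>: "0 \<le> \<sigma>" "0 \<le> \<theta>" "\<theta> * \<sigma>\<^sup>2 \<le> 1/2"
    and q: "q \<in> borel_measurable (lebesgue_on (ball a d))" "Lnorm (real CARD('n) / 2) (ball a d) q \<le> ennreal \<theta>" "Lnorm (real CARD('n) / 2) (ball a d) q \<le> ennreal r"
    and u: "u \<in> Lspace 2 (ball a d)" "u \<in> Lspace (crit_p CARD('n)) (ball a d)"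
    and v: "\<And>i. v i \<in> Lspace (crit_p CARD('n)) (ball a d)" "\<And>i. is_weak_deriv (ball a d) i u (v i)"
    and w: "\<And>i. w i \<in> Lspace (crit_p CARD('n)) (ball a d)" "\<And>i. is_weak_deriv (ball a d) i (v i) (w i)"
  shows "Lnorm 2 (ball a (d * \<rho> / 2) - ball a (3/2 * (d * \<eta>))) u \<le>
    4 * ennreal (M * d * \<kappa> * (8 * (1 + 4 * b * M * \<sigma> + 8 * b\<^sup>2 * M + b * M))) *
     (ennreal (\<eta> powr (-\<tau>)) * Lnorm (crit_p CARD('n)) (ball a (d/2) - ball a (3/8 * (d * \<eta>))) (\<lambda>y. (\<Sum>i\<in>UNIV. w i y) + q y * u y)
      + ennreal (2 powr (-\<tau>)) * Lnorm (crit_p CARD('n)) (ball a d - ball a (d/2))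
          (\<lambda>y. (dil \<phi> a d y * (\<Sum>i\<in>UNIV. w i y) + 2 * (\<Sum>i\<in>UNIV. pderiv_at i (dil \<phi> a d) y * v i y) + lap (dil \<phi> a d) y * u y) + q y * (dil \<phi> a d y * u y))
      + ennreal (\<eta> powr (-\<tau>) / (d * \<eta>)) * Lnorm 2 (ball a (3 * (d * \<eta>))) u)"
proof -
  let ?p = "crit_p CARD('n)" and ?p' = "crit_p' CARD('n)" and ?D = "ball a d" and ?f = "dil \<phi> a d"
  note ff = is_bump_dil[OF \<phi> d, of a]
  have p: "?p > 0" "?p' > 0" "?p \<ge> 1" using crit_exponents[OF n] by auto
  define s where "s = d * \<eta>"
  have "d * \<eta> < d * (1/8)" using d \<rho> by (intro mult_strict_left_mono) auto
  then have s: "0 < s" "8 * s < d" using d \<rho> by (auto simp: s_def)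
  \<comment> \<open>\<open>R'\<close> captures the support of the cut-off and, being at least 3/4 d,
    the ball of radius d / 2. \<open>R\<close> lies between \<open>R'\<close> and d to leave room
    for mollification.\<close>
  obtain R' where R': "3/4 * d \<le> R'" "R' < d" "supp ?f \<subseteq> ball a R'"
    using compact_subset_ball_shrink[of "supp ?f" a d "3/4 * d"] ff(1) d by (auto simp: test_functions_iff)
  let ?B = "ball a R'"
  define R where "R = (R' + d) / 2"
  have R: "0 < R'" "R' < R" "cball a R \<subseteq> ?D" using R' d by (auto simp: R_def)
  define P where "P = ball a (d * \<rho> / 2) - ball a (3/2 * s)"
  define S1 where "S1 = ball a (d/2) - ball a (3/8 * s)"
  define S2 where "S2 = ball a d - ball a (d/2)"
  define S where "S = ball a d - ball a (3/8 * s)"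
  define B3 where "B3 = ball a (3 * s)"
  have dr: "d * \<rho> / 2 < R'" using mult_strict_left_mono[OF \<rho>(3) d] d R'(1) by linarith
  have sets: "P \<in> sets lebesgue" "S1 \<in> sets lebesgue" "S2 \<in> sets lebesgue" "S \<in> sets lebesgue" "B3 \<in> sets lebesgue" "?D \<in> sets lebesgue" "?B \<in> sets lebesgue"
    by (auto simp: P_def S1_def S2_def S_def B3_def)
  have sub: "P \<subseteq> ?B" "S1 \<subseteq> ?B" "S1 \<subseteq> S" "S2 \<subseteq> S" "S \<subseteq> ?D" "B3 \<subseteq> ?B" "?B \<subseteq> ?D" "S1 \<subseteq> ?D" "S2 \<subseteq> ?D" "P \<subseteq> ?D" "B3 \<subseteq> ?D"
    using s dr R' d by (auto simp: P_def S1_def S2_def S_def B3_def)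
  have mD: "u \<in> borel_measurable (lebesgue_on ?D)" "v i \<in> borel_measurable (lebesgue_on ?D)" "w i \<in> borel_measurable (lebesgue_on ?D)" for i
    using u v(1)[of i] w(1)[of i] by (auto simp: Lspace_def)
  have fin: "Lnorm r (cball a R) g < \<infinity>" if "g \<in> Lspace r ?D" "r > 0" for r g
  proof -
    have "Lnorm r (cball a R) g \<le> Lnorm r ?D g" using that R by (intro Lnorm_subset) auto
    also have "\<dots> < \<infinity>" using that by (simp add: Lspace_def)
    finally show ?thesis .
  qed
  define W where "W = (\<lambda>y. \<Sum>i\<in>UNIV. w i y)"
  have mW: "W \<in> borel_measurable (lebesgue_on ?D)" unfolding W_def by (intro borel_measurable_sum mD)
  obtain U where U: "\<And>k. smooth (U k)"
    and l2: "(\<lambda>k. Lnorm 2 ?B (\<lambda>x. U k x - u x)) \<longlonglongrightarrow> 0"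
    and lp: "(\<lambda>k. Lnorm ?p ?B (\<lambda>x. U k x - u x)) \<longlonglongrightarrow> 0"
    and lv: "\<And>i. (\<lambda>k. Lnorm ?p ?B (\<lambda>x. pderiv_at i (U k) x - v i x)) \<longlonglongrightarrow> 0"
    and lw: "(\<lambda>k. Lnorm ?p ?B (\<lambda>x. lap (U k) x - W x)) \<longlonglongrightarrow> 0"
    and ae: "AE x in lebesgue. x \<in> ?B \<longrightarrow> (\<lambda>k. U k x) \<longlonglongrightarrow> u x"
  proof -
    have "\<exists>U. (\<forall>k. smooth (U k)) \<and>
      (\<lambda>k. Lnorm 2 (ball a R') (\<lambda>x. U k x - u x)) \<longlonglongrightarrow> 0 \<and>
      (\<lambda>k. Lnorm ?p (ball a R') (\<lambda>x. U k x - u x)) \<longlonglongrightarrow> 0 \<and>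
      (\<forall>i. (\<lambda>k. Lnorm ?p (ball a R') (\<lambda>x. pderiv_at i (U k) x - v i x)) \<longlonglongrightarrow> 0) \<and>
      (\<lambda>k. Lnorm ?p (ball a R') (\<lambda>x. lap (U k) x - (\<Sum>i\<in>UNIV. w i x))) \<longlonglongrightarrow> 0 \<and>
      (AE x in lebesgue. x \<in> ball a R' \<longrightarrow> (\<lambda>k. U k x) \<longlonglongrightarrow> u x)"
      using p by (intro smooth_approximation[OF mo R p(3) fin[OF u(1)] fin[OF u(2)] v(2) fin[OF v(1)] w(2) fin[OF w(1)]]) auto
    then show ?thesis using that unfolding W_def by blast
  qed
  have t: "0 < 3/8 * s" "2 * (3/8 * s) < d" "3/8 * s < R'" using s R' d by auto
  have crit: "(\<lambda>k. Lnorm ?p' S (\<lambda>x. ?f x * (U k x - u x))) \<longlonglongrightarrow> 0"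
    unfolding S_def by (rule critical_convergence[OF n C f \<phi> t R'(2,3) \<tau> U mD(1,2) mW lp lv lw ae])
  have mres: "g \<in> borel_measurable (lebesgue_on X)" if "g \<in> borel_measurable (lebesgue_on ?D)" "X \<subseteq> ?D" for g :: "real^'n \<Rightarrow> real" and X
    using measurable_restrict_mono[OF that] .
  have sm: "g \<in> borel_measurable (lebesgue_on ?D)" if "smooth g" for g using smooth_measurable[OF that] sets by auto
  have mdU: "(\<lambda>x. U k x - u x) \<in> borel_measurable (lebesgue_on ?D)" for k by (intro borel_measurable_diff sm U mD)
  have mqf: "(\<lambda>x. q x * (?f x * (U k x - u x))) \<in> borel_measurable (lebesgue_on ?D)" for k
    by (intro borel_measurable_times q(1) mdU sm ff)
  \<comment> \<open>The term that convergence in W^{2,p} alone does not provide: q in L^{n/2} is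
    paired with the convergence in L^p' away from a.\<close>
  have qS: "(\<lambda>k. Lnorm ?p S (\<lambda>x. q x * (?f x * (U k x - u x)))) \<longlonglongrightarrow> 0"
  proof (rule tendsto_sandwich[OF _ _ tendsto_const])
    have "(\<lambda>k. ennreal \<theta> * Lnorm ?p' S (\<lambda>x. ?f x * (U k x - u x))) \<longlonglongrightarrow> ennreal \<theta> * 0"
      by (intro ennreal_tendsto_cmult crit) simp
    then show "(\<lambda>k. ennreal \<theta> * Lnorm ?p' S (\<lambda>x. ?f x * (U k x - u x))) \<longlonglongrightarrow> 0" by simp
    have "Lnorm ?p S (\<lambda>x. q x * (?f x * (U k x - u x))) \<le> ennreal \<theta> * Lnorm ?p' S (\<lambda>x. ?f x * (U k x - u x))" for k
    proof -
      have "Lnorm ?p S (\<lambda>x. q x * (?f x * (U k x - u x))) \<le> Lnorm (real CARD('n) / 2) S q * Lnorm ?p' S (\<lambda>x. ?f x * (U k x - u x))"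
        using p n crit_exponents(5)[OF n] sets sub by (intro Lnorm_Holder mres[OF q(1)] mres[OF borel_measurable_times[OF sm[OF ff(2)] mdU]]) auto
      also have "\<dots> \<le> ennreal \<theta> * Lnorm ?p' S (\<lambda>x. ?f x * (U k x - u x))"
      proof (intro mult_right_mono)
        have "Lnorm (real CARD('n) / 2) S q \<le> Lnorm (real CARD('n) / 2) ?D q" using n sets sub by (intro Lnorm_subset) auto
        then show "Lnorm (real CARD('n) / 2) S q \<le> ennreal \<theta>" using q(2) by simp
      qed simp
      finally show ?thesis .
    qed
    then show "\<forall>\<^sub>F k in sequentially. Lnorm ?p S (\<lambda>x. q x * (?f x * (U k x - u x))) \<le> ennreal \<theta> * Lnorm ?p' S (\<lambda>x. ?f x * (U k x - u x))" by simp
  qed simp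
  have restr: "(\<lambda>k. Lnorm r X (g k)) \<longlonglongrightarrow> 0" if "(\<lambda>k. Lnorm r Y (g k)) \<longlonglongrightarrow> 0" "X \<in> sets lebesgue" "Y \<in> sets lebesgue" "X \<subseteq> Y" "r > 0"
    for X Y r and g :: "nat \<Rightarrow> real^'n \<Rightarrow> real"
    by (rule tendsto_sandwich[OF _ _ tendsto_const that(1)]) (use that in \<open>auto intro!: always_eventually Lnorm_subset\<close>)
  define F where "F = (\<lambda>y. W y + q y * u y)"
  define T where "T = (\<lambda>y. ?f y * W y + 2 * (\<Sum>i\<in>UNIV. pderiv_at i ?f y * v i y) + lap ?f y * u y)"
  define E where "E = (\<lambda>y. T y + q y * (?f y * u y))"
  define Fk where "Fk k = (\<lambda>y. lap (U k) y + q y * U k y)" for k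
  define Ek where "Ek k = (\<lambda>y. lap (\<lambda>y. ?f y * U k y) y + q y * (?f y * U k y))" for k
  have mT: "T \<in> borel_measurable (lebesgue_on ?D)" unfolding T_def
    by (intro borel_measurable_add borel_measurable_times borel_measurable_sum sm smooth_pderiv smooth_lap ff mD mW smooth_const)
  have mF: "F \<in> borel_measurable (lebesgue_on ?D)" unfolding F_def by (intro borel_measurable_add borel_measurable_times mW q mD)
  have mE: "E \<in> borel_measurable (lebesgue_on ?D)" unfolding E_def by (intro borel_measurable_add borel_measurable_times mT q mD sm ff)
  have mFk: "Fk k \<in> borel_measurable (lebesgue_on ?D)" for k unfolding Fk_def by (intro borel_measurable_add borel_measurable_times q sm smooth_lap U)
  have mEk: "Ek k \<in> borel_measurable (lebesgue_on ?D)" for k unfolding Ek_def by (intro borel_measurable_add borel_measurable_times q sm smooth_lap smooth_mult U ff)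
  have limF: "(\<lambda>k. Lnorm ?p S1 (\<lambda>y. Fk k y - F y)) \<longlonglongrightarrow> 0"
  proof -
    \<comment> \<open>The cut-off equals 1 on \<open>S1\<close>, so it may be inserted in front of U
      k - u there.\<close>
    have "(\<lambda>k. Lnorm ?p S1 (\<lambda>x. (lap (U k) x - W x) + q x * (?f x * (U k x - u x)))) \<longlonglongrightarrow> 0"
      by (intro Lnorm_tendsto_add p sets restr[OF lw] restr[OF qS] sub mres[OF borel_measurable_diff[OF sm[OF smooth_lap[OF U]] mW]] mres[OF mqf])
    moreover have "Lnorm ?p S1 (\<lambda>x. (lap (U k) x - W x) + q x * (?f x * (U k x - u x))) = Lnorm ?p S1 (\<lambda>y. Fk k y - F y)" for k
      using ff(5) by (intro Lnorm_cong p sets) (auto simp: S1_def Fk_def F_def algebra_simps)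
    ultimately show ?thesis by simp
  qed
  have limE: "(\<lambda>k. Lnorm ?p S2 (\<lambda>y. Ek k y - E y)) \<longlonglongrightarrow> 0"
  proof -
    have cB: "?f \<in> test_functions ?B" using ff(1) R' by (simp add: test_functions_iff)
    have lT: "(\<lambda>k. Lnorm ?p ?D (\<lambda>x. lap (\<lambda>y. ?f y * U k y) x - T x)) \<longlonglongrightarrow> 0"
      unfolding T_def by (rule lap_mult_tendsto[OF p(3) sets(6,7) sub(7) cB U mD(1,2) mW lp lv lw])
    have "(\<lambda>k. Lnorm ?p S2 (\<lambda>x. (lap (\<lambda>y. ?f y * U k y) x - T x) + q x * (?f x * (U k x - u x)))) \<longlonglongrightarrow> 0"
      by (intro Lnorm_tendsto_add p sets restr[OF qS] restr[OF lT] sub mres[OF borel_measurable_diff[OF sm[OF smooth_lap[OF smooth_mult[OF ff(2) U]]] mT]] mres[OF mqf])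
    moreover have "(\<lambda>x. (lap (\<lambda>y. ?f y * U k y) x - T x) + q x * (?f x * (U k x - u x))) = (\<lambda>y. Ek k y - E y)" for k
      by (simp add: fun_eq_iff Ek_def E_def algebra_simps)
    ultimately show ?thesis by simp
  qed
  have lim3: "(\<lambda>k. Lnorm 2 B3 (\<lambda>x. U k x - u x)) \<longlonglongrightarrow> 0" and limP: "(\<lambda>k. Lnorm 2 P (\<lambda>x. U k x - u x)) \<longlonglongrightarrow> 0"
    using sets sub by (auto intro: restr[OF l2])
  define c1 where "c1 = ennreal (\<eta> powr (-\<tau>))"
  define c2 where "c2 = ennreal (2 powr (-\<tau>))"
  define c3 where "c3 = ennreal (\<eta> powr (-\<tau>) / s)"
  define K where "K = ennreal (M * d * \<kappa> * (8 * (1 + 4 * b * M * \<sigma> + 8 * b\<^sup>2 * M + b * M)))"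
  have main: "Lnorm 2 P (U k) \<le> K * (c1 * Lnorm ?p S1 (Fk k) + c2 * Lnorm ?p S2 (Ek k) + c3 * Lnorm 2 B3 (U k))" for k
    unfolding P_def K_def c1_def c2_def c3_def S1_def S2_def Fk_def Ek_def B3_def s_def
    by (rule smooth_carleman_estimate[OF n C \<kappa> U f \<phi> b M d \<rho> \<tau> sob \<sigma> q])
  define \<alpha> where "\<alpha> k = Lnorm 2 P (\<lambda>x. U k x - u x)" for k
  define \<beta> where "\<beta> k = Lnorm ?p S1 (\<lambda>y. Fk k y - F y)" for k
  define \<gamma> where "\<gamma> k = Lnorm ?p S2 (\<lambda>y. Ek k y - E y)" for k
  define \<delta> where "\<delta> k = Lnorm 2 B3 (\<lambda>x. U k x - u x)" for k
  have bound: "Lnorm 2 P u \<le> 2 * (K * (c1 * (2 * (Lnorm ?p S1 F + \<beta> k)) + c2 * (2 * (Lnorm ?p S2 E + \<gamma> k)) + c3 * (2 * (Lnorm 2 B3 u + \<delta> k))) + \<alpha> k)" for k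
  proof -
    have tri: "Lnorm r X g \<le> 2 * (Lnorm r X h + Lnorm r X (\<lambda>x. g x - h x))"
      if "1 \<le> r" "X \<in> sets lebesgue" "X \<subseteq> ?D" "g \<in> borel_measurable (lebesgue_on ?D)" "h \<in> borel_measurable (lebesgue_on ?D)"
      for r X and g h :: "real^'n \<Rightarrow> real"
      using Lnorm_add_le[OF that(1,2) mres[OF that(5,3)] mres[OF borel_measurable_diff[OF that(4,5)] that(3)]] by simp
    have "Lnorm 2 P u \<le> 2 * (Lnorm 2 P (U k) + Lnorm 2 P (\<lambda>x. u x - U k x))"
      using sets sub by (intro tri mD sm U) auto
    also have "Lnorm 2 P (\<lambda>x. u x - U k x) = \<alpha> k"
      unfolding \<alpha>_def using sets by (intro Lnorm_cong) (auto simp: abs_minus_commute)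
    also have "Lnorm 2 P (U k) \<le> K * (c1 * (2 * (Lnorm ?p S1 F + \<beta> k)) + c2 * (2 * (Lnorm ?p S2 E + \<gamma> k)) + c3 * (2 * (Lnorm 2 B3 u + \<delta> k)))"
      unfolding \<beta>_def \<gamma>_def \<delta>_def
      by (rule order_trans[OF main]) (intro mult_left_mono add_mono tri p sets sub mF mE mFk mEk mD sm U; simp)
    finally show ?thesis by (simp add: add_mono mult_left_mono)
  qed
  have Kc: "K < top" "c1 < top" "c2 < top" "c3 < top" by (simp_all add: K_def c1_def c2_def c3_def)
  have "(\<lambda>k. 2 * (K * (c1 * (2 * (Lnorm ?p S1 F + \<beta> k)) + c2 * (2 * (Lnorm ?p S2 E + \<gamma> k)) + c3 * (2 * (Lnorm 2 B3 u + \<delta> k))) + \<alpha> k))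
     \<longlonglongrightarrow> 2 * (K * (c1 * (2 * (Lnorm ?p S1 F + 0)) + c2 * (2 * (Lnorm ?p S2 E + 0)) + c3 * (2 * (Lnorm 2 B3 u + 0))) + 0)"
    unfolding \<alpha>_def \<beta>_def \<gamma>_def \<delta>_def
    by (intro ennreal_tendsto_cmult tendsto_add tendsto_const limF limE lim3 limP Kc) simp_all
  then have "Lnorm 2 P u \<le> 2 * (K * (c1 * (2 * (Lnorm ?p S1 F + 0)) + c2 * (2 * (Lnorm ?p S2 E + 0)) + c3 * (2 * (Lnorm 2 B3 u + 0))) + 0)"
    by (rule tendsto_lowerbound) (use bound in auto)
  also have "\<dots> = 4 * K * (c1 * Lnorm ?p S1 F + c2 * Lnorm ?p S2 E + c3 * Lnorm 2 B3 u)"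
  proof -
    have "2 * (K * (c1 * (2 * x) + c2 * (2 * y) + c3 * (2 * z))) = (2 * 2) * K * (c1 * x + c2 * y + c3 * z)" for x y z :: ennreal
      by (simp only: distrib_left mult_ac)
    then show ?thesis by simp
  qed
  finally show ?thesis
    unfolding P_def K_def c1_def c2_def c3_def S1_def S2_def F_def E_def T_def W_def B3_def s_def .
qed

section \<open>From the shell to the full ball\<close>

lemma Lspace_subset:
  assumes "f \<in> Lspace p S" "0 < p" "S \<in> sets lebesgue" "T \<in> sets lebesgue" "T \<subseteq> S"
  shows "f \<in> Lspace p T"
proof -
  have "f \<in> borel_measurable (lebesgue_on T)"
    using assms by (auto simp: Lspace_def intro: measurable_restrict_mono)
  moreover have "Lnorm p T f \<le> Lnorm p S f" using assms by (intro Lnorm_subset)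
  ultimately show ?thesis using assms(1) by (auto simp: Lspace_def intro: le_less_trans)
qed

lemma ball_subset_of_infdist:
  assumes "infdist x (- S) = d" shows "ball x d \<subseteq> S"
proof
  fix y assume y: "y \<in> ball x d"
  show "y \<in> S"
  proof (rule ccontr)
    assume "y \<notin> S"
    then have "infdist x (- S) \<le> dist x y" by (intro infdist_le) simp
    then show False using y assms by simp
  qed
qed

lemma rho_m_bound:
  assumes "0 < \<eta>" "\<eta> < d"
  shows "Lnorm 2 (ball x \<eta>) u \<le> ennreal (\<eta> ^ m) * rho_m x d m u"
proof -
  have "ennreal (\<eta> powr (- real m)) * Lnorm 2 (ball x \<eta>) u \<le> rho_m x d m u"
    unfolding rho_m_def using assms by (intro SUP_upper) simp
  then have "ennreal (\<eta> ^ m) * (ennreal (\<eta> powr (- real m)) * Lnorm 2 (ball x \<eta>) u) \<le> ennreal (\<eta> ^ m) * rho_m x d m u"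
    by (rule mult_left_mono) simp
  moreover have "ennreal (\<eta> ^ m) * ennreal (\<eta> powr (- real m)) = 1"
    using assms by (simp add: ennreal_mult[symmetric] powr_minus powr_realpow)
  ultimately show ?thesis by (simp add: mult.assoc[symmetric])
qed

lemma bump_derivatives_bounded:
  fixes f :: "real^'n \<Rightarrow> real"
  assumes "is_bump f"
  obtains b where "0 \<le> b" "\<And>x. norm (grad f x) \<le> b" "\<And>x. \<bar>lap f x\<bar> \<le> b"
proof -
  have f: "f \<in> test_functions (ball 0 1)" using assms by (simp add: is_bump_def)
  obtain b1 where b1: "b1 \<ge> 0" "\<And>x. norm (grad f x) \<le> b1" using grad_bounded[OF f] by blast
  have "compact (supp (lap f))"
    by (rule compact_supp[of "supp f"]) (use f in \<open>simp_all add: test_functions_iff lap_eq_0\<close>)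
  then obtain b2 where b2: "\<And>x. \<bar>lap f x\<bar> \<le> b2"
    using continuous_compact_bounded[OF smooth_continuous[OF smooth_lap[OF test_functions_smooth[OF f]]]] by blast
  show ?thesis
    by (rule that[of "max b1 b2"]) (use b1 b2 in \<open>auto simp: le_max_iff_disj\<close>)
qed

theorem theorem3p3:
  fixes r_star r0 \<theta> d :: real
  assumes "CARD('n::finite) \<ge> 3"
    and "r_star > 0"
    and "\<And>r. 0 < r \<Longrightarrow> r < r_star \<Longrightarrow> \<exists>\<kappa>>0. carleman TYPE('n) r \<kappa>"
    and "0 < r0" and "r0 < r_star"
    and "\<theta> > 0" and "2 * ennreal \<theta> * (sobolev_const TYPE('n))\<^sup>2 < 1"
    and "d > 0"
  shows "\<exists>c>0. \<forall>(\<Omega> :: (real^'n) set) x0 \<rho> \<phi>.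
     open \<Omega> \<and> connected \<Omega> \<and> bounded \<Omega> \<and> x0 \<in> \<Omega> \<and> infdist x0 (- \<Omega>) = d \<and>
     0 < \<rho> \<and> \<rho> < 1 / 2 \<and>
     \<phi> \<in> test_functions (ball 0 1) \<and> (\<forall>x\<in>ball 0 (1 / 2). \<phi> x = 1) \<and> (\<forall>x. 0 \<le> \<phi> x \<and> \<phi> x \<le> 1) \<longrightarrow>
     (\<forall>m::nat. \<forall>\<tau> \<in> Lambda CARD('n). \<forall>q \<in> Qtilde \<Omega> x0 d (min r0 \<theta>).
      \<forall>u \<in> sobolev 2 (crit_p CARD('n)) \<Omega> \<inter> O_m \<Omega> x0 d m. \<forall>\<eta>.
        m \<ge> 1 \<and> 0 < \<eta> \<and> \<eta> < \<rho> / 4 \<longrightarrow>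
        (let p = crit_p CARD('n); D = ball x0 d;
             \<phi>u = (\<lambda>y. \<phi> ((y - x0) /\<^sub>R d) * u y)
         in ennreal c * Lnorm 2 (ball x0 (d * \<rho> / 2)) u
            \<le> ennreal (\<eta> powr (-\<tau>)) * Lnorm p D (\<lambda>y. weak_lap \<Omega> u y + q y * u y)
              + ennreal (2 powr (-(\<tau> + 1))) * Lnorm p D (\<lambda>y. weak_lap D \<phi>u y + q y * \<phi>u y)
              + ennreal ((3 * d) ^ m * \<eta> powr (real m - (\<tau> + 3))) * rho_m x0 d m u))"
proof (cases "\<exists>f :: real^'n \<Rightarrow> real. is_bump f")
  \<comment> \<open>No bump function has to be constructed: without one, the claim about all \<open>\<phi>\<close> is vacuous.
    The constant is built from a fixed \<open>f\<close>, because it must not depend on \<open>\<phi>\<close>.\<close>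
  case False
  then show ?thesis unfolding is_bump_def by (intro exI[of _ 1]) auto
next
  case True
  then obtain f :: "real^'n \<Rightarrow> real" where f: "is_bump f" by blast
  have n: "CARD('n) \<ge> 3" by fact
  have d: "d > 0" by fact
  let ?p = "crit_p CARD('n)" and ?n = "real CARD('n)"
  have p: "?p > 0" "?p \<ge> 1" using crit_exponents[OF n] by auto
  obtain \<kappa> where \<kappa>: "\<kappa> > 0" and C: "carleman TYPE('n) r0 \<kappa>" using assms by blast
  obtain J :: "nat \<Rightarrow> real^'n \<Rightarrow> real" where J: "mollifier J"
    using mollifier_exists[of f] f by (auto simp: is_bump_def)
  obtain b where b0: "0 \<le> b" and b: "\<And>x. norm (grad f x) \<le> b" "\<And>x. \<bar>lap f x\<bar> \<le> b"
    by (rule bump_derivatives_bounded[OF f]) blast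
  define M where "M = measure lebesgue (ball (0::real^'n) 1) powr (1 / ?n)"
  have M: "Lnorm ?n (ball (0::real^'n) 1) (\<lambda>x. 1::real) \<le> ennreal M" "0 \<le> M"
    using n by (simp_all add: M_def Lnorm_const)
  \<comment> \<open>An infinite supremum would contradict the smallness assumption, because \<theta>
    > 0.\<close>
  have "sobolev_const TYPE('n) \<noteq> top"
  proof
    assume "sobolev_const TYPE('n) = top"
    then have "2 * ennreal \<theta> * (sobolev_const TYPE('n))\<^sup>2 = top"
      using \<open>\<theta> > 0\<close> by (simp add: power2_eq_square ennreal_mult_top)
    then show False using assms(7) by simp
  qed
  then obtain \<sigma> where \<sigma>0: "0 \<le> \<sigma>" and \<sigma>: "sobolev_const TYPE('n) = ennreal \<sigma>"
    by (cases "sobolev_const TYPE('n)") auto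
  have \<theta>: "0 \<le> \<theta>" using \<open>\<theta> > 0\<close> by simp
  have \<theta>\<sigma>: "\<theta> * \<sigma>\<^sup>2 \<le> 1/2"
  proof -
    have "2 * ennreal \<theta> * (ennreal \<sigma>)\<^sup>2 = ennreal (2 * \<theta> * \<sigma>\<^sup>2)"
      using \<theta> \<sigma>0 by (simp add: ennreal_mult ennreal_power)
    then have "ennreal (2 * \<theta> * \<sigma>\<^sup>2) < 1" using assms(7) by (simp add: \<sigma>)
    then have "2 * \<theta> * \<sigma>\<^sup>2 < 1"
      using ennreal_leI[of 1 "2 * \<theta> * \<sigma>\<^sup>2"] by (cases "1 \<le> 2 * \<theta> * \<sigma>\<^sup>2") auto
    then show ?thesis by simp
  qed
  define K where "K = M * d * \<kappa> * (8 * (1 + 4 * b * M * \<sigma> + 8 * b\<^sup>2 * M + b * M))"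
  have K: "0 \<le> K" using M d \<kappa> b0 \<sigma>0 by (simp add: K_def)
  \<comment> \<open>L = 2 * (4 * K * \<beta> + 1) with \<beta> = 2 + 1 / d: the 4 comes from the
    passage to the limit, the 2 from splitting off the central ball, and the 1 is for that ball
    itself.\<close>
  define L where "L = 8 * K * (2 + 1 / d) + 2"
  have L: "L > 0" using K d by (auto simp: L_def intro!: add_nonneg_pos)
  show ?thesis
  proof (intro exI[of _ "1 / L"] conjI allI impI ballI)
    show "0 < 1 / L" using L by simp
    fix \<Omega> :: "(real^'n) set" and x0 :: "real^'n" and \<rho> :: real and \<phi> :: "real^'n \<Rightarrow> real" and m :: nat
      and \<tau> :: real and q u :: "real^'n \<Rightarrow> real" and \<eta> :: real
    assume H: "open \<Omega> \<and> connected \<Omega> \<and> bounded \<Omega> \<and> x0 \<in> \<Omega> \<and> infdist x0 (- \<Omega>) = d \<and>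
      0 < \<rho> \<and> \<rho> < 1 / 2 \<and>
      \<phi> \<in> test_functions (ball 0 1) \<and> (\<forall>x\<in>ball 0 (1 / 2). \<phi> x = 1) \<and> (\<forall>x. 0 \<le> \<phi> x \<and> \<phi> x \<le> 1)"
      and \<tau>: "\<tau> \<in> Lambda CARD('n)" and q: "q \<in> Qtilde \<Omega> x0 d (min r0 \<theta>)"
      and u: "u \<in> sobolev 2 ?p \<Omega> \<inter> O_m \<Omega> x0 d m" and \<eta>: "m \<ge> 1 \<and> 0 < \<eta> \<and> \<eta> < \<rho> / 4"
    let ?D = "ball x0 d"
    have \<phi>: "is_bump \<phi>" using H by (simp add: is_bump_def)
    have \<Omega>: "open \<Omega>" "?D \<subseteq> \<Omega>" using H ball_subset_of_infdist by blast+
    have sets: "\<Omega> \<in> sets lebesgue" "?D \<in> sets lebesgue" using \<Omega> by (auto simp: borel_open)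
    have \<rho>: "0 < \<eta>" "\<eta> < \<rho> / 4" "\<rho> < 1/2" "0 < \<rho>" using H \<eta> by auto
    have \<tau>0: "0 < \<tau>" using \<tau> by (simp add: Lambda_def)
    note LD = Lspace_subset[OF _ _ sets \<Omega>(2)]
    have qm: "q \<in> borel_measurable (lebesgue_on ?D)"
      using LD[of q "?n / 2"] q n by (simp add: Qtilde_def Lspace_def)
    \<comment> \<open>The bound by r0 serves the Carleman inequality, the bound by \<theta> the
      Caccioppoli estimate.\<close>
    have "Lnorm (?n / 2) ?D q \<le> ennreal (min r0 \<theta>)" using q by (simp add: Qtilde_def)
    then have qn: "Lnorm (?n / 2) ?D q \<le> ennreal \<theta>" "Lnorm (?n / 2) ?D q \<le> ennreal r0"
      by (auto elim!: order_trans intro!: ennreal_leI)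
    have uS: "u \<in> Lspace ?p \<Omega>" "\<forall>i. \<exists>g\<in>sobolev (Suc 0) ?p \<Omega>. is_weak_deriv \<Omega> i u g" "u \<in> Lspace 2 \<Omega>"
      using u by (auto simp: numeral_2_eq_2 O_m_def)
    obtain v where v: "\<And>i. v i \<in> sobolev (Suc 0) ?p \<Omega>" "\<And>i. is_weak_deriv \<Omega> i u (v i)" using uS(2) by metis
    have "\<forall>i. \<exists>g\<in>Lspace ?p \<Omega>. is_weak_deriv \<Omega> i (v i) g" using v(1) by auto
    then obtain w where w: "\<And>i. w i \<in> Lspace ?p \<Omega>" "\<And>i. is_weak_deriv \<Omega> i (v i) (w i)" by metis
    have vL: "\<And>i. v i \<in> Lspace ?p \<Omega>" using v(1) by auto
    have sob: "Lnorm (crit_p' CARD('n)) ?D \<psi> \<le> ennreal \<sigma> * Lnorm 2 ?D (grad \<psi>)" if "\<psi> \<in> test_functions ?D" for \<psi>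
      using sobolev_inequality_ball[OF J n d that] by (simp add: \<sigma>)
    define W where "W = (\<lambda>y. \<Sum>i\<in>UNIV. w i y)"
    define T where "T = (\<lambda>y. dil \<phi> x0 d y * W y + 2 * (\<Sum>i\<in>UNIV. pderiv_at i (dil \<phi> x0 d) y * v i y) + lap (dil \<phi> x0 d) y * u y)"
    define P where "P = ball x0 (d * \<rho> / 2) - ball x0 (3/2 * (d * \<eta>))"
    define B3 where "B3 = ball x0 (3 * (d * \<eta>))"
    define LF where "LF = Lnorm ?p ?D (\<lambda>y. weak_lap \<Omega> u y + q y * u y)"
    define LE where "LE = Lnorm ?p ?D (\<lambda>y. weak_lap ?D (\<lambda>y. dil \<phi> x0 d y * u y) y + q y * (dil \<phi> x0 d y * u y))"
    have est: "Lnorm 2 P u \<le> 4 * ennreal K *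
       (ennreal (\<eta> powr (-\<tau>)) * Lnorm ?p (ball x0 (d/2) - ball x0 (3/8 * (d * \<eta>))) (\<lambda>y. W y + q y * u y)
       + ennreal (2 powr (-\<tau>)) * Lnorm ?p (ball x0 d - ball x0 (d/2)) (\<lambda>y. T y + q y * (dil \<phi> x0 d y * u y))
       + ennreal (\<eta> powr (-\<tau>) / (d * \<eta>)) * Lnorm 2 B3 u)"
      unfolding P_def K_def W_def T_def B3_def
    proof (rule weak_carleman_estimate[OF n C less_imp_le[OF \<kappa>] f \<phi> J b M d \<rho>(1-3) \<tau> sob \<sigma>0 \<theta> \<theta>\<sigma> qm qn])
      show "u \<in> Lspace 2 ?D" by (rule LD[OF uS(3)]) simp
      show "u \<in> Lspace ?p ?D" by (rule LD[OF uS(1) p(1)])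
      show "v i \<in> Lspace ?p ?D" "w i \<in> Lspace ?p ?D" for i by (rule LD[OF vL p(1)], rule LD[OF w(1) p(1)])
      show "is_weak_deriv ?D i u (v i)" "is_weak_deriv ?D i (v i) (w i)" for i
        by (rule is_weak_deriv_subset[OF v(2) \<Omega>(2)], rule is_weak_deriv_subset[OF w(2) \<Omega>(2)])
    qed
    have 1: "Lnorm ?p (ball x0 (d/2) - ball x0 (3/8 * (d * \<eta>))) (\<lambda>y. W y + q y * u y) \<le> LF"
    proof -
      have "Lnorm ?p (ball x0 (d/2) - ball x0 (3/8 * (d * \<eta>))) (\<lambda>y. W y + q y * u y) \<le> Lnorm ?p ?D (\<lambda>y. W y + q y * u y)"
        using p d by (intro Lnorm_subset) auto
      also have "\<dots> = LF" unfolding LF_def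
      proof (rule Lnorm_cong_AE[OF p(1) sets(2)])
        show "AE x in lebesgue. x \<in> ?D \<longrightarrow> norm (W x + q x * u x) = norm (weak_lap \<Omega> u x + q x * u x)"
          using weak_lap_AE_eq[OF J \<Omega>(1) v(2) w(2)] by eventually_elim (use \<Omega>(2) in \<open>auto simp: W_def\<close>)
      qed
      finally show ?thesis .
    qed
    have 2: "Lnorm ?p (ball x0 d - ball x0 (d/2)) (\<lambda>y. T y + q y * (dil \<phi> x0 d y * u y)) \<le> LE"
    proof -
      have "Lnorm ?p (ball x0 d - ball x0 (d/2)) (\<lambda>y. T y + q y * (dil \<phi> x0 d y * u y)) \<le> Lnorm ?p ?D (\<lambda>y. T y + q y * (dil \<phi> x0 d y * u y))"
        using p by (intro Lnorm_subset) auto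
      also have "\<dots> = LE" unfolding LE_def
      proof (rule Lnorm_cong_AE[OF p(1) sets(2)])
        show "AE x in lebesgue. x \<in> ?D \<longrightarrow> norm (T x + q x * (dil \<phi> x0 d x * u x))
           = norm (weak_lap ?D (\<lambda>y. dil \<phi> x0 d y * u y) x + q x * (dil \<phi> x0 d x * u x))"
          using weak_lap_mult_smooth[OF J open_ball is_bump_dil(2)[OF \<phi> d, of x0] is_weak_deriv_subset[OF v(2) \<Omega>(2)] is_weak_deriv_subset[OF w(2) \<Omega>(2)]]
          by eventually_elim (simp add: T_def W_def)
      qed
      finally show ?thesis .
    qed
    have "\<eta> < 1/8" using \<rho> by simp
    have "d * \<eta> < d * (1/8)" using d \<open>\<eta> < 1/8\<close> by (intro mult_strict_left_mono)
    then have s: "0 < d * \<eta>" "3 * (d * \<eta>) < d" using d \<rho> by auto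
    define X where "X = (3 * d) ^ m * \<eta> powr (real m - (\<tau> + 3))"
    have X: "X \<ge> 0" using d by (simp add: X_def)
    have X1: "(3 * (d * \<eta>)) ^ m \<le> X"
    proof -
      have "\<eta> ^ m \<le> \<eta> powr (real m - (\<tau> + 3))"
        using \<rho> \<tau>0 \<open>\<eta> < 1/8\<close> powr_mono'[of "real m - (\<tau> + 3)" "real m" \<eta>] by (simp add: powr_realpow)
      then have "(3 * d) ^ m * \<eta> ^ m \<le> X" unfolding X_def using d by (intro mult_left_mono) auto
      then show ?thesis by (simp add: power_mult_distrib mult.assoc)
    qed
    \<comment> \<open>The estimate yields the exponent m - (\<tau> + 1); since \<eta> < 1, the power
      with \<tau> + 3 in place of \<tau> + 1 is larger.\<close>
    have X2: "\<eta> powr (-\<tau>) / (d * \<eta>) * (3 * (d * \<eta>)) ^ m \<le> 1 / d * X"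
    proof -
      have "\<eta> powr (-\<tau>) / (d * \<eta>) * (3 * (d * \<eta>)) ^ m = 1 / d * ((3 * d) ^ m * (\<eta> powr (-\<tau>) * \<eta> powr (real m) * \<eta> powr (-1)))"
        using \<rho>(1) d by (simp add: power_mult_distrib powr_realpow powr_minus field_simps)
      also have "\<eta> powr (-\<tau>) * \<eta> powr (real m) * \<eta> powr (-1) = \<eta> powr (real m - (\<tau> + 1))"
        unfolding powr_add[symmetric] by (simp add: algebra_simps)
      also have "1 / d * ((3 * d) ^ m * \<eta> powr (real m - (\<tau> + 1))) \<le> 1 / d * X"
        unfolding X_def using \<rho> d \<open>\<eta> < 1/8\<close> by (intro mult_left_mono powr_mono') auto
      finally show ?thesis .
    qed
    define R where "R = rho_m x0 d m u"
    \<comment> \<open>Since 3 d \<eta> < d, this radius is admissible in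
      \<open>rho_m\<close>.\<close>
    have B3: "Lnorm 2 B3 u \<le> ennreal ((3 * (d * \<eta>)) ^ m) * R"
      unfolding B3_def R_def using s by (intro rho_m_bound) auto
    define A1 where "A1 = ennreal (\<eta> powr (-\<tau>)) * LF"
    define A2 where "A2 = ennreal (2 powr (-(\<tau> + 1))) * LE"
    define A3 where "A3 = ennreal X * R"
    \<comment> \<open>One constant for three factors: 1 for \<open>A1\<close>, 2 for
      \<open>A2\<close> because 2 powr (-\<tau>) is twice 2 powr (-(\<tau> + 1)), and 1 / d for
      \<open>A3\<close>.\<close>
    define \<beta> where "\<beta> = 2 + 1 / d"
    have \<beta>: "1 \<le> \<beta>" "2 \<le> \<beta>" "1 / d \<le> \<beta>" "0 \<le> \<beta>" using d by (auto simp: \<beta>_def)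
    have B3X: "Lnorm 2 B3 u \<le> A3"
      unfolding A3_def by (rule order_trans[OF B3]) (intro mult_right_mono ennreal_leI X1; simp)
    have inner: "ennreal (\<eta> powr (-\<tau>)) * Lnorm ?p (ball x0 (d/2) - ball x0 (3/8 * (d * \<eta>))) (\<lambda>y. W y + q y * u y)
       + ennreal (2 powr (-\<tau>)) * Lnorm ?p (ball x0 d - ball x0 (d/2)) (\<lambda>y. T y + q y * (dil \<phi> x0 d y * u y))
       + ennreal (\<eta> powr (-\<tau>) / (d * \<eta>)) * Lnorm 2 B3 u \<le> ennreal \<beta> * A1 + ennreal \<beta> * A2 + ennreal \<beta> * A3"
    proof (intro add_mono)
      have "1 * A1 \<le> ennreal \<beta> * A1" using \<beta> by (intro mult_right_mono) auto
      then show "ennreal (\<eta> powr (-\<tau>)) * Lnorm ?p (ball x0 (d/2) - ball x0 (3/8 * (d * \<eta>))) (\<lambda>y. W y + q y * u y) \<le> ennreal \<beta> * A1"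
        using mult_left_mono[OF 1, of "ennreal (\<eta> powr (-\<tau>))"] unfolding A1_def by simp
      have "(2::real) powr (-\<tau>) = 2 * 2 powr (-(\<tau> + 1))" using powr_add[of 2 1 "-(\<tau> + 1)"] by simp
      then have "ennreal (2 powr (-\<tau>)) = ennreal 2 * ennreal (2 powr (-(\<tau> + 1)))" by (simp only: ennreal_mult powr_ge_zero zero_le_numeral)
      then have "ennreal (2 powr (-\<tau>)) * LE = ennreal 2 * A2" unfolding A2_def by (simp only: mult.assoc)
      also have "\<dots> \<le> ennreal \<beta> * A2" using \<beta> by (intro mult_right_mono ennreal_leI) auto
      finally show "ennreal (2 powr (-\<tau>)) * Lnorm ?p (ball x0 d - ball x0 (d/2)) (\<lambda>y. T y + q y * (dil \<phi> x0 d y * u y)) \<le> ennreal \<beta> * A2"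
        using mult_left_mono[OF 2, of "ennreal (2 powr (-\<tau>))"] by simp
      have "ennreal (\<eta> powr (-\<tau>) / (d * \<eta>)) * Lnorm 2 B3 u \<le> ennreal (\<eta> powr (-\<tau>) / (d * \<eta>)) * (ennreal ((3 * (d * \<eta>)) ^ m) * R)"
        by (intro mult_left_mono B3) simp
      also have "\<dots> = ennreal (\<eta> powr (-\<tau>) / (d * \<eta>) * (3 * (d * \<eta>)) ^ m) * R"
      proof -
        have "0 \<le> \<eta> powr (-\<tau>) / (d * \<eta>)" "0 \<le> (3 * (d * \<eta>)) ^ m" using s by (simp_all del: power_mult_distrib)
        then show ?thesis by (simp only: ennreal_mult mult.assoc)
      qed
      also have "\<dots> \<le> ennreal (1 / d * X) * R" by (intro mult_right_mono ennreal_leI X2) simp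
      also have "\<dots> \<le> ennreal (\<beta> * X) * R" using \<beta> X by (intro mult_right_mono ennreal_leI) auto
      also have "\<dots> = ennreal \<beta> * A3" unfolding A3_def using \<beta> X by (simp add: ennreal_mult mult.assoc)
      finally show "ennreal (\<eta> powr (-\<tau>) / (d * \<eta>)) * Lnorm 2 B3 u \<le> ennreal \<beta> * A3" .
    qed
    have Pu: "Lnorm 2 P u \<le> ennreal (4 * K * \<beta>) * (A1 + A2 + A3)"
    proof -
      have "Lnorm 2 P u \<le> 4 * ennreal K * (ennreal \<beta> * A1 + ennreal \<beta> * A2 + ennreal \<beta> * A3)"
        by (rule order_trans[OF est]) (intro mult_left_mono inner; simp)
      also have "\<dots> = 4 * ennreal K * ennreal \<beta> * (A1 + A2 + A3)" by (simp only: distrib_left mult.assoc)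
      also have "4 * ennreal K * ennreal \<beta> = ennreal (4 * K * \<beta>)" using K \<beta> by (simp add: ennreal_mult)
      finally show ?thesis .
    qed
    have um: "u \<in> borel_measurable (lebesgue_on (ball x0 (d * \<rho> / 2)))"
    proof -
      have "d * \<rho> / 2 \<le> d" using d \<rho> mult_left_mono[of \<rho> 1 d] by simp
      then have "ball x0 (d * \<rho> / 2) \<subseteq> \<Omega>" using \<Omega>(2) by force
      then show ?thesis using uS(3) by (auto simp: Lspace_def intro: measurable_restrict_mono)
    qed
    \<comment> \<open>The shell estimate omits the ball of radius 3/2 d \<eta>; it lies in
      \<open>B3\<close> and is controlled by \<open>rho_m\<close> directly.\<close>
    have "Lnorm 2 (ball x0 (d * \<rho> / 2)) u \<le> 2 * (Lnorm 2 P u + Lnorm 2 B3 u)"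
    proof -
      let ?Q = "ball x0 (d * \<rho> / 2)"
      have ind: "(indicator Y :: real^'n \<Rightarrow> real) \<in> borel_measurable (lebesgue_on ?Q)" if "Y \<in> sets lebesgue" for Y
        using that by (intro measurable_restrict_space1 borel_measurable_indicator)
      have PB: "P \<in> sets lebesgue" "ball x0 (3/2 * (d * \<eta>)) \<in> sets lebesgue" "B3 \<in> sets lebesgue" by (auto simp: P_def B3_def)
      have "Lnorm 2 ?Q u = Lnorm 2 ?Q (\<lambda>x. indicator P x * u x + indicator (ball x0 (3/2 * (d * \<eta>))) x * u x)"
        by (intro Lnorm_cong) (auto simp: P_def indicator_def)
      also have "\<dots> \<le> 2 * (Lnorm 2 ?Q (\<lambda>x. indicator P x * u x) + Lnorm 2 ?Q (\<lambda>x. indicator (ball x0 (3/2 * (d * \<eta>))) x * u x))"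
        by (intro Lnorm_add_le borel_measurable_times ind PB um) auto
      also have "\<dots> \<le> 2 * (Lnorm 2 P u + Lnorm 2 B3 u)"
      proof (intro mult_left_mono add_mono)
        show "Lnorm 2 ?Q (\<lambda>x. indicator P x * u x) \<le> Lnorm 2 P u"
          using PB by (intro Lnorm_subset_mono) auto
        show "Lnorm 2 ?Q (\<lambda>x. indicator (ball x0 (3/2 * (d * \<eta>))) x * u x) \<le> Lnorm 2 B3 u"
          using PB s by (intro Lnorm_subset_mono) (auto simp: B3_def indicator_def)
      qed simp
      finally show ?thesis .
    qed
    also have "\<dots> \<le> 2 * (ennreal (4 * K * \<beta>) * (A1 + A2 + A3) + (A1 + A2 + A3))"
      using B3X by (intro mult_left_mono add_mono Pu) (auto intro: order_trans)
    also have "\<dots> = ennreal L * (A1 + A2 + A3)"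
    proof -
      have "ennreal L = 2 * (ennreal (4 * K * \<beta>) + 1)"
      proof -
        have "L = 2 * (4 * K * \<beta> + 1)" by (simp add: L_def \<beta>_def algebra_simps)
        moreover have "ennreal (2 * (y + 1)) = 2 * (ennreal y + 1)" if "0 \<le> y" for y
          using that by (simp add: ennreal_mult')
        moreover have "0 \<le> 4 * K * \<beta>" using K \<beta> by simp
        ultimately show ?thesis by metis
      qed
      then show ?thesis by (simp add: distrib_right mult.assoc distrib_left)
    qed
    finally have "ennreal (1 / L) * Lnorm 2 (ball x0 (d * \<rho> / 2)) u \<le> ennreal (1 / L) * (ennreal L * (A1 + A2 + A3))"
      by (rule mult_left_mono) simp
    also have "\<dots> = A1 + A2 + A3"
    proof -
      have "ennreal (1 / L) * ennreal L = 1" using L by (simp add: ennreal_mult[symmetric])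
      then show ?thesis by (simp add: mult.assoc[symmetric])
    qed
    finally show "let p = ?p; D = ball x0 d; \<phi>u = (\<lambda>y. \<phi> ((y - x0) /\<^sub>R d) * u y)
         in ennreal (1 / L) * Lnorm 2 (ball x0 (d * \<rho> / 2)) u
            \<le> ennreal (\<eta> powr (-\<tau>)) * Lnorm p D (\<lambda>y. weak_lap \<Omega> u y + q y * u y)
              + ennreal (2 powr (-(\<tau> + 1))) * Lnorm p D (\<lambda>y. weak_lap D \<phi>u y + q y * \<phi>u y)
              + ennreal ((3 * d) ^ m * \<eta> powr (real m - (\<tau> + 3))) * rho_m x0 d m u"
      unfolding Let_def A1_def A2_def A3_def LF_def LE_def R_def X_def dil_def .
  qed
qed

end
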